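(* Let $(X,\mu)$ be a standard measure space with sigma-finite measure $\mu$, and let $T$ be an ergodic automorphism of $(X,\mu)$ satisfying the following two conditions: (i) $T$ has property $(\perp)$; (ii) for every integer $n>0$ the power $T^n$ has exactly $n$ invariant ergodic sets. Then $T$ has no roots, and the Poisson suspension $P(T)$ has no roots.
   Context: An automorphism of a measure space is an invertible bi-measurable measure-preserving transformation; automorphisms, sets and equalities between them are considered modulo null sets. The automorphism $T$ of $(X,\mu)$ induces an orthogonal (unitary, over the complex numbers) operator on $L_2(\mu)$, $f\mapsto f\circ T$, also denoted by $T$. Property $(\perp)$: the spectral measure $\sigma$ of $T$ (a measure on the unit circle representing the maximal spectral type of the operator $T$ on $L_2(\mu)$) is mutually singular with each of its convolution powers $\sigma^{*n}$, $n\ge 2$. Equivalently, for every $n>1$ there is no nonzero bounded operator intertwining $T$ with the tensor power $T^{\otimes n}$. "$T^n$ has exactly $n$ invariant ergodic sets" means that, modulo null sets, $X$ is a disjoint union of exactly $n$ sets of positive measure, each invariant under $T^n$, such that the restriction of $T^n$ to each of them is ergodic. Poisson suspension: let $X^*$ be the space of configurations on $X$ (integer-valued counting measures on $X$, i.e. countable collections of points) and let $\mu^*$ be the Poisson probability measure on $X^*$ with intensity $\mu$: for each measurable set $A$ with $\mu(A)<\infty$ the number of points of the configuration in $A$ is Poisson distributed with mean $\mu(A)$, and the numbers of points in pairwise disjoint sets are independent. $P(T)$ is the automorphism of the probability space $(X^*,\mu^* )$ that moves every point of the configuration by $T$. Roots: an automorphism $S$ of a measure space has no roots if for no integer $n\ge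 2$ there exists an automorphism $R$ of the same measure space with $R^n=S$. (For $P(T)$, the automorphism $R$ ranges over all automorphisms of $(X^*,\mu^* )$.) *)

theory Defs
  imports "HOL-Probability.Probability"
begin

section \<open>Measure spaces, automorphisms and roots\<close>

definition standard_borel :: "'a measure \<Rightarrow> bool" where
  "standard_borel M \<longleftrightarrow>
     (\<exists>X. topspace X = space M \<and> completely_metrizable_space X \<and> second_countable X \<and>
          sets M = sigma_sets (space M) {U. openin X U})"

definition standard_measure_space :: "'a measure \<Rightarrow> bool" where
  "standard_measure_space M \<longleftrightarrow> standard_borel M \<and> sigma_finite_measure M"

text \<open>Automorphisms are taken modulo null sets: a representative is a measurable map with a
  measurable inverse almost everywhere.\<close>

definition automorphism :: "'a measure \<Rightarrow> ('a \<Rightarrow> 'a) \<Rightarrow> bool" where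
  "automorphism M T \<longleftrightarrow>
     T \<in> M \<rightarrow>\<^sub>M M \<and> distr M M T = M \<and>
     (\<exists>S. S \<in> M \<rightarrow>\<^sub>M M \<and> distr M M S = M \<and>
          (AE x in M. S (T x) = x) \<and> (AE x in M. T (S x) = x))"

definition has_no_roots :: "'a measure \<Rightarrow> ('a \<Rightarrow> 'a) \<Rightarrow> bool" where
  "has_no_roots M S \<longleftrightarrow>
     \<not> (\<exists>n\<ge>2. \<exists>R. automorphism M R \<and> (AE x in M. (R ^^ n) x = S x))"

section \<open>Ergodicity\<close>

definition invariant_set :: "'a measure \<Rightarrow> ('a \<Rightarrow> 'a) \<Rightarrow> 'a set \<Rightarrow> bool" where
  "invariant_set M T A \<longleftrightarrow> A \<in> sets M \<and> (AE x in M. T x \<in> A \<longleftrightarrow> x \<in> A)"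

text \<open>The restriction of \<open>T\<close> to the invariant set \<open>A\<close> is ergodic. A set \<open>B \<subseteq> A\<close> is invariant
  (modulo null sets) under the restriction iff it is invariant under \<open>T\<close>.\<close>

definition ergodic_on :: "'a measure \<Rightarrow> ('a \<Rightarrow> 'a) \<Rightarrow> 'a set \<Rightarrow> bool" where
  "ergodic_on M T A \<longleftrightarrow>
     invariant_set M T A \<and>
     (\<forall>B. B \<subseteq> A \<and> invariant_set M T B \<longrightarrow> B \<in> null_sets M \<or> A - B \<in> null_sets M)"

definition ergodic :: "'a measure \<Rightarrow> ('a \<Rightarrow> 'a) \<Rightarrow> bool" where
  "ergodic M T \<longleftrightarrow> ergodic_on M T (space M)"

definition has_exactly_ergodic_sets :: "'a measure \<Rightarrow> ('a \<Rightarrow> 'a) \<Rightarrow> nat \<Rightarrow> bool" where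
  "has_exactly_ergodic_sets M T n \<longleftrightarrow>
     (\<exists>A :: nat \<Rightarrow> 'a set.
        disjoint_family_on A {..<n} \<and>
        (\<forall>i<n. emeasure M (A i) > 0 \<and> ergodic_on M T (A i)) \<and>
        (AE x in M. x \<in> (\<Union>i<n. A i)))"

section \<open>Spectral measures\<close>

definition circle :: "complex measure" where
  "circle = restrict_space borel (sphere 0 1)"

definition circle_measure :: "complex measure \<Rightarrow> bool" where
  "circle_measure \<sigma> \<longleftrightarrow> finite_measure \<sigma> \<and> sets \<sigma> = sets circle"

definition L2_fun :: "'a measure \<Rightarrow> ('a \<Rightarrow> complex) \<Rightarrow> bool" where
  "L2_fun M f \<longleftrightarrow> f \<in> borel_measurable M \<and> integrable M (\<lambda>x. (cmod (f x))\<^sup>2)"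

text \<open>The spectral measure of the vector \<open>f\<close>: \<open>\<langle>T\<^sup>k f, f\<rangle>\<close> is the \<open>k\<close>-th Fourier coefficient
  of \<open>\<nu>\<close>. Negative \<open>k\<close> is covered by complex conjugation.\<close>

definition spectral_measure_of ::
    "'a measure \<Rightarrow> ('a \<Rightarrow> 'a) \<Rightarrow> ('a \<Rightarrow> complex) \<Rightarrow> complex measure \<Rightarrow> bool" where
  "spectral_measure_of M T f \<nu> \<longleftrightarrow>
     circle_measure \<nu> \<and>
     (\<forall>k::nat. (LINT z|\<nu>. z ^ k) = (LINT x|M. f ((T ^^ k) x) * cnj (f x)))"

text \<open>\<open>\<sigma>\<close> represents the maximal spectral type: it dominates the spectral measure of every vector
  and is equivalent to the spectral measure of some vector. Note that
  \<open>absolutely_continuous \<sigma> \<nu>\<close> means that \<open>\<nu>\<close> is absolutely continuous with respect to \<open>\<sigma>\<close>.\<close>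

definition maximal_spectral_type ::
    "'a measure \<Rightarrow> ('a \<Rightarrow> 'a) \<Rightarrow> complex measure \<Rightarrow> bool" where
  "maximal_spectral_type M T \<sigma> \<longleftrightarrow>
     circle_measure \<sigma> \<and>
     (\<forall>f. L2_fun M f \<longrightarrow> (\<exists>\<nu>. spectral_measure_of M T f \<nu> \<and> absolutely_continuous \<sigma> \<nu>)) \<and>
     (\<exists>f \<nu>. L2_fun M f \<and> spectral_measure_of M T f \<nu> \<and>
             absolutely_continuous \<sigma> \<nu> \<and> absolutely_continuous \<nu> \<sigma>)"

definition circle_convolution :: "complex measure \<Rightarrow> complex measure \<Rightarrow> complex measure" where
  "circle_convolution \<sigma> \<tau> = distr (\<sigma> \<Otimes>\<^sub>M \<tau>) circle (\<lambda>(z, w). z * w)"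

fun convolution_power :: "complex measure \<Rightarrow> nat \<Rightarrow> complex measure" where
  "convolution_power \<sigma> 0 = return circle 1"
| "convolution_power \<sigma> (Suc n) = circle_convolution \<sigma> (convolution_power \<sigma> n)"

definition mutually_singular :: "'a measure \<Rightarrow> 'a measure \<Rightarrow> bool" where
  "mutually_singular M N \<longleftrightarrow> (\<exists>A \<in> sets M \<inter> sets N. A \<in> null_sets M \<and> space N - A \<in> null_sets N)"

text \<open>The condition depends only on the measure class of \<open>\<sigma>\<close>, so it does not matter which
  representative of the maximal spectral type is used.\<close>

definition property_perp :: "'a measure \<Rightarrow> ('a \<Rightarrow> 'a) \<Rightarrow> bool" where
  "property_perp M T \<longleftrightarrow>
     (\<exists>\<sigma>. maximal_spectral_type M T \<sigma> \<and>
          (\<forall>n\<ge>2. mutually_singular \<sigma> (convolution_power \<sigma> n)))"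

section \<open>Poisson suspensions\<close>

text \<open>A countable collection of points \<open>x i\<close>, \<open>i \<in> I\<close>, with multiplicities, is encoded as its
  counting measure, i.e. the image under \<open>x\<close> of the counting measure on \<open>I\<close>.\<close>

definition configurations :: "'a measure \<Rightarrow> 'a measure set" where
  "configurations M =
     {distr (count_space I) M x | (I :: nat set) x. x \<in> I \<rightarrow> space M}"

definition configuration_algebra :: "'a measure \<Rightarrow> 'a measure measure" where
  "configuration_algebra M =
     (SUP A \<in> sets M. vimage_algebra (configurations M) (\<lambda>N. emeasure N A) borel)"

text \<open>The counting variables take values in \<open>\<nat> \<union> {\<infinity>}\<close>, here embedded in the type
  \<^typ>\<open>ennreal\<close>. The rate \<open>0\<close> is allowed (with \<open>0 ^ 0 = 1\<close>).\<close>

definition poisson_measure :: "'a measure \<Rightarrow> 'a measure measure \<Rightarrow> bool" where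
  "poisson_measure M P \<longleftrightarrow>
     prob_space P \<and> sets P = sets (configuration_algebra M) \<and>
     (\<forall>A \<in> sets M. emeasure M A < \<infinity> \<longrightarrow>
        (\<forall>k::nat. measure P {N \<in> space P. emeasure N A = of_nat k}
                    = measure M A ^ k / fact k * exp (- measure M A))) \<and>
     (\<forall>\<A>. \<A> \<subseteq> sets M \<and> disjoint \<A> \<longrightarrow>
        prob_space.indep_vars P (\<lambda>_. borel) (\<lambda>A N. emeasure N A) \<A>)"

text \<open>Moving every point of a configuration by \<open>T\<close> is the push-forward of its counting measure.\<close>

definition poisson_suspension :: "'a measure \<Rightarrow> ('a \<Rightarrow> 'a) \<Rightarrow> 'a measure \<Rightarrow> 'a measure" where
  "poisson_suspension M T N = distr N M T"

lemma space_configuration_algebra: "space (configuration_algebra M) = configurations M"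
  unfolding configuration_algebra_def
  by (subst space_Sup_eq_UN) auto

lemma emeasure_configuration:
  fixes I :: "nat set"
  assumes "x \<in> I \<rightarrow> space M" "A \<in> sets M"
  shows "emeasure (distr (count_space I) M x) A = emeasure (count_space I) {i \<in> I. x i \<in> A}"
  using assms by (subst emeasure_distr) (auto simp: vimage_def Int_def intro!: arg_cong2[where f = emeasure])

lemma poisson_suspension_configuration:
  fixes I :: "nat set"
  assumes "x \<in> I \<rightarrow> space M" "T \<in> M \<rightarrow>\<^sub>M M"
  shows "poisson_suspension M T (distr (count_space I) M x) = distr (count_space I) M (T \<circ> x)"
  using assms unfolding poisson_suspension_def by (subst distr_distr) auto

lemma measurable_poisson_suspension:
  assumes T: "T \<in> M \<rightarrow>\<^sub>M M"
  shows "poisson_suspension M T \<in> configuration_algebra M \<rightarrow>\<^sub>M configuration_algebra M"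
proof -
  have maps: "poisson_suspension M T \<in> configurations M \<rightarrow> configurations M"
  proof
    fix N assume "N \<in> configurations M"
    then obtain I :: "nat set" and x where Ix: "x \<in> I \<rightarrow> space M" "N = distr (count_space I) M x"
      unfolding configurations_def by blast
    moreover have "T \<circ> x \<in> I \<rightarrow> space M"
      using Ix(1) measurable_space[OF T] by (auto simp: Pi_iff)
    ultimately show "poisson_suspension M T N \<in> configurations M"
      unfolding configurations_def using poisson_suspension_configuration[OF Ix(1) T] by blast
  qed
  have eval: "(\<lambda>N. emeasure N A) \<in> borel_measurable (configuration_algebra M)" if "A \<in> sets M" for A
    unfolding configuration_algebra_def using that
    by (intro measurable_Sup1[of "vimage_algebra (configurations M) (\<lambda>N. emeasure N A) borel"]
              imageI measurable_vimage_algebra1) auto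
  show ?thesis
    unfolding configuration_algebra_def[of M]
  proof (rule measurable_Sup2)
    fix V assume "V \<in> (\<lambda>A. vimage_algebra (configurations M) (\<lambda>N. emeasure N A) borel) ` sets M"
    then obtain A where A: "A \<in> sets M"
      and V: "V = vimage_algebra (configurations M) (\<lambda>N. emeasure N A) borel" by auto
    have "(\<lambda>N. emeasure (poisson_suspension M T N) A) \<in> borel_measurable (configuration_algebra M)"
    proof (subst measurable_cong)
      fix N assume "N \<in> space (configuration_algebra M)"
      then have "sets N = sets M"
        by (auto simp: space_configuration_algebra configurations_def)
      then show "emeasure (poisson_suspension M T N) A = emeasure N (T -` A \<inter> space M)"
        unfolding poisson_suspension_def using T A
        by (subst emeasure_distr) (auto cong: measurable_cong_sets dest: sets_eq_imp_space_eq)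
    qed (use T A in \<open>intro eval measurable_sets\<close>)
    then show "poisson_suspension M T \<in>
        (SUP A \<in> sets M. vimage_algebra (configurations M) (\<lambda>N. emeasure N A) borel) \<rightarrow>\<^sub>M V"
      unfolding V using maps space_configuration_algebra[of M]
      by (intro measurable_vimage_algebra2) (auto simp: configuration_algebra_def)
  qed auto
qed

end

theory Submission
  imports Defs
begin

text \<open>
  The base. Suppose \<open>R\<^sup>n = T\<close> with \<open>n \<ge> 2\<close>. Then \<open>R\<close> commutes with \<open>T\<^sup>n\<close> and permutes its \<open>n\<close> ergodic
  components by some \<open>\<rho>\<close>, and \<open>T\<close> permutes them by \<open>\<rho>\<^sup>n\<close>. Since \<open>T\<close> is ergodic, \<open>\<rho>\<^sup>n\<close> is transitive; but then
  \<open>\<rho>\<close> is a cycle of length \<open>n\<close> and \<open>\<rho>\<^sup>n\<close> is the identity. The lemma \<open>no_root_of_set_map\<close> gives this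
  argument for an abstract action \<open>\<phi>\<close> on the sets of finite measure in place of \<open>R\<close>.

  The suspension. Suppose \<open>S\<^sup>n = P(T)\<close>. The functions in \<open>L\<^sub>2\<close> of the Poisson measure decompose into chaoses.
  The first one consists of the centred linear statistics and is a copy of \<open>L\<^sub>2(M)\<close>, on which \<open>P(T)\<close> acts as
  \<open>T\<close>; on the chaos of order \<open>k\<close> the spectral type is \<open>\<sigma>\<^sup>*\<^sup>k\<close>. As \<open>S\<close> commutes with \<open>P(T)\<close> and \<open>\<sigma>\<close> is
  singular to \<open>\<sigma>\<^sup>*\<^sup>k\<close> for \<open>k \<ge> 2\<close>, the first chaos is mapped to itself by \<open>S\<close>. For a set \<open>B\<close> of finite measure,
  the number of points in \<open>B\<close> composed with \<open>S\<close> is therefore, up to a constant, the stochastic integral of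
  some function \<open>g\<close>, and it has a Poisson distribution. The characteristic function then forces \<open>g\<close> to be an
  indicator (\<open>first_chaos_image_is_count\<close>), so that \<open>S\<close> acts on the sets of finite measure. On these sets \<open>S\<close>
  is an \<open>n\<close>-th root of \<open>T\<close>, and the first part gives a contradiction.

  Neither multiple stochastic integrals nor the spectral theorem are constructed. The chaoses of order at least
  two are represented by the exponentials \<open>exp (- \<Sum> u)\<close> of linear statistics, suitably normalised and with
  their components in the constants and in the first chaos removed (\<open>wick\<close>). The covariances of these are
  \<open>e\<^sup>r - 1 - r\<close>, where \<open>r\<close> is an inner product in \<open>L\<^sub>2(M)\<close>; expanding in powers of \<open>r\<close> exhibits their spectral
  measures as mixtures of convolution powers of order at least two (\<open>wick_covariance\<close>,
  \<open>higher_chaos_spectral_measure\<close>). Functions with mutually singular spectral measures are orthogonal because a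
  trigonometric polynomial can be small for one measure and close to \<open>1\<close> for the other
  (\<open>singular_spectral_measures_orthogonal\<close>). A function orthogonal to the constants and to all these vectors
  belongs to the first chaos, since the exponentials span a dense subspace of \<open>L\<^sub>2\<close> (\<open>first_chaos\<close>).
\<close>

section \<open>Measure-preserving maps\<close>

definition preserves :: "'a measure \<Rightarrow> ('a \<Rightarrow> 'a) \<Rightarrow> bool" where
  "preserves M T \<longleftrightarrow> T \<in> M \<rightarrow>\<^sub>M M \<and> distr M M T = M"

lemma preserves_measurable [measurable_dest]: "preserves M T \<Longrightarrow> T \<in> M \<rightarrow>\<^sub>M M"
  by (simp add: preserves_def)

lemma preserves_AE:
  assumes "preserves M T" "AE x in M. P x"
  shows "AE x in M. P (T x)"
  using assms AE_distrD[of T M M P] unfolding preserves_def by metis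

lemma preserves_funpow:
  assumes "preserves M T"
  shows "preserves M (T ^^ k)"
proof (induction k)
  case 0
  then show ?case by (simp add: preserves_def id_def distr_id)
next
  case (Suc k)
  then show ?case using assms distr_distr[of T M M "T ^^ k" M]
    unfolding preserves_def funpow.simps by (metis measurable_comp)
qed

lemma preserves_emeasure:
  assumes "preserves M T" "A \<in> sets M"
  shows "emeasure M (T -` A \<inter> space M) = emeasure M A"
  using assms emeasure_distr[of T M M A] by (simp add: preserves_def)

lemma preserves_fmeasurable:
  assumes "preserves M T" "A \<in> fmeasurable M"
  shows "T -` A \<inter> space M \<in> fmeasurable M"
  using assms preserves_emeasure[of M T A] by (auto simp: fmeasurable_def preserves_def)

lemma preserves_integral:
  fixes f :: "'a \<Rightarrow> 'b::{banach, second_countable_topology}"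
  assumes "preserves M T" "f \<in> borel_measurable M"
  shows "(LINT x|M. f (T x)) = (LINT x|M. f x)"
  using assms integral_distr[of T M M f] by (simp add: preserves_def)

lemma preserves_integrable:
  fixes f :: "'a \<Rightarrow> 'b::{banach, second_countable_topology}"
  assumes "preserves M T" "integrable M f"
  shows "integrable M (\<lambda>x. f (T x))"
  using assms integrable_distr_eq[of T M M f] borel_measurable_integrable[OF assms(2)]
  by (simp add: preserves_def)

lemma preserves_inverse_funpow:
  assumes "preserves M T" "AE x in M. S (T x) = x"
  shows "AE x in M. (S ^^ k) ((T ^^ k) x) = x"
proof (induction k)
  case (Suc k)
  have "AE x in M. S (T ((T ^^ k) x)) = (T ^^ k) x"
    using preserves_AE[OF preserves_funpow[OF assms(1)] assms(2)] .
  with Suc show ?case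
    by eventually_elim (simp add: funpow_swap1)
qed auto

lemma automorphism_iff:
  "automorphism M T \<longleftrightarrow> preserves M T \<and>
     (\<exists>S. preserves M S \<and> (AE x in M. S (T x) = x) \<and> (AE x in M. T (S x) = x))"
  by (auto simp: automorphism_def preserves_def)

text \<open>Inclusion modulo null sets becomes an equation between numbers. This is how maps of sets that
  preserve the measures of intersections are shown to be monotone.\<close>

lemma AE_subset_iff_measure:
  assumes A: "A \<in> fmeasurable M" and B: "B \<in> sets M"
  shows "(AE x in M. x \<in> A \<longrightarrow> x \<in> B) \<longleftrightarrow> measure M (A \<inter> B) = measure M A"
proof -
  have "measure M (A - B) = measure M A - measure M (A \<inter> B)"
    using A B measurable_measure_Diff[of A M "A \<inter> B"] by (auto simp: Diff_Int fmeasurableD)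
  moreover have "A - B \<in> fmeasurable M" using A B by (auto intro: fmeasurable_Diff)
  then have "(AE x in M. x \<notin> A - B) \<longleftrightarrow> measure M (A - B) = 0"
    by (subst AE_iff_null_sets[symmetric]) (auto simp: null_sets_def emeasure_eq_measure2 fmeasurableD)
  ultimately show ?thesis by auto
qed

section \<open>Roots and the ergodic components of powers\<close>

text \<open>If \<open>\<rho>\<^sup>n\<close> is transitive on \<open>n\<close> points, then so is \<open>\<rho>\<close>, and \<open>\<rho>\<close> is a single cycle of length \<open>n\<close>.
  But then \<open>\<rho>\<^sup>n\<close> is the identity.\<close>

lemma funpow_transitive_no_root:
  fixes \<rho> :: "nat \<Rightarrow> nat"
  assumes maps: "\<rho> ` {..<n} \<subseteq> {..<n}" and inj: "inj_on \<rho> {..<n}" and n: "n \<ge> 2"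
    and trans: "\<And>i. i < n \<Longrightarrow> \<exists>k. i = ((\<rho> ^^ n) ^^ k) 0"
  shows False
proof -
  have lt: "(\<rho> ^^ k) 0 < n" for k
    using maps n by (induction k) auto
  have inj_pow: "(\<rho> ^^ k) a = (\<rho> ^^ k) b \<Longrightarrow> a = b" if "a < n" "b < n" for a b k
    using that
  proof (induction k arbitrary: a b)
    case (Suc k)
    then have "(\<rho> ^^ k) (\<rho> a) = (\<rho> ^^ k) (\<rho> b)" by (simp add: funpow_swap1)
    moreover have "\<rho> a < n" "\<rho> b < n" using maps Suc by auto
    ultimately have "\<rho> a = \<rho> b" using Suc by blast
    then show ?case using inj Suc by (auto simp: inj_on_def)
  qed simp
  have "\<not> inj_on (\<lambda>k. (\<rho> ^^ k) 0) {..n}"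
  proof
    assume "inj_on (\<lambda>k. (\<rho> ^^ k) 0) {..n}"
    then have "card {..n} \<le> card {..<n}" using lt by (intro card_inj_on_le) auto
    then show False by simp
  qed
  then obtain a b where ab: "a < b" "b \<le> n" "(\<rho> ^^ a) 0 = (\<rho> ^^ b) 0"
    by (auto simp: inj_on_def) (metis linorder_neqE_nat)
  have "(\<rho> ^^ a) 0 = (\<rho> ^^ a) ((\<rho> ^^ (b - a)) 0)"
    using ab by (metis add_diff_inverse_nat comp_apply funpow_add not_less_iff_gr_or_eq)
  then have per: "(\<rho> ^^ (b - a)) 0 = 0" using inj_pow[of 0] lt n by force
  define p where "p = b - a"
  have p: "0 < p" "p \<le> n" "(\<rho> ^^ p) 0 = 0" using ab per by (auto simp: p_def)
  have "{..<n} \<subseteq> (\<lambda>k. (\<rho> ^^ k) 0) ` {..<p}"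
  proof
    fix i assume "i \<in> {..<n}"
    then obtain k where "i = (\<rho> ^^ (n * k)) 0" using trans by (auto simp: funpow_mult)
    then have "i = (\<rho> ^^ (n * k mod p)) 0" using p(3) funpow_mod_eq[of p \<rho> 0] by metis
    then show "i \<in> (\<lambda>k. (\<rho> ^^ k) 0) ` {..<p}" using p(1) by auto
  qed
  then have "card {..<n} \<le> card {..<p}" by (meson card_image_le card_mono finite_imageI finite_lessThan le_trans)
  then have "(\<rho> ^^ n) 0 = 0" using p by auto
  then have "((\<rho> ^^ n) ^^ k) 0 = 0" for k by (induction k) auto
  with trans[of 1] n show False by auto
qed

text \<open>The map \<open>\<phi>\<close> plays the role of \<open>B \<mapsto> R\<^sup>-\<^sup>1 B\<close> for a root \<open>R\<close> of \<open>T\<close>. Stated for sets of finite measure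
  modulo null sets, the lemma applies to roots of the base and also to roots of the suspension,
  which act on such sets although no transformation of \<open>M\<close> has been attached to them.

  The image of an ergodic component of \<open>T\<^sup>n\<close> is again invariant and meets no image of another
  component, so by counting it is a component: \<open>\<phi>\<close> permutes the \<open>n\<close> components by some \<open>\<rho>\<close>. Then
  \<open>T\<^sup>-\<^sup>1\<close> permutes them by \<open>\<rho>\<^sup>n\<close>, and ergodicity of \<open>T\<close> says that \<open>\<rho>\<^sup>n\<close> is transitive.\<close>

lemma no_root_of_set_map:
  fixes M :: "'a measure"
  assumes sf: "sigma_finite_measure M" and aut: "automorphism M T" and erg: "ergodic M T"
    and comps: "has_exactly_ergodic_sets M (T ^^ n) n" and n: "n \<ge> 2"
    and \<phi>: "\<And>B. B \<in> fmeasurable M \<Longrightarrow> \<phi> B \<in> fmeasurable M"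
    and inter: "\<And>B B'. B \<in> fmeasurable M \<Longrightarrow> B' \<in> fmeasurable M \<Longrightarrow>
                  measure M (\<phi> B \<inter> \<phi> B') = measure M (B \<inter> B')"
    and comm: "\<And>B. B \<in> fmeasurable M \<Longrightarrow>
                  AE x in M. x \<in> \<phi> (T -` B \<inter> space M) \<longleftrightarrow> T x \<in> \<phi> B"
    and iter: "\<And>B. B \<in> fmeasurable M \<Longrightarrow> AE x in M. x \<in> (\<phi> ^^ n) B \<longleftrightarrow> T x \<in> B"
  shows False
proof -
  interpret sigma_finite_measure M by fact
  from aut obtain S where T: "preserves M T" and S: "preserves M S"
    and ST: "AE x in M. S (T x) = x" and TS: "AE x in M. T (S x) = x"
    by (auto simp: automorphism_iff)
  note [measurable] = preserves_measurable[OF T] preserves_measurable[OF S]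
  note fm = fmeasurableD[of _ M, simp]
  note [simp, intro] = \<phi>
  have [simp, intro]: "T -` B \<inter> space M \<in> fmeasurable M" if "B \<in> fmeasurable M" for B
    using preserves_fmeasurable[OF T that] .
  have meas_\<phi>: "measure M (\<phi> B) = measure M B" if "B \<in> fmeasurable M" for B
    using inter[OF that that] by simp
  have mono: "AE x in M. x \<in> \<phi> B \<longrightarrow> x \<in> \<phi> B'"
    if "B \<in> fmeasurable M" "B' \<in> fmeasurable M" "AE x in M. x \<in> B \<longrightarrow> x \<in> B'" for B B'
    using that AE_subset_iff_measure[of B M B'] AE_subset_iff_measure[of "\<phi> B" M "\<phi> B'"]
    by (simp add: inter meas_\<phi>)
  have cong: "AE x in M. x \<in> \<phi> B \<longleftrightarrow> x \<in> \<phi> B'"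
    if "B \<in> fmeasurable M" "B' \<in> fmeasurable M" "AE x in M. x \<in> B \<longleftrightarrow> x \<in> B'" for B B'
  proof -
    have "AE x in M. x \<in> B \<longrightarrow> x \<in> B'" "AE x in M. x \<in> B' \<longrightarrow> x \<in> B"
      using that(3) by (eventually_elim, simp)+
    from mono[OF that(1,2) this(1)] mono[OF that(2,1) this(2)] show ?thesis
      by eventually_elim auto
  qed
  obtain A :: "nat \<Rightarrow> 'a set" where disj: "disjoint_family_on A {..<n}"
    and A: "\<And>i. i < n \<Longrightarrow> emeasure M (A i) > 0" "\<And>i. i < n \<Longrightarrow> ergodic_on M (T ^^ n) (A i)"
    and cover: "AE x in M. x \<in> (\<Union>i<n. A i)"
    using comps by (auto simp: has_exactly_ergodic_sets_def)
  have A_sets [simp, intro]: "A i \<in> sets M" if "i < n" for i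
    using A(2)[OF that] by (auto simp: ergodic_on_def invariant_set_def)
  have A_disj: "i = j" if "x \<in> A i" "x \<in> A j" "i < n" "j < n" for x i j
    using disj that by (auto simp: disjoint_family_on_def)
  obtain X where X: "range X \<subseteq> sets M" "(\<Union>i. X i) = space M" "\<And>i. emeasure M (X i) \<noteq> \<infinity>" "incseq X"
    using sigma_finite_incseq by blast
  have X_sets [simp, intro]: "X m \<in> sets M" for m using X by auto
  have fmX [simp, intro]: "B \<inter> X m \<in> fmeasurable M" if "B \<in> sets M" for B m
  proof (rule fmeasurableI2)
    show "X m \<in> fmeasurable M"
      using X(3)[of m] by (intro fmeasurableI X_sets) (simp add: less_top[symmetric])
  qed (use that in \<open>auto intro: sets.Int X_sets\<close>)
  \<comment> \<open>A component has infinite measure in general, so its image is assembled from those of finite pieces.\<close>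
  define E where "E i = (\<Union>m. \<phi> (A i \<inter> X m))" for i
  have E_sets [simp, intro]: "E i \<in> sets M" if "i < n" for i
    unfolding E_def using that by (intro sets.countable_UN) auto
  have sub_E: "AE x in M. x \<in> \<phi> D \<longrightarrow> x \<in> E i"
    if i: "i < n" and D: "D \<in> fmeasurable M" "AE x in M. x \<in> D \<longrightarrow> x \<in> A i" for D i
  proof -
    have "measure M (D \<inter> X m) \<le> measure M (\<phi> D \<inter> E i)" for m
    proof -
      have D': "D \<inter> X m \<in> fmeasurable M" using D by auto
      have "AE x in M. x \<in> D \<inter> X m \<longrightarrow> x \<in> A i \<inter> X m" using D(2) by eventually_elim auto
      then have "AE x in M. x \<in> \<phi> (D \<inter> X m) \<longrightarrow> x \<in> \<phi> (A i \<inter> X m)"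
        using D' i by (intro mono) auto
      then have "AE x in M. x \<in> \<phi> D \<inter> \<phi> (D \<inter> X m) \<longrightarrow> x \<in> \<phi> D \<inter> E i"
        by eventually_elim (auto simp: E_def)
      then have "measure M (\<phi> D \<inter> \<phi> (D \<inter> X m)) \<le> measure M (\<phi> D \<inter> E i)"
        using i D D' fmeasurable_Int_fmeasurable[of "\<phi> D" M "E i"] unfolding measure_def
        by (intro enn2real_mono emeasure_mono_AE) (auto simp: less_top[symmetric] dest: fmeasurableD2)
      then show ?thesis using inter[OF D(1) D'] by (simp add: Int_absorb1)
    qed
    moreover have "(\<lambda>m. measure M (D \<inter> X m)) \<longlonglongrightarrow> measure M (\<Union>m. D \<inter> X m)"
    proof (rule Lim_measure_incseq)
      have "(\<Union>m. D \<inter> X m) = D" using X(2) D(1) sets.sets_into_space[of D M] by auto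
      then show "emeasure M (\<Union>m. D \<inter> X m) \<noteq> \<infinity>" using D by (simp add: fmeasurableD2)
    qed (use D X(4) in \<open>auto simp: incseq_def\<close>)
    moreover have "(\<Union>m. D \<inter> X m) = D" using X(2) D(1) sets.sets_into_space[of D M] by auto
    ultimately have "measure M D \<le> measure M (\<phi> D \<inter> E i)"
      by (metis LIMSEQ_le_const2)
    moreover have "measure M (\<phi> D \<inter> E i) \<le> measure M (\<phi> D)"
      using D i by (intro measure_mono_fmeasurable) auto
    ultimately show ?thesis using D i meas_\<phi>[OF D(1)]
      by (subst AE_subset_iff_measure) auto
  qed
  have E_disj: "AE x in M. \<not> (x \<in> E i \<and> x \<in> E j)" if "i < n" "j < n" "i \<noteq> j" for i j
  proof -
    have "AE x in M. \<not> (x \<in> \<phi> (A i \<inter> X k) \<and> x \<in> \<phi> (A j \<inter> X l))" for k l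
    proof -
      have "measure M (\<phi> (A i \<inter> X k) \<inter> \<phi> (A j \<inter> X l)) = measure M ((A i \<inter> X k) \<inter> (A j \<inter> X l))"
        using that by (intro inter) auto
      also have "(A i \<inter> X k) \<inter> (A j \<inter> X l) = {}" using A_disj that by blast
      finally have "\<phi> (A i \<inter> X k) \<inter> \<phi> (A j \<inter> X l) \<in> null_sets M"
        using that by (auto simp: null_sets_def emeasure_eq_measure2 fmeasurable_Int_fmeasurable)
      then show ?thesis using AE_not_in by force
    qed
    then have "AE x in M. \<forall>k l. \<not> (x \<in> \<phi> (A i \<inter> X k) \<and> x \<in> \<phi> (A j \<inter> X l))"
      unfolding AE_all_countable by blast
    then show ?thesis by eventually_elim (auto simp: E_def)
  qed
  define Q where "Q = T ^^ n"
  define Q' where "Q' = S ^^ n"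
  have Q: "preserves M Q" and Q': "preserves M Q'"
    using preserves_funpow T S by (auto simp: Q_def Q'_def)
  note [measurable] = preserves_measurable[OF Q] preserves_measurable[OF Q']
  have QQ': "AE x in M. Q (Q' x) = x" and Q'Q: "AE x in M. Q' (Q x) = x"
    using preserves_inverse_funpow[OF T ST] preserves_inverse_funpow[OF S TS]
    by (auto simp: Q_def Q'_def)
  have comm_pow: "AE x in M. x \<in> \<phi> ((T ^^ k) -` B \<inter> space M) \<longleftrightarrow> (T ^^ k) x \<in> \<phi> B"
    if "B \<in> fmeasurable M" for B k
    using that
  proof (induction k arbitrary: B)
    case 0
    have "B \<inter> space M = B" using 0 sets.sets_into_space[of B M] by auto
    then show ?case by simp
  next
    case (Suc k)
    have eq: "(T ^^ k) -` (T -` B \<inter> space M) \<inter> space M = (T ^^ Suc k) -` B \<inter> space M"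
      using measurable_space[OF preserves_measurable[OF preserves_funpow[OF T]], of _ k] by auto
    have "AE x in M. (T ^^ k) x \<in> \<phi> (T -` B \<inter> space M) \<longleftrightarrow> T ((T ^^ k) x) \<in> \<phi> B"
      using preserves_AE[OF preserves_funpow[OF T] comm[OF Suc.prems]] .
    moreover have "AE x in M. x \<in> \<phi> ((T ^^ k) -` (T -` B \<inter> space M) \<inter> space M) \<longleftrightarrow>
        (T ^^ k) x \<in> \<phi> (T -` B \<inter> space M)"
      by (rule Suc.IH) (use Suc.prems in blast)
    ultimately show ?case unfolding eq by eventually_elim (simp add: comp_def)
  qed
  have inv_A: "AE x in M. Q x \<in> A i \<longleftrightarrow> x \<in> A i" if "i < n" for i
    using A(2)[OF that] by (auto simp: ergodic_on_def invariant_set_def Q_def)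
  have inv_E: "AE x in M. Q x \<in> E i \<longleftrightarrow> x \<in> E i" if i: "i < n" for i
  proof -
    have "AE x in M. Q x \<in> \<phi> (A i \<inter> X m) \<longrightarrow> x \<in> E i" for m
    proof -
      have "AE x in M. x \<in> \<phi> (Q -` (A i \<inter> X m) \<inter> space M) \<longrightarrow> x \<in> E i"
        using inv_A[OF i] i
        by (intro sub_E preserves_fmeasurable[OF Q]) (auto elim!: eventually_mono)
      moreover have "AE x in M. x \<in> \<phi> (Q -` (A i \<inter> X m) \<inter> space M) \<longleftrightarrow> Q x \<in> \<phi> (A i \<inter> X m)"
        unfolding Q_def using i by (intro comm_pow) auto
      ultimately show ?thesis by eventually_elim auto
    qed
    moreover have "AE x in M. x \<in> \<phi> (A i \<inter> X m) \<longrightarrow> Q x \<in> E i" for m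
    proof -
      \<comment> \<open>The piece is the preimage under \<open>T\<^sup>n\<close> of a set \<open>D\<close>, to which \<open>\<phi>\<close> can be applied before pulling back.\<close>
      define D where "D = Q' -` (A i \<inter> X m) \<inter> space M"
      have D: "D \<in> fmeasurable M" unfolding D_def using i by (intro preserves_fmeasurable[OF Q']) auto
      have "AE x in M. x \<in> D \<longrightarrow> x \<in> A i"
        using preserves_AE[OF Q' inv_A[OF i]] QQ' by eventually_elim (auto simp: D_def)
      then have 1: "AE x in M. Q x \<in> \<phi> D \<longrightarrow> Q x \<in> E i"
        using preserves_AE[OF Q sub_E[OF i D]] by auto
      have "AE x in M. x \<in> Q -` D \<inter> space M \<longleftrightarrow> x \<in> A i \<inter> X m"
        using Q'Q AE_space
        by eventually_elim (use measurable_space[OF preserves_measurable[OF Q]] in \<open>auto simp: D_def\<close>)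
      then have 2: "AE x in M. x \<in> \<phi> (Q -` D \<inter> space M) \<longleftrightarrow> x \<in> \<phi> (A i \<inter> X m)"
        using D i preserves_fmeasurable[OF Q] by (intro cong) auto
      have 3: "AE x in M. x \<in> \<phi> (Q -` D \<inter> space M) \<longleftrightarrow> Q x \<in> \<phi> D"
        unfolding Q_def using D by (intro comm_pow)
      from 1 2 3 show ?thesis by eventually_elim auto
    qed
    ultimately have "AE x in M. (\<forall>m. Q x \<in> \<phi> (A i \<inter> X m) \<longrightarrow> x \<in> E i) \<and>
       (\<forall>m. x \<in> \<phi> (A i \<inter> X m) \<longrightarrow> Q x \<in> E i)"
      unfolding AE_conj_iff AE_all_countable by blast
    then show ?thesis by eventually_elim (unfold E_def, blast)
  qed
  have E_pos: "\<not> (AE x in M. x \<notin> E i)" if i: "i < n" for i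
  proof
    assume *: "AE x in M. x \<notin> E i"
    have "AE x in M. x \<notin> A i \<inter> X m" for m
    proof -
      have f: "A i \<inter> X m \<in> fmeasurable M" using i by auto
      have "AE x in M. x \<in> \<phi> (A i \<inter> X m) \<longrightarrow> x \<in> {}"
        using * by eventually_elim (auto simp: E_def)
      then have "measure M (A i \<inter> X m) = 0"
        using AE_subset_iff_measure[OF \<phi>[OF f], of "{}"] meas_\<phi>[OF f] by simp
      then show ?thesis
        using AE_subset_iff_measure[OF f, of "{}"] by auto
    qed
    then have "AE x in M. \<forall>m. x \<notin> A i \<inter> X m" unfolding AE_all_countable by blast
    then have "AE x in M. x \<notin> A i" using AE_space by eventually_elim (use X(2) in auto)
    then have "A i \<in> null_sets M" using i by (subst AE_iff_null_sets) auto
    then show False using A(1)[OF i] by auto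
  qed
  have dich: "(AE x in M. \<not> (x \<in> E i \<and> x \<in> A j)) \<or> (AE x in M. x \<in> A j \<longrightarrow> x \<in> E i)"
    if "i < n" "j < n" for i j
  proof -
    have "invariant_set M (T ^^ n) (E i \<inter> A j)"
      unfolding invariant_set_def Q_def[symmetric]
      using inv_E[OF that(1)] inv_A[OF that(2)] that by (auto elim: eventually_elim2)
    then have "E i \<inter> A j \<in> null_sets M \<or> A j - (E i \<inter> A j) \<in> null_sets M"
      using A(2)[OF that(2)] by (auto simp: ergodic_on_def)
    then show ?thesis
      using AE_not_in[of "E i \<inter> A j" M] AE_not_in[of "A j - (E i \<inter> A j)" M] by auto
  qed
  have A_pos: "\<not> (AE x in M. x \<notin> A i)" if i: "i < n" for i
    using A(1)[OF i] i AE_iff_null_sets[of "A i" M] by auto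
  have "\<exists>j<n. AE x in M. x \<in> A j \<longrightarrow> x \<in> E i" if i: "i < n" for i
  proof (rule ccontr)
    assume "\<not> ?thesis"
    then have "\<forall>j\<in>{..<n}. AE x in M. \<not> (x \<in> E i \<and> x \<in> A j)" using dich[OF i] by auto
    then have "AE x in M. \<forall>j\<in>{..<n}. \<not> (x \<in> E i \<and> x \<in> A j)"
      by (subst AE_ball_countable) (auto intro: countable_finite)
    then have "AE x in M. x \<notin> E i" using cover by eventually_elim auto
    then show False using E_pos[OF i] by simp
  qed
  then obtain \<rho> where \<rho>: "\<And>i. i < n \<Longrightarrow> \<rho> i < n" "\<And>i. i < n \<Longrightarrow> AE x in M. x \<in> A (\<rho> i) \<longrightarrow> x \<in> E i"
    by metis
  have inj: "inj_on \<rho> {..<n}"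
  proof (rule inj_onI, rule ccontr)
    fix i j assume ij: "i \<in> {..<n}" "j \<in> {..<n}" "\<rho> i = \<rho> j" "i \<noteq> j"
    then have "AE x in M. x \<notin> A (\<rho> i)"
      using \<rho>(2)[of i] \<rho>(2)[of j] E_disj[of i j] by (auto elim!: eventually_elim2)
    then show False using A_pos[of "\<rho> i"] \<rho>(1) ij by auto
  qed
  have bij: "\<rho> ` {..<n} = {..<n}"
    using inj \<rho>(1) by (intro endo_inj_surj) auto
  have E_sub: "AE x in M. x \<in> E i \<longrightarrow> x \<in> A (\<rho> i)" if i: "i < n" for i
  proof -
    have "AE x in M. \<not> (x \<in> E i \<and> x \<in> A j)" if j: "j < n" "j \<noteq> \<rho> i" for j
    proof -
      obtain i' where i': "i' < n" "j = \<rho> i'" using bij j by (metis imageE lessThan_iff)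
      then have "AE x in M. x \<in> A j \<longrightarrow> x \<in> E i'" using \<rho> by auto
      moreover have "AE x in M. \<not> (x \<in> E i \<and> x \<in> E i')" using i i' j by (intro E_disj) auto
      ultimately show ?thesis by eventually_elim auto
    qed
    then have "\<forall>j\<in>{..<n} - {\<rho> i}. AE x in M. \<not> (x \<in> E i \<and> x \<in> A j)" by auto
    then have "AE x in M. \<forall>j\<in>{..<n} - {\<rho> i}. \<not> (x \<in> E i \<and> x \<in> A j)"
      by (subst AE_ball_countable) (auto intro: countable_finite)
    then show ?thesis using cover by eventually_elim auto
  qed
  have pow: "(\<rho> ^^ k) i < n \<and> (\<phi> ^^ k) D \<in> fmeasurable M \<and> (AE x in M. x \<in> (\<phi> ^^ k) D \<longrightarrow> x \<in> A ((\<rho> ^^ k) i))"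
    if i: "i < n" and D: "D \<in> fmeasurable M" "AE x in M. x \<in> D \<longrightarrow> x \<in> A i" for D i k
  proof (induction k)
    case (Suc k)
    then have "AE x in M. x \<in> \<phi> ((\<phi> ^^ k) D) \<longrightarrow> x \<in> E ((\<rho> ^^ k) i)" by (intro sub_E) auto
    then show ?case using E_sub[of "(\<rho> ^^ k) i"] Suc \<rho>(1) by (auto elim: eventually_elim2)
  qed (use that in auto)
  define c where "c = \<rho> ^^ n"
  have c_lt: "c i < n" if "i < n" for i
    using pow[OF that, of "{}"] by (simp add: c_def)
  have c_bij: "bij_betw c {..<n} {..<n}"
    unfolding c_def by (intro bij_betw_funpow) (use inj bij in \<open>auto simp: bij_betw_def\<close>)
  have T_A: "AE x in M. T x \<in> A i \<longrightarrow> x \<in> A (c i)" if i: "i < n" for i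
  proof -
    have "AE x in M. T x \<in> A i \<inter> X m \<longrightarrow> x \<in> A (c i)" for m
      using iter[of "A i \<inter> X m"] pow[of i "A i \<inter> X m" n, folded c_def] i
      by (auto elim: eventually_elim2)
    then have "AE x in M. \<forall>m. T x \<in> A i \<inter> X m \<longrightarrow> x \<in> A (c i)" unfolding AE_all_countable by blast
    then show ?thesis using AE_space
      by eventually_elim (use X(2) measurable_space[OF preserves_measurable[OF T]] in \<open>auto; blast\<close>)
  qed
  define J where "J = {(c ^^ k) 0 | k. True}"
  have J_lt: "J \<subseteq> {..<n}"
  proof -
    have "(c ^^ k) 0 < n" for k by (induction k) (use n c_lt in auto)
    then show ?thesis by (auto simp: J_def)
  qed
  have cJ: "c ` J \<subseteq> J" unfolding J_def by clarsimp (metis comp_apply funpow.simps(2))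
  have cJ_eq: "c ` J = J"
    using J_lt cJ c_bij by (intro endo_inj_surj) (auto simp: bij_betw_def intro: finite_subset inj_on_subset)
  have J_back: "i \<in> J" if "i < n" "c i \<in> J" for i
    using that cJ_eq c_bij J_lt unfolding bij_betw_def inj_on_def by (metis imageE lessThan_iff subsetD)
  \<comment> \<open>The components along the orbit of the first one form a \<open>T\<close>-invariant set.\<close>
  define AJ where "AJ = (\<Union>j\<in>J. A j)"
  have AJ_sets: "AJ \<in> sets M" unfolding AJ_def using J_lt by (intro sets.finite_UN) (auto intro: finite_subset)
  have "AE x in M. \<forall>i\<in>{..<n}. T x \<in> A i \<longrightarrow> x \<in> A (c i)"
    by (subst AE_ball_countable) (auto intro: countable_finite T_A)
  moreover have "AE x in M. T x \<in> (\<Union>i<n. A i)" by (rule preserves_AE[OF T cover])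
  ultimately have "AE x in M. T x \<in> AJ \<longleftrightarrow> x \<in> AJ"
  proof eventually_elim
    case (elim x)
    then obtain i where i: "i < n" "T x \<in> A i" "x \<in> A (c i)" by auto
    have "T x \<in> AJ \<longleftrightarrow> i \<in> J" unfolding AJ_def using A_disj i J_lt by blast
    moreover have "x \<in> AJ \<longleftrightarrow> c i \<in> J" unfolding AJ_def using A_disj i c_lt[OF i(1)] J_lt by blast
    ultimately show ?case using J_back[OF i(1)] cJ by blast
  qed
  then have "AJ \<in> null_sets M \<or> space M - AJ \<in> null_sets M"
    using erg AJ_sets sets.sets_into_space unfolding ergodic_def ergodic_on_def invariant_set_def by blast
  moreover have "0 \<in> J" by (auto simp: J_def intro!: exI[of _ 0])
  then have "A 0 \<subseteq> AJ" by (auto simp: AJ_def)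
  then have "AJ \<notin> null_sets M"
    using A_pos[of 0] n AE_not_in[of AJ M] by (metis (mono_tags, lifting) eventually_mono in_mono less_le_trans pos2)
  ultimately have null: "space M - AJ \<in> null_sets M" by simp
  have "\<exists>k. i = (c ^^ k) 0" if i: "i < n" for i
  proof (rule ccontr)
    assume "\<not> ?thesis"
    then have "i \<notin> J" by (auto simp: J_def)
    then have "A i \<inter> AJ = {}" using A_disj[OF _ _ i] J_lt unfolding AJ_def by blast
    then have "AE x in M. x \<notin> A i"
      by (intro AE_mp[OF AE_not_in[OF null] AE_I2]) auto
    then show False using A_pos[OF i] by simp
  qed
  then show False
    using funpow_transitive_no_root[OF _ inj n] bij unfolding c_def by blast
qed

lemma has_no_roots_base:
  fixes M :: "'a measure"
  assumes sf: "sigma_finite_measure M" and aut: "automorphism M T" and erg: "ergodic M T"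
    and comps: "\<And>n::nat. n > 0 \<Longrightarrow> has_exactly_ergodic_sets M (T ^^ n) n"
  shows "has_no_roots M T"
  unfolding has_no_roots_def
proof safe
  fix n :: nat and R assume n: "n \<ge> 2" and R: "automorphism M R" "AE x in M. (R ^^ n) x = T x"
  have R': "preserves M R" and T: "preserves M T" using R aut by (auto simp: automorphism_iff)
  note [measurable] = preserves_measurable[OF R'] preserves_measurable[OF T]
  have RT: "AE x in M. R (T x) = T (R x)"
    using R(2) preserves_AE[OF R' R(2)]
    by eventually_elim (metis funpow_swap1)
  define \<phi> where "\<phi> B = R -` B \<inter> space M" for B
  have sp: "R x \<in> space M" "T x \<in> space M" if "x \<in> space M" for x
    using that measurable_space[OF preserves_measurable[OF R']] measurable_space[OF preserves_measurable[OF T]] by auto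
  have pow: "(\<phi> ^^ k) B = (R ^^ k) -` B \<inter> space M" if "B \<in> sets M" for k B
    using that
  proof (induction k)
    case 0 then show ?case using sets.sets_into_space by auto
  next
    case (Suc k) then show ?case using sp by (auto simp: \<phi>_def funpow_swap1)
  qed
  show False
  proof (rule no_root_of_set_map[OF sf aut erg comps[of n] n, of \<phi>])
    fix B B' assume B: "B \<in> fmeasurable M" and B': "B' \<in> fmeasurable M"
    show "\<phi> B \<in> fmeasurable M" unfolding \<phi>_def using preserves_fmeasurable[OF R' B] .
    have "\<phi> B \<inter> \<phi> B' = R -` (B \<inter> B') \<inter> space M" by (auto simp: \<phi>_def)
    then show "measure M (\<phi> B \<inter> \<phi> B') = measure M (B \<inter> B')"
      using preserves_emeasure[OF R', of "B \<inter> B'"] B B' by (simp add: measure_def fmeasurableD)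
    show "AE x in M. x \<in> \<phi> (T -` B \<inter> space M) \<longleftrightarrow> T x \<in> \<phi> B"
      using RT AE_space by eventually_elim (use sp in \<open>auto simp: \<phi>_def\<close>)
    show "AE x in M. x \<in> (\<phi> ^^ n) B \<longleftrightarrow> T x \<in> B"
      using R(2) AE_space by eventually_elim (use B in \<open>auto simp: pow fmeasurableD\<close>)
  qed (use n in auto)
qed

section \<open>Square-integrable functions and circle measures\<close>

lemma integrable_mult_L2:
  fixes f g :: "'a \<Rightarrow> 'b::{real_normed_field, banach, second_countable_topology}"
  assumes [measurable]: "f \<in> borel_measurable M" "g \<in> borel_measurable M"
    and "integrable M (\<lambda>x. (norm (f x))\<^sup>2)" "integrable M (\<lambda>x. (norm (g x))\<^sup>2)"
  shows "integrable M (\<lambda>x. f x * g x)"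
proof (rule Bochner_Integration.integrable_bound)
  show "integrable M (\<lambda>x. (norm (f x))\<^sup>2 + (norm (g x))\<^sup>2)" using assms by auto
  show "AE x in M. norm (f x * g x) \<le> norm ((norm (f x))\<^sup>2 + (norm (g x))\<^sup>2)"
  proof (rule AE_I2)
    fix x
    have "2 * norm (f x) * norm (g x) \<le> (norm (f x))\<^sup>2 + (norm (g x))\<^sup>2" by (rule sum_squares_bound)
    moreover have "0 \<le> norm (f x) * norm (g x)" by simp
    ultimately have "norm (f x) * norm (g x) \<le> (norm (f x))\<^sup>2 + (norm (g x))\<^sup>2" by linarith
    then show "norm (f x * g x) \<le> norm ((norm (f x))\<^sup>2 + (norm (g x))\<^sup>2)"
      by (simp add: norm_mult)
  qed
qed measurable

lemma Cauchy_Schwarz_integral: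
  fixes f g :: "'a \<Rightarrow> 'b::{real_normed_field, banach, second_countable_topology}"
  assumes [measurable]: "f \<in> borel_measurable M" "g \<in> borel_measurable M"
    and f: "integrable M (\<lambda>x. (norm (f x))\<^sup>2)" and g: "integrable M (\<lambda>x. (norm (g x))\<^sup>2)"
  shows "norm (LINT x|M. f x * g x) \<le> sqrt (LINT x|M. (norm (f x))\<^sup>2) * sqrt (LINT x|M. (norm (g x))\<^sup>2)"
proof -
  let ?I = "LINT x|M. norm (f x) * norm (g x)"
  have int: "integrable M (\<lambda>x. norm (f x) * norm (g x))"
    using integrable_norm[OF integrable_mult_L2[OF assms]] by (simp add: norm_mult)
  have "(\<integral>\<^sup>+x. ennreal (norm (f x)) * ennreal (norm (g x)) \<partial>M)\<^sup>2 \<le>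
      (\<integral>\<^sup>+x. (ennreal (norm (f x)))\<^sup>2 \<partial>M) * (\<integral>\<^sup>+x. (ennreal (norm (g x)))\<^sup>2 \<partial>M)"
    by (rule Cauchy_Schwarz_nn_integral) auto
  also have "(\<integral>\<^sup>+x. ennreal (norm (f x)) * ennreal (norm (g x)) \<partial>M) = ennreal ?I"
    using int by (subst nn_integral_eq_integral[symmetric]) (auto simp: ennreal_mult)
  also have "(\<integral>\<^sup>+x. (ennreal (norm (f x)))\<^sup>2 \<partial>M) = ennreal (LINT x|M. (norm (f x))\<^sup>2)"
    using f by (subst nn_integral_eq_integral[symmetric]) (auto simp: ennreal_power)
  also have "(\<integral>\<^sup>+x. (ennreal (norm (g x)))\<^sup>2 \<partial>M) = ennreal (LINT x|M. (norm (g x))\<^sup>2)"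
    using g by (subst nn_integral_eq_integral[symmetric]) (auto simp: ennreal_power)
  finally have "?I\<^sup>2 \<le> (LINT x|M. (norm (f x))\<^sup>2) * (LINT x|M. (norm (g x))\<^sup>2)"
    by (simp add: ennreal_power ennreal_mult[symmetric])
  then have "?I \<le> sqrt (LINT x|M. (norm (f x))\<^sup>2) * sqrt (LINT x|M. (norm (g x))\<^sup>2)"
    by (simp add: real_le_rsqrt real_sqrt_mult[symmetric])
  moreover have "norm (LINT x|M. f x * g x) \<le> ?I"
    using integral_norm_bound[of M "\<lambda>x. f x * g x"] by (simp add: norm_mult)
  ultimately show ?thesis by simp
qed

lemma circle_measureD:
  assumes "circle_measure \<nu>"
  shows "finite_measure \<nu>" "sets \<nu> = sets circle" "space \<nu> = sphere 0 1"
  using assms sets_eq_imp_space_eq[of \<nu> circle]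
  by (auto simp: circle_measure_def circle_def space_restrict_space)

lemma circle_measure_borel [measurable]: "circle_measure \<nu> \<Longrightarrow> (\<lambda>z. z) \<in> \<nu> \<rightarrow>\<^sub>M borel"
  using circle_measureD(2)[of \<nu>]
  by (auto simp: circle_def cong: measurable_cong_sets intro: measurable_restrict_space1)

lemma circle_measure_borel_measurable:
  assumes "circle_measure \<nu>" "f \<in> borel_measurable borel"
  shows "f \<in> borel_measurable \<nu>"
  using measurable_comp[OF circle_measure_borel[OF assms(1)] assms(2)] by (simp add: comp_def)

lemma circle_measure_integrable:
  fixes f :: "complex \<Rightarrow> 'b::{banach, second_countable_topology}"
  assumes "circle_measure \<nu>" "f \<in> borel_measurable borel" "\<And>z. cmod z = 1 \<Longrightarrow> norm (f z) \<le> B"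
  shows "integrable \<nu> f"
proof -
  interpret finite_measure \<nu> using circle_measureD[OF assms(1)] by simp
  show ?thesis
  proof (rule integrable_const_bound[of _ B])
    show "AE z in \<nu>. norm (f z) \<le> B"
      using assms(3) circle_measureD(3)[OF assms(1)] by (intro AE_I2) simp
  qed (rule circle_measure_borel_measurable[OF assms(1,2)])
qed

lemma continuous_circle_integrable:
  fixes f :: "complex \<Rightarrow> 'b::{banach, second_countable_topology}"
  assumes "circle_measure \<nu>" "continuous_on UNIV f"
  shows "integrable \<nu> f"
proof -
  have "compact (f ` sphere 0 1)"
    using assms(2) by (intro compact_continuous_image) (auto intro: continuous_on_subset)
  then have "bounded (f ` sphere 0 1)" by (rule compact_imp_bounded)
  then obtain B where B: "\<And>y. y \<in> f ` sphere 0 1 \<Longrightarrow> norm y \<le> B"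
    unfolding bounded_iff by blast
  show ?thesis
  proof (rule circle_measure_integrable[OF assms(1)])
    show "f \<in> borel_measurable borel" using assms(2) by (rule borel_measurable_continuous_onI)
    show "norm (f z) \<le> B" if "cmod z = 1" for z using that by (intro B imageI) simp
  qed
qed

section \<open>Trigonometric polynomials\<close>

text \<open>On the circle, \<open>Re z\<close> and \<open>Im z\<close> are linear combinations of \<open>z\<close> and \<open>1 / z\<close>. The factor \<open>z\<^sup>N\<close> clears
  the negative exponents.\<close>

lemma real_polynomial_on_circle:
  fixes g :: "complex \<Rightarrow> real"
  assumes "real_polynomial_function g"
  shows "\<exists>q N. \<forall>z. cmod z = 1 \<longrightarrow> poly q z = z ^ N * of_real (g z)"
  using assms
proof (induction rule: real_polynomial_function.induct)
  case (linear f)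
  define a b where "a = complex_of_real (f 1)" and "b = complex_of_real (f \<i>)"
  have f: "of_real (f z) = a * of_real (Re z) + b * of_real (Im z)" for z
  proof -
    have "f z = f (Re z *\<^sub>R 1 + Im z *\<^sub>R \<i>)" by (metis complex_eq mult.commute scaleR_conv_of_real mult.right_neutral)
    also have "\<dots> = Re z * f 1 + Im z * f \<i>"
      using linear by (simp add: linear_simps)
    finally show ?thesis by (simp add: a_def b_def)
  qed
  have "poly [: (a + \<i> * b) / 2, 0, (a - \<i> * b) / 2 :] z = z ^ 1 * of_real (f z)" if "cmod z = 1" for z
  proof -
    have 1: "z * cnj z = 1" using that by (simp add: complex_norm_square[symmetric])
    have re: "of_real (Re z) = (z + cnj z) / 2" and im: "of_real (Im z) = (z - cnj z) / (2 * \<i>)"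
      by (simp_all add: complex_eq_iff)
    have "z * of_real (f z) = (a * (z * z + z * cnj z) - \<i> * b * (z * z - z * cnj z)) / 2"
      unfolding f re im by (simp add: field_simps)
    then show ?thesis unfolding 1 by (simp add: algebra_simps diff_divide_distrib add_divide_distrib)
  qed
  then show ?case by blast
next
  case (const c)
  show ?case by (rule exI[of _ "[:of_real c:]"], rule exI[of _ 0]) simp
next
  case (add f g)
  then obtain q N q' N' where "\<And>z. cmod z = 1 \<Longrightarrow> poly q z = z ^ N * of_real (f z)"
      "\<And>z. cmod z = 1 \<Longrightarrow> poly q' z = z ^ N' * of_real (g z)" by blast
  then have "\<forall>z. cmod z = 1 \<longrightarrow> poly (monom 1 N' * q + monom 1 N * q') z = z ^ (N + N') * of_real (f z + g z)"
    by (simp add: poly_monom power_add algebra_simps)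
  then show ?case by blast
next
  case (mult f g)
  then obtain q N q' N' where "\<And>z. cmod z = 1 \<Longrightarrow> poly q z = z ^ N * of_real (f z)"
      "\<And>z. cmod z = 1 \<Longrightarrow> poly q' z = z ^ N' * of_real (g z)" by blast
  then have "\<forall>z. cmod z = 1 \<longrightarrow> poly (q * q') z = z ^ (N + N') * of_real (f z * g z)"
    by (simp add: power_add algebra_simps)
  then show ?case by blast
qed

text \<open>A continuous function that is \<open>1\<close> on most of \<open>\<tau>\<close> and \<open>0\<close> on most of \<open>\<nu>\<close> exists by regularity and
  Urysohn's lemma; Stone-Weierstrass replaces it by a trigonometric polynomial. The comparison is
  with \<open>z\<^sup>N\<close> rather than \<open>1\<close> so that the polynomial has nonnegative exponents and can be evaluated at
  a transformation without an inverse.\<close>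

lemma separating_polynomial:
  fixes \<nu> \<tau> :: "complex measure"
  assumes \<nu>: "circle_measure \<nu>" and \<tau>: "circle_measure \<tau>"
    and E: "E \<in> null_sets \<nu>" "space \<tau> - E \<in> null_sets \<tau>" and e: "e > 0"
  shows "\<exists>q N. (LINT z|\<nu>. (cmod (poly q z))\<^sup>2) < e \<and> (LINT z|\<tau>. (cmod (poly q z - z ^ N))\<^sup>2) < e"
proof -
  note [measurable] = circle_measure_borel[OF \<nu>] circle_measure_borel[OF \<tau>]
  note \<nu>' = circle_measureD[OF \<nu>] and \<tau>' = circle_measureD[OF \<tau>]
  interpret \<nu>: finite_measure \<nu> by (rule \<nu>'(1))
  interpret \<tau>: finite_measure \<tau> by (rule \<tau>'(1))
  let ?\<nu> = "distr \<nu> borel (\<lambda>z. z)" and ?\<tau> = "distr \<tau> borel (\<lambda>z. z)"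
  interpret \<nu>d: finite_measure ?\<nu> by (rule \<nu>.finite_measure_distr) measurable
  interpret \<tau>d: finite_measure ?\<tau> by (rule \<tau>.finite_measure_distr) measurable
  have E_circle: "E \<in> sets circle" using E(1) \<nu>'(2) by auto
  then have E_sub: "E \<subseteq> sphere 0 1" and E_borel: "E \<in> sets borel"
    by (auto simp: circle_def sets_restrict_space_iff)
  \<comment> \<open>The error is at most \<open>2\<delta>\<close> from the exceptional sets and \<open>2\<delta>\<close> from the uniform approximation.\<close>
  define \<delta> where "\<delta> = e / 8"
  have \<delta>: "\<delta> > 0" using e by (simp add: \<delta>_def)
  \<comment> \<open>a compact subset of \<open>E\<close> that carries almost all of \<open>\<tau>\<close>\<close>
  have "emeasure ?\<tau> E = (SUP K \<in> {K. K \<subseteq> E \<and> compact K}. emeasure ?\<tau> K)"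
    using E_borel by (intro inner_regular) auto
  then have "\<exists>K\<in>{K. K \<subseteq> E \<and> compact K}. measure ?\<tau> E < measure ?\<tau> K + \<delta>"
  proof -
    have "\<not> (SUP K \<in> {K. K \<subseteq> E \<and> compact K}. emeasure ?\<tau> K) \<le> ennreal (measure ?\<tau> E - \<delta>)
        \<or> measure ?\<tau> E < \<delta>"
      unfolding \<open>emeasure ?\<tau> E = _\<close>[symmetric] using \<delta>
      by (auto simp: not_le ennreal_less_iff \<tau>d.emeasure_eq_measure)
    then show ?thesis
    proof
      assume "\<not> (SUP K \<in> {K. K \<subseteq> E \<and> compact K}. emeasure ?\<tau> K) \<le> ennreal (measure ?\<tau> E - \<delta>)"
      then obtain K where K: "K \<subseteq> E" "compact K" "\<not> emeasure ?\<tau> K \<le> ennreal (measure ?\<tau> E - \<delta>)"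
        unfolding SUP_le_iff by blast
      then have "measure ?\<tau> E - \<delta> < measure ?\<tau> K"
        unfolding \<tau>d.emeasure_eq_measure by (meson ennreal_leI not_le)
      with K show ?thesis by (intro bexI[of _ K]) auto
    next
      assume "measure ?\<tau> E < \<delta>"
      then show ?thesis by (intro bexI[of _ "{}"]) auto
    qed
  qed
  then obtain K where K: "K \<subseteq> E" "compact K" "measure ?\<tau> E < measure ?\<tau> K + \<delta>" by auto
  have K_borel: "K \<in> sets borel" using K by (simp add: borel_compact)
  have meas: "measure ?\<tau> A = measure \<tau> (A \<inter> sphere 0 1)" "measure ?\<nu> A = measure \<nu> (A \<inter> sphere 0 1)"
    if "A \<in> sets borel" for A
    using that \<nu>'(3) \<tau>'(3) by (auto simp: measure_distr Int_def)
  have "measure \<tau> (sphere 0 1) = measure \<tau> E"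
  proof -
    have "measure \<tau> (space \<tau> - (space \<tau> - E)) = measure \<tau> (space \<tau>)"
      using E(2) by (intro measure_Diff_null_set) auto
    moreover have "space \<tau> - (space \<tau> - E) = E" using E_sub \<tau>'(3) by auto
    ultimately show ?thesis using \<tau>'(3) by simp
  qed
  moreover have "measure ?\<tau> E = measure \<tau> E" "measure ?\<tau> K = measure \<tau> K"
    using meas E_borel K_borel E_sub K(1) by (simp_all add: Int_absorb2)
  ultimately have \<tau>K: "measure ?\<tau> (UNIV - K) < \<delta>"
  proof -
    assume a: "measure \<tau> (sphere 0 1) = measure \<tau> E" "measure ?\<tau> E = measure \<tau> E" "measure ?\<tau> K = measure \<tau> K"
    have "measure ?\<tau> (space ?\<tau> - K) = measure ?\<tau> (space ?\<tau>) - measure ?\<tau> K"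
      using K_borel by (intro \<tau>d.finite_measure_compl) auto
    then show ?thesis using a K(3) meas(1)[of UNIV] by simp
  qed
  \<comment> \<open>an open neighbourhood of it that is almost null for \<open>\<nu>\<close>\<close>
  have "emeasure ?\<nu> K = 0"
  proof -
    have "K \<in> null_sets \<nu>"
    proof (rule null_sets_subset[OF E(1)])
      show "K \<in> sets \<nu>" using K(1) K_borel E_sub \<nu>'(2) by (auto simp: circle_def sets_restrict_space_iff)
    qed (rule K(1))
    then have "measure \<nu> K = 0" by (simp add: measure_def null_setsD1)
    then show ?thesis unfolding \<nu>d.emeasure_eq_measure
      using meas(2)[OF K_borel] K(1) E_sub by (simp add: Int_absorb2)
  qed
  moreover have "emeasure ?\<nu> K = (INF U \<in> {U. K \<subseteq> U \<and> open U}. emeasure ?\<nu> U)"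
    using K_borel by (intro outer_regular) auto
  ultimately have "(INF U \<in> {U. K \<subseteq> U \<and> open U}. emeasure ?\<nu> U) < ennreal \<delta>" using \<delta> by simp
  then obtain U where U: "K \<subseteq> U" "open U" "emeasure ?\<nu> U < ennreal \<delta>"
    unfolding INF_less_iff by blast
  have \<nu>U: "measure ?\<nu> U < \<delta>"
    using U(3) unfolding \<nu>d.emeasure_eq_measure by (simp add: ennreal_less_iff)
  obtain h :: "complex \<Rightarrow> real" where h: "continuous_on UNIV h" "\<And>z. h z \<in> closed_segment 1 0"
      "\<And>z. z \<in> K \<Longrightarrow> h z = 1" "\<And>z. z \<in> - U \<Longrightarrow> h z = 0"
    using Urysohn_local[of UNIV K "- U" 1 "0::real"] K(2) U by (auto simp: compact_imp_closed)
  have h01: "0 \<le> h z" "h z \<le> 1" for z using h(2)[of z] by (auto simp: closed_segment_eq_real_ivl)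
  define B where "B = measure ?\<nu> UNIV + measure ?\<tau> UNIV + 1"
  have B: "B \<ge> 1" by (simp add: B_def)
  define \<eta> where "\<eta> = sqrt (\<delta> / B)"
  have \<eta>: "\<eta> > 0" "\<eta>\<^sup>2 * B = \<delta>" using \<delta> B by (auto simp: \<eta>_def)
  obtain g where g: "real_polynomial_function g" "\<And>z. z \<in> sphere 0 1 \<Longrightarrow> \<bar>h z - g z\<bar> < \<eta>"
    using Stone_Weierstrass_real_polynomial_function[of "sphere (0::complex) 1" h \<eta>] h(1) \<eta>
    by (auto intro: continuous_on_subset)
  obtain q N where q: "\<And>z. cmod z = 1 \<Longrightarrow> poly q z = z ^ N * of_real (g z)"
    using real_polynomial_on_circle[OF g(1)] by blast
  have sq: "(x + y)\<^sup>2 \<le> 2 * x\<^sup>2 + 2 * y\<^sup>2" for x y :: real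
    using sum_squares_bound[of x y] by (simp add: power2_sum)
  have bound\<nu>: "(cmod (poly q z))\<^sup>2 \<le> 2 * indicator U z + 2 * \<eta>\<^sup>2" if z: "cmod z = 1" for z
  proof -
    have "cmod (poly q z) = \<bar>g z\<bar>" using q[OF z] z by (simp add: norm_mult norm_power)
    also have "\<dots> \<le> h z + \<eta>" using g(2)[of z] h01[of z] z by auto
    finally have "(cmod (poly q z))\<^sup>2 \<le> (h z + \<eta>)\<^sup>2" by (intro power_mono) auto
    also have "\<dots> \<le> 2 * (h z)\<^sup>2 + 2 * \<eta>\<^sup>2" by (rule sq)
    also have "(h z)\<^sup>2 \<le> indicator U z"
      using h(4)[of z] h01[of z] by (cases "z \<in> U") (auto simp: power_le_one)
    finally show ?thesis by simp
  qed
  have bound\<tau>: "(cmod (poly q z - z ^ N))\<^sup>2 \<le> 2 * indicator (UNIV - K) z + 2 * \<eta>\<^sup>2" if z: "cmod z = 1" for z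
  proof -
    have "poly q z - z ^ N = z ^ N * of_real (g z - 1)" using q[OF z] by (simp add: algebra_simps)
    then have "cmod (poly q z - z ^ N) = \<bar>g z - 1\<bar>"
      using z by (metis mult_1 norm_mult norm_of_real norm_power power_one)
    also have "\<dots> \<le> (1 - h z) + \<eta>" using g(2)[of z] h01[of z] z by auto
    finally have "(cmod (poly q z - z ^ N))\<^sup>2 \<le> ((1 - h z) + \<eta>)\<^sup>2" by (intro power_mono) auto
    also have "\<dots> \<le> 2 * (1 - h z)\<^sup>2 + 2 * \<eta>\<^sup>2" by (rule sq)
    also have "(1 - h z)\<^sup>2 \<le> indicator (UNIV - K) z"
      using h(3)[of z] h01[of z] by (cases "z \<in> K") (auto simp: power_le_one)
    finally show ?thesis by simp
  qed
  have U_borel: "U \<in> sets borel" using U by simp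
  have "(LINT z|\<nu>. (cmod (poly q z))\<^sup>2) \<le> (LINT z|\<nu>. 2 * indicator U z + 2 * \<eta>\<^sup>2)"
    using bound\<nu> \<nu>'(3) U_borel
    by (intro integral_mono continuous_circle_integrable[OF \<nu>] circle_measure_integrable[OF \<nu>, of _ "2 + 2 * \<eta>\<^sup>2"])
       (auto intro!: continuous_intros split: split_indicator)
  also have "\<dots> = (LINT z|?\<nu>. 2 * indicator U z + 2 * \<eta>\<^sup>2)"
    using U_borel by (subst integral_distr) auto
  also have "\<dots> = 2 * measure ?\<nu> U + 2 * \<eta>\<^sup>2 * measure ?\<nu> UNIV"
    using U_borel \<nu>d.emeasure_finite[of U]
    by (subst Bochner_Integration.integral_add) (auto simp: top.not_eq_extremum \<nu>d.emeasure_eq_measure)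
  also have "\<dots> < 2 * \<delta> + 2 * \<eta>\<^sup>2 * B"
    using \<nu>U \<eta> by (intro add_less_le_mono mult_left_mono) (auto simp: B_def)
  also have "\<dots> < e" using \<eta>(2) e by (simp add: \<delta>_def)
  finally have 1: "(LINT z|\<nu>. (cmod (poly q z))\<^sup>2) < e" .
  have "(LINT z|\<tau>. (cmod (poly q z - z ^ N))\<^sup>2) \<le> (LINT z|\<tau>. 2 * indicator (UNIV - K) z + 2 * \<eta>\<^sup>2)"
    using bound\<tau> \<tau>'(3) K_borel
    by (intro integral_mono continuous_circle_integrable[OF \<tau>] circle_measure_integrable[OF \<tau>, of _ "2 + 2 * \<eta>\<^sup>2"])
       (auto intro!: continuous_intros split: split_indicator)
  also have "\<dots> = (LINT z|?\<tau>. 2 * indicator (UNIV - K) z + 2 * \<eta>\<^sup>2)"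
    using K_borel by (subst integral_distr) auto
  also have "\<dots> = 2 * measure ?\<tau> (UNIV - K) + 2 * \<eta>\<^sup>2 * measure ?\<tau> UNIV"
    using K_borel \<tau>d.emeasure_finite[of "UNIV - K"]
    by (subst Bochner_Integration.integral_add) (auto simp: top.not_eq_extremum \<tau>d.emeasure_eq_measure)
  also have "\<dots> < 2 * \<delta> + 2 * \<eta>\<^sup>2 * B"
    using \<tau>K \<eta> by (intro add_less_le_mono mult_left_mono) (auto simp: B_def)
  also have "\<dots> < e" using \<eta>(2) e by (simp add: \<delta>_def)
  finally have 2: "(LINT z|\<tau>. (cmod (poly q z - z ^ N))\<^sup>2) < e" .
  from 1 2 show ?thesis by blast
qed

section \<open>Mutually singular spectral measures and orthogonality\<close>

text \<open>The part of the spectral theorem that is needed: \<open>F \<circ> \<Phi>\<^sup>k \<mapsto> z\<^sup>k\<close> extends linearly to an isometry,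
  because the inner products on both sides depend in the same way on the difference of the
  exponents.\<close>

lemma isometry_on_orbit:
  fixes F :: "'a \<Rightarrow> real"
  assumes \<Phi>: "preserves P \<Phi>" and F [measurable]: "F \<in> borel_measurable P" and F2: "integrable P (\<lambda>x. (F x)\<^sup>2)"
    and \<nu>: "circle_measure \<nu>"
    and coef: "\<And>k::nat. (LINT z|\<nu>. z ^ k) = complex_of_real (LINT x|P. F ((\<Phi> ^^ k) x) * F x)"
    and I: "finite I"
  shows "(LINT x|P. (cmod (\<Sum>j\<in>I. a j * of_real (F ((\<Phi> ^^ e j) x))))\<^sup>2) =
         (LINT z|\<nu>. (cmod (\<Sum>j\<in>I. a j * z ^ e j))\<^sup>2)"
    and "integrable P (\<lambda>x. (cmod (\<Sum>j\<in>I. a j * of_real (F ((\<Phi> ^^ e j) x))))\<^sup>2)"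
proof -
  have \<Phi>k: "preserves P (\<Phi> ^^ k)" for k by (rule preserves_funpow[OF \<Phi>])
  note [measurable] = preserves_measurable[OF \<Phi>k]
  have [measurable]: "(\<lambda>x. F ((\<Phi> ^^ k) x)) \<in> borel_measurable P" for k by measurable
  have sq: "integrable P (\<lambda>x. (F ((\<Phi> ^^ k) x))\<^sup>2)" for k
    using preserves_integrable[OF \<Phi>k F2] by simp
  have prod: "integrable P (\<lambda>x. F ((\<Phi> ^^ k) x) * F ((\<Phi> ^^ l) x))" for k l
    using sq by (intro integrable_mult_L2) auto
  have diff: "(LINT x|P. F ((\<Phi> ^^ (k + l)) x) * F ((\<Phi> ^^ l) x)) = (LINT x|P. F ((\<Phi> ^^ k) x) * F x)" for k l
    using preserves_integral[OF \<Phi>k[of l], of "\<lambda>x. F ((\<Phi> ^^ k) x) * F x"]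
    by (simp add: funpow_add)
  have moment: "(LINT z|\<nu>. z ^ k * cnj (z ^ l)) = complex_of_real (LINT x|P. F ((\<Phi> ^^ k) x) * F ((\<Phi> ^^ l) x))" for k l
  proof -
    have *: "z ^ (m + l) * cnj (z ^ l) = z ^ m" if "cmod z = 1" for z m l
    proof -
      have "z ^ l * cnj (z ^ l) = 1" using that unfolding complex_norm_square[symmetric] by (simp add: norm_power)
      then show ?thesis by (simp add: power_add mult.assoc)
    qed
    have geq: "(LINT z|\<nu>. z ^ (m + l) * cnj (z ^ l)) = complex_of_real (LINT x|P. F ((\<Phi> ^^ (m + l)) x) * F ((\<Phi> ^^ l) x))" for m l
    proof -
      have "(LINT z|\<nu>. z ^ (m + l) * cnj (z ^ l)) = (LINT z|\<nu>. z ^ m)"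
        using circle_measureD(3)[OF \<nu>] * by (intro Bochner_Integration.integral_cong) auto
      then show ?thesis by (simp add: coef diff)
    qed
    show ?thesis
    proof (cases "k \<ge> l")
      case True
      then show ?thesis using geq[of "k - l" l] by simp
    next
      case False
      have "(LINT z|\<nu>. z ^ k * cnj (z ^ l)) = (LINT z|\<nu>. cnj (z ^ l * cnj (z ^ k)))"
        by (simp add: mult.commute)
      also have "\<dots> = cnj (LINT z|\<nu>. z ^ l * cnj (z ^ k))" by (rule Bochner_Integration.integral_cnj)
      also have "(LINT z|\<nu>. z ^ l * cnj (z ^ k)) = complex_of_real (LINT x|P. F ((\<Phi> ^^ l) x) * F ((\<Phi> ^^ k) x))"
        using geq[of "l - k" k] False by simp
      finally show ?thesis by (simp add: mult.commute)
    qed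
  qed
  have int\<nu>: "integrable \<nu> (\<lambda>z. z ^ k * cnj (z ^ l))" for k l
    by (intro continuous_circle_integrable[OF \<nu>] continuous_intros)
  have expand: "complex_of_real ((cmod (\<Sum>j\<in>I. b j))\<^sup>2) = (\<Sum>j\<in>I. \<Sum>i\<in>I. b j * cnj (b i))" for b :: "_ \<Rightarrow> complex"
    unfolding complex_norm_square cnj_sum by (rule sum_product)
  have eqP: "complex_of_real ((cmod (\<Sum>j\<in>I. a j * of_real (F ((\<Phi> ^^ e j) x))))\<^sup>2) =
     (\<Sum>j\<in>I. \<Sum>i\<in>I. a j * cnj (a i) * complex_of_real (F ((\<Phi> ^^ e j) x) * F ((\<Phi> ^^ e i) x)))" for x
    unfolding expand by (simp add: algebra_simps)
  have eq\<nu>: "complex_of_real ((cmod (\<Sum>j\<in>I. a j * z ^ e j))\<^sup>2) =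
     (\<Sum>j\<in>I. \<Sum>i\<in>I. a j * cnj (a i) * (z ^ e j * cnj (z ^ e i)))" for z
    unfolding expand by (simp add: algebra_simps)
  have intP: "integrable P (\<lambda>x. \<Sum>j\<in>I. \<Sum>i\<in>I. a j * cnj (a i) * complex_of_real (F ((\<Phi> ^^ e j) x) * F ((\<Phi> ^^ e i) x)))"
    by (intro Bochner_Integration.integrable_sum integrable_mult_right) (use prod in \<open>simp add: complex_of_real_integrable_eq del: of_real_mult\<close>)
  then have "integrable P (\<lambda>x. complex_of_real ((cmod (\<Sum>j\<in>I. a j * of_real (F ((\<Phi> ^^ e j) x))))\<^sup>2))"
    unfolding eqP .
  then show "integrable P (\<lambda>x. (cmod (\<Sum>j\<in>I. a j * of_real (F ((\<Phi> ^^ e j) x))))\<^sup>2)"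
    unfolding complex_of_real_integrable_eq .
  have "complex_of_real (LINT x|P. (cmod (\<Sum>j\<in>I. a j * of_real (F ((\<Phi> ^^ e j) x))))\<^sup>2) =
     (\<Sum>j\<in>I. \<Sum>i\<in>I. a j * cnj (a i) * complex_of_real (LINT x|P. F ((\<Phi> ^^ e j) x) * F ((\<Phi> ^^ e i) x)))"
    unfolding integral_complex_of_real[symmetric] eqP
    using prod by (simp add: Bochner_Integration.integral_sum complex_of_real_integrable_eq del: of_real_mult)
  also have "\<dots> = (\<Sum>j\<in>I. \<Sum>i\<in>I. a j * cnj (a i) * (LINT z|\<nu>. z ^ e j * cnj (z ^ e i)))"
    unfolding moment ..
  also have "\<dots> = (LINT z|\<nu>. complex_of_real ((cmod (\<Sum>j\<in>I. a j * z ^ e j))\<^sup>2))"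
    unfolding eq\<nu> using int\<nu> by (simp add: Bochner_Integration.integral_sum del: complex_cnj_power)
  finally show "(LINT x|P. (cmod (\<Sum>j\<in>I. a j * of_real (F ((\<Phi> ^^ e j) x))))\<^sup>2) =
         (LINT z|\<nu>. (cmod (\<Sum>j\<in>I. a j * z ^ e j))\<^sup>2)"
    unfolding integral_complex_of_real of_real_eq_iff .
qed

text \<open>Take a polynomial \<open>q\<close> that is small in \<open>L\<^sub>2(\<nu>)\<close> and close to \<open>z\<^sup>N\<close> in \<open>L\<^sub>2(\<tau>)\<close>. Then \<open>q(\<Phi>) G\<close> is close to
  \<open>G \<circ> \<Phi>\<^sup>N\<close>, whereas the adjoint of \<open>q(\<Phi>)\<close> almost annihilates \<open>F\<close>. Hence the inner product of
  \<open>F \<circ> \<Phi>\<^sup>N\<close> and \<open>G \<circ> \<Phi>\<^sup>N\<close>, which is that of \<open>F\<close> and \<open>G\<close>, is arbitrarily small.\<close>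

lemma singular_spectral_measures_orthogonal:
  fixes F G :: "'a \<Rightarrow> real"
  assumes \<Phi>: "preserves P \<Phi>"
    and F [measurable]: "F \<in> borel_measurable P" and F2: "integrable P (\<lambda>x. (F x)\<^sup>2)"
    and G [measurable]: "G \<in> borel_measurable P" and G2: "integrable P (\<lambda>x. (G x)\<^sup>2)"
    and \<nu>: "circle_measure \<nu>" and \<tau>: "circle_measure \<tau>"
    and coefF: "\<And>k::nat. (LINT z|\<nu>. z ^ k) = complex_of_real (LINT x|P. F ((\<Phi> ^^ k) x) * F x)"
    and coefG: "\<And>k::nat. (LINT z|\<tau>. z ^ k) = complex_of_real (LINT x|P. G ((\<Phi> ^^ k) x) * G x)"
    and E: "E \<in> null_sets \<nu>" "space \<tau> - E \<in> null_sets \<tau>"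
  shows "(LINT x|P. F x * G x) = 0"
proof -
  have \<Phi>k: "preserves P (\<Phi> ^^ k)" for k by (rule preserves_funpow[OF \<Phi>])
  note [measurable] = preserves_measurable[OF \<Phi>k]
  note isoF = isometry_on_orbit[OF \<Phi> F F2 \<nu> coefF]
  note isoG = isometry_on_orbit[OF \<Phi> G G2 \<tau> coefG]
  have F2k: "integrable P (\<lambda>x. (F ((\<Phi> ^^ k) x))\<^sup>2)" "(LINT x|P. (F ((\<Phi> ^^ k) x))\<^sup>2) = (LINT x|P. (F x)\<^sup>2)" for k
    using preserves_integrable[OF \<Phi>k F2] preserves_integral[OF \<Phi>k, of "\<lambda>x. (F x)\<^sup>2" k] by simp_all
  have G2k: "integrable P (\<lambda>x. (G ((\<Phi> ^^ k) x))\<^sup>2)" "(LINT x|P. (G ((\<Phi> ^^ k) x))\<^sup>2) = (LINT x|P. (G x)\<^sup>2)" for k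
    using preserves_integrable[OF \<Phi>k G2] preserves_integral[OF \<Phi>k, of "\<lambda>x. (G x)\<^sup>2" k] by simp_all
  have [measurable]: "cnj \<in> borel_measurable borel"
    by (intro borel_measurable_continuous_onI continuous_intros)
  define C where "C = sqrt (LINT x|P. (F x)\<^sup>2) + sqrt (LINT x|P. (G x)\<^sup>2)"
  have small: "\<bar>LINT x|P. F x * G x\<bar> \<le> C * sqrt \<epsilon>" if \<epsilon>: "\<epsilon> > 0" for \<epsilon>
  proof -
    obtain q N where q: "(LINT z|\<nu>. (cmod (poly q z))\<^sup>2) < \<epsilon>" "(LINT z|\<tau>. (cmod (poly q z - z ^ N))\<^sup>2) < \<epsilon>"
      using separating_polynomial[OF \<nu> \<tau> E \<epsilon>] by blast
    define D where "D = max (degree q) N"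
    have poly_q: "poly q z = (\<Sum>j\<le>D. coeff q j * z ^ j)" for z
      unfolding poly_altdef D_def by (intro sum.mono_neutral_left) (auto simp: coeff_eq_0)
    \<comment> \<open>This is \<open>q(\<Phi>) G\<close>.\<close>
    define X where "X x = (\<Sum>j\<le>D. coeff q j * of_real (G ((\<Phi> ^^ j) x)))" for x
    have [measurable]: "X \<in> borel_measurable P" unfolding X_def by measurable
    have diff: "(\<Sum>j\<le>D. (coeff q j - (if j = N then 1 else 0)) * v j) = (\<Sum>j\<le>D. coeff q j * v j) - v N" for v :: "nat \<Rightarrow> complex"
      by (simp add: left_diff_distrib sum_subtractf D_def if_distrib[of "\<lambda>c. c * _"] cong: if_cong)
    have X1: "(LINT x|P. (cmod (X x - of_real (G ((\<Phi> ^^ N) x))))\<^sup>2) < \<epsilon>"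
      and X1i: "integrable P (\<lambda>x. (cmod (X x - of_real (G ((\<Phi> ^^ N) x))))\<^sup>2)"
      using isoG[of "{..D}" "\<lambda>j. coeff q j - (if j = N then 1 else 0)" "\<lambda>j. j"] q(2)
      unfolding diff X_def poly_q by simp_all
    have X2i: "integrable P (\<lambda>x. (cmod (X x))\<^sup>2)"
      using isoG(2)[of "{..D}" "coeff q" "\<lambda>j. j"] unfolding X_def by simp
    \<comment> \<open>The adjoint of \<open>q(\<Phi>)\<close> applied to \<open>F \<circ> \<Phi>\<^sup>N\<close>, shifted by \<open>\<Phi>\<^sup>D\<close> to avoid negative exponents.\<close>
    define Y where "Y x = (\<Sum>j\<le>D. cnj (coeff q j) * of_real (F ((\<Phi> ^^ (N + D - j)) x)))" for x
    have [measurable]: "Y \<in> borel_measurable P" unfolding Y_def by measurable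
    have Y: "(LINT x|P. (cmod (Y x))\<^sup>2) < \<epsilon>" and Yi: "integrable P (\<lambda>x. (cmod (Y x))\<^sup>2)"
    proof -
      have "cmod (\<Sum>j\<le>D. cnj (coeff q j) * z ^ (N + D - j)) = cmod (poly q z)" if z: "cmod z = 1" for z
      proof -
        have "cnj (coeff q j) * z ^ (N + D - j) = z ^ (N + D) * cnj (coeff q j * z ^ j)" if "j \<le> D" for j
        proof -
          have "z ^ j * cnj (z ^ j) = 1" using z unfolding complex_norm_square[symmetric] by (simp add: norm_power)
          moreover have "z ^ (N + D) = z ^ (N + D - j) * z ^ j"
            using that by (simp add: power_add[symmetric])
          ultimately show ?thesis by (simp add: algebra_simps)
        qed
        then have "(\<Sum>j\<le>D. cnj (coeff q j) * z ^ (N + D - j)) = z ^ (N + D) * cnj (poly q z)"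
          unfolding poly_q cnj_sum sum_distrib_left by (intro sum.cong) auto
        then show ?thesis using z by (simp add: norm_mult norm_power)
      qed
      then have "(LINT z|\<nu>. (cmod (\<Sum>j\<le>D. cnj (coeff q j) * z ^ (N + D - j)))\<^sup>2) = (LINT z|\<nu>. (cmod (poly q z))\<^sup>2)"
        using circle_measureD(3)[OF \<nu>] by (intro Bochner_Integration.integral_cong) auto
      then show "(LINT x|P. (cmod (Y x))\<^sup>2) < \<epsilon>" "integrable P (\<lambda>x. (cmod (Y x))\<^sup>2)"
        using isoF[of "{..D}" "\<lambda>j. cnj (coeff q j)" "\<lambda>j. N + D - j"] q(1) unfolding Y_def by simp_all
    qed
    let ?FN = "\<lambda>x. complex_of_real (F ((\<Phi> ^^ N) x))" and ?GN = "\<lambda>x. complex_of_real (G ((\<Phi> ^^ N) x))"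
    let ?GD = "\<lambda>x. complex_of_real (G ((\<Phi> ^^ D) x))"
    have FG: "complex_of_real (LINT x|P. F x * G x) = (LINT x|P. ?FN x * ?GN x)"
      using preserves_integral[OF \<Phi>k, of "\<lambda>x. complex_of_real (F x * G x)" N]
      by (simp add: integral_complex_of_real[symmetric] del: integral_complex_of_real)
    have FX: "(LINT x|P. ?FN x * cnj (X x)) = (LINT x|P. Y x * ?GD x)"
    proof -
      have iFG: "integrable P (\<lambda>x. complex_of_real (F ((\<Phi> ^^ k) x)) * complex_of_real (G ((\<Phi> ^^ l) x)))" for k l
        using F2k G2k by (intro integrable_mult_L2) auto
      have "(LINT x|P. ?FN x * cnj (X x)) = (LINT x|P. (\<Sum>j\<le>D. cnj (coeff q j) * (?FN x * complex_of_real (G ((\<Phi> ^^ j) x)))))"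
        unfolding X_def by (simp add: sum_distrib_left algebra_simps)
      also have "\<dots> = (\<Sum>j\<le>D. cnj (coeff q j) * (LINT x|P. ?FN x * complex_of_real (G ((\<Phi> ^^ j) x))))"
        using iFG by (subst Bochner_Integration.integral_sum) auto
      also have "\<dots> = (\<Sum>j\<le>D. cnj (coeff q j) * (LINT x|P. complex_of_real (F ((\<Phi> ^^ (N + D - j)) x)) * ?GD x))"
      proof (intro sum.cong refl arg_cong2[where f = "(*)"])
        fix j assume j: "j \<in> {..D}"
        have "(\<Phi> ^^ N) ((\<Phi> ^^ (D - j)) x) = (\<Phi> ^^ (N + D - j)) x" "(\<Phi> ^^ j) ((\<Phi> ^^ (D - j)) x) = (\<Phi> ^^ D) x" for x
          using j by (simp_all add: funpow_add[symmetric, unfolded comp_def, THEN fun_cong])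
        then show "(LINT x|P. ?FN x * complex_of_real (G ((\<Phi> ^^ j) x))) = (LINT x|P. complex_of_real (F ((\<Phi> ^^ (N + D - j)) x)) * ?GD x)"
          using preserves_integral[OF \<Phi>k, of "\<lambda>x. ?FN x * complex_of_real (G ((\<Phi> ^^ j) x))" "D - j"] by simp
      qed
      also have "\<dots> = (LINT x|P. (\<Sum>j\<le>D. cnj (coeff q j) * (complex_of_real (F ((\<Phi> ^^ (N + D - j)) x)) * ?GD x)))"
        using iFG by (subst Bochner_Integration.integral_sum) auto
      also have "\<dots> = (LINT x|P. Y x * ?GD x)"
        unfolding Y_def by (simp add: sum_distrib_right mult.assoc)
      finally show ?thesis .
    qed
    have "(LINT x|P. ?FN x * ?GN x) = (LINT x|P. ?FN x * cnj (?GN x - X x)) + (LINT x|P. ?FN x * cnj (X x))"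
    proof (subst Bochner_Integration.integral_add[symmetric])
      show "integrable P (\<lambda>x. ?FN x * cnj (?GN x - X x))" "integrable P (\<lambda>x. ?FN x * cnj (X x))"
        using F2k X1i X2i by (auto intro!: integrable_mult_L2 simp: norm_minus_commute simp del: complex_cnj_diff)
    qed (simp add: algebra_simps)
    moreover have "cmod (LINT x|P. ?FN x * cnj (?GN x - X x)) \<le> sqrt (LINT x|P. (F x)\<^sup>2) * sqrt \<epsilon>"
    proof -
      have "cmod (LINT x|P. ?FN x * cnj (?GN x - X x)) \<le> sqrt (LINT x|P. (cmod (?FN x))\<^sup>2) * sqrt (LINT x|P. (cmod (cnj (?GN x - X x)))\<^sup>2)"
        using F2k X1i by (intro Cauchy_Schwarz_integral) (auto simp: norm_minus_commute simp del: complex_cnj_diff)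
      also have "\<dots> \<le> sqrt (LINT x|P. (F x)\<^sup>2) * sqrt \<epsilon>"
        using X1 F2k by (intro mult_mono) (auto simp: norm_minus_commute simp del: complex_cnj_diff)
      finally show ?thesis .
    qed
    moreover have "cmod (LINT x|P. Y x * ?GD x) \<le> sqrt \<epsilon> * sqrt (LINT x|P. (G x)\<^sup>2)"
    proof -
      have "cmod (LINT x|P. Y x * ?GD x) \<le> sqrt (LINT x|P. (cmod (Y x))\<^sup>2) * sqrt (LINT x|P. (cmod (?GD x))\<^sup>2)"
        using G2k Yi by (intro Cauchy_Schwarz_integral) auto
      also have "\<dots> \<le> sqrt \<epsilon> * sqrt (LINT x|P. (G x)\<^sup>2)"
        using Y G2k \<epsilon> by (intro mult_mono) auto
      finally show ?thesis .
    qed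
    ultimately have "cmod (complex_of_real (LINT x|P. F x * G x)) \<le> C * sqrt \<epsilon>"
      unfolding FG FX C_def using norm_triangle_ineq[of "LINT x|P. ?FN x * cnj (?GN x - X x)" "LINT x|P. Y x * ?GD x"]
      by (simp add: algebra_simps)
    then show ?thesis by (simp only: norm_of_real)
  qed
  have "((\<lambda>\<epsilon>. C * sqrt \<epsilon>) \<longlongrightarrow> C * sqrt 0) (at_right 0)"
    by (intro tendsto_intros)
  moreover have "eventually (\<lambda>\<epsilon>. \<bar>LINT x|P. F x * G x\<bar> \<le> C * sqrt \<epsilon>) (at_right 0)"
    using small by (auto simp: eventually_at_filter)
  ultimately have "\<bar>LINT x|P. F x * G x\<bar> \<le> C * sqrt 0"
    by (intro tendsto_lowerbound) auto
  then show ?thesis by simp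
qed

section \<open>Convolutions and mixtures of circle measures\<close>

lemma measurable_circle_mult: "(\<lambda>(z, w). z * w) \<in> circle \<Otimes>\<^sub>M circle \<rightarrow>\<^sub>M circle"
proof -
  have [measurable]: "(\<lambda>z. z) \<in> circle \<rightarrow>\<^sub>M borel"
    unfolding circle_def by (rule measurable_restrict_space1) simp
  have "(\<lambda>(z, w). z * w) \<in> circle \<Otimes>\<^sub>M circle \<rightarrow>\<^sub>M borel" by measurable
  moreover have "(\<lambda>(z, w). z * w) \<in> space (circle \<Otimes>\<^sub>M circle) \<rightarrow> sphere 0 1"
    by (auto simp: space_pair_measure circle_def space_restrict_space norm_mult)
  ultimately show ?thesis
    by (subst (3) circle_def) (rule measurable_restrict_space2)
qed

lemma circle_measure_pair:
  assumes "circle_measure \<sigma>" "circle_measure \<tau>"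
  shows "(\<lambda>(z, w). z * w) \<in> \<sigma> \<Otimes>\<^sub>M \<tau> \<rightarrow>\<^sub>M circle" "finite_measure (\<sigma> \<Otimes>\<^sub>M \<tau>)"
proof -
  have "sets (\<sigma> \<Otimes>\<^sub>M \<tau>) = sets (circle \<Otimes>\<^sub>M circle)"
    using circle_measureD(2)[OF assms(1)] circle_measureD(2)[OF assms(2)] by (rule sets_pair_measure_cong)
  then show "(\<lambda>(z, w). z * w) \<in> \<sigma> \<Otimes>\<^sub>M \<tau> \<rightarrow>\<^sub>M circle"
    using measurable_circle_mult by (simp cong: measurable_cong_sets)
  show "finite_measure (\<sigma> \<Otimes>\<^sub>M \<tau>)"
    using circle_measureD(1)[OF assms(1)] circle_measureD(1)[OF assms(2)] by (intro finite_measure_pair_measure)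
qed

lemma circle_measure_convolution:
  assumes "circle_measure \<sigma>" "circle_measure \<tau>"
  shows "circle_measure (circle_convolution \<sigma> \<tau>)"
  unfolding circle_measure_def circle_convolution_def
  using finite_measure.finite_measure_distr[OF circle_measure_pair(2,1)[OF assms]] by simp

lemma moment_circle_convolution:
  assumes \<sigma>: "circle_measure \<sigma>" and \<tau>: "circle_measure \<tau>"
  shows "(LINT z|circle_convolution \<sigma> \<tau>. z ^ k) = (LINT z|\<sigma>. z ^ k) * (LINT z|\<tau>. z ^ k)"
proof -
  interpret \<sigma>: finite_measure \<sigma> using circle_measureD[OF \<sigma>] by simp
  interpret \<tau>: finite_measure \<tau> using circle_measureD[OF \<tau>] by simp
  interpret pair_sigma_finite \<sigma> \<tau> ..
  interpret p: finite_measure "\<sigma> \<Otimes>\<^sub>M \<tau>" by (rule circle_measure_pair[OF \<sigma> \<tau>])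
  note [measurable] = circle_measure_borel[OF \<sigma>] circle_measure_borel[OF \<tau>]
  have c: "(\<lambda>z. z ^ k) \<in> borel_measurable circle"
    unfolding circle_def by (intro measurable_restrict_space1) measurable
  have "(LINT z|circle_convolution \<sigma> \<tau>. z ^ k) = (LINT p|(\<sigma> \<Otimes>\<^sub>M \<tau>). (case p of (z, w) \<Rightarrow> z * w) ^ k)"
    unfolding circle_convolution_def by (rule integral_distr[OF circle_measure_pair(1)[OF \<sigma> \<tau>] c])
  also have "\<dots> = (LINT p|(\<sigma> \<Otimes>\<^sub>M \<tau>). (case p of (z, w) \<Rightarrow> z ^ k * w ^ k))"
    by (intro Bochner_Integration.integral_cong) (auto simp: power_mult_distrib)
  also have "\<dots> = (LINT z|\<sigma>. LINT w|\<tau>. z ^ k * w ^ k)"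
  proof -
    have "integrable (\<sigma> \<Otimes>\<^sub>M \<tau>) (\<lambda>(z, w). z ^ k * w ^ k)"
    proof (rule p.integrable_const_bound[of _ 1])
      show "AE x in \<sigma> \<Otimes>\<^sub>M \<tau>. norm (case x of (z, w) \<Rightarrow> z ^ k * w ^ k) \<le> 1"
        using circle_measureD(3)[OF \<sigma>] circle_measureD(3)[OF \<tau>]
        by (intro AE_I2) (auto simp: space_pair_measure norm_mult norm_power)
    qed measurable
    from integral_fst'[OF this] show ?thesis by simp
  qed
  finally show ?thesis by simp
qed

text \<open>By Fubini, a set is null for the convolution iff almost all of its rotates are null for the second
  factor. Absolute continuity preserves both "almost all" and "null".\<close>

lemma circle_convolution_ac:
  assumes \<sigma>: "circle_measure \<sigma>" and \<tau>: "circle_measure \<tau>" and \<sigma>': "circle_measure \<sigma>'" and \<tau>': "circle_measure \<tau>'"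
    and ac: "absolutely_continuous \<sigma> \<sigma>'" "absolutely_continuous \<tau> \<tau>'"
  shows "absolutely_continuous (circle_convolution \<sigma> \<tau>) (circle_convolution \<sigma>' \<tau>')"
proof -
  have sec: "(E \<in> null_sets (circle_convolution \<sigma> \<tau>)) \<longleftrightarrow>
      E \<in> sets circle \<and> (AE z in \<sigma>. {w \<in> sphere 0 1. z * w \<in> E} \<in> null_sets \<tau>)"
    if \<sigma>: "circle_measure \<sigma>" and \<tau>: "circle_measure \<tau>" for E \<sigma> \<tau>
  proof (cases "E \<in> sets circle")
    case True
    interpret \<sigma>: finite_measure \<sigma> using circle_measureD[OF \<sigma>] by simp
    interpret \<tau>: finite_measure \<tau> using circle_measureD[OF \<tau>] by simp
    define X where "X = (\<lambda>(z, w). z * w) -` E \<inter> space (\<sigma> \<Otimes>\<^sub>M \<tau>)"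
    have X: "X \<in> sets (\<sigma> \<Otimes>\<^sub>M \<tau>)"
      unfolding X_def by (rule measurable_sets[OF circle_measure_pair(1)[OF \<sigma> \<tau>] True])
    have slice: "Pair z -` X = {w \<in> sphere 0 1. z * w \<in> E}" if "z \<in> space \<sigma>" for z
      using that unfolding X_def space_pair_measure circle_measureD(3)[OF \<tau>] by auto
    have "emeasure (circle_convolution \<sigma> \<tau>) E = emeasure (\<sigma> \<Otimes>\<^sub>M \<tau>) X"
      unfolding circle_convolution_def X_def by (rule emeasure_distr[OF circle_measure_pair(1)[OF \<sigma> \<tau>] True])
    also have "\<dots> = (\<integral>\<^sup>+z. emeasure \<tau> (Pair z -` X) \<partial>\<sigma>)" by (rule \<tau>.emeasure_pair_measure_alt[OF X])
    finally have "emeasure (circle_convolution \<sigma> \<tau>) E = 0 \<longleftrightarrow> (AE z in \<sigma>. emeasure \<tau> (Pair z -` X) = 0)"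
      using \<tau>.measurable_emeasure_Pair[OF X] by (simp add: nn_integral_0_iff_AE)
    also have "\<dots> \<longleftrightarrow> (AE z in \<sigma>. {w \<in> sphere 0 1. z * w \<in> E} \<in> null_sets \<tau>)"
    proof (rule AE_cong)
      fix z assume z: "z \<in> space \<sigma>"
      show "emeasure \<tau> (Pair z -` X) = 0 \<longleftrightarrow> {w \<in> sphere 0 1. z * w \<in> E} \<in> null_sets \<tau>"
        using sets_Pair1[OF X, of z] unfolding slice[OF z, symmetric] by (simp add: null_sets_def)
    qed
    finally show ?thesis using True by (auto simp: null_sets_def circle_convolution_def)
  qed (auto simp: null_sets_def circle_convolution_def)
  show ?thesis
    unfolding absolutely_continuous_def
  proof
    fix E assume "E \<in> null_sets (circle_convolution \<sigma> \<tau>)"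
    then have E: "E \<in> sets circle" "AE z in \<sigma>. {w \<in> sphere 0 1. z * w \<in> E} \<in> null_sets \<tau>"
      using sec[OF \<sigma> \<tau>] by auto
    have "AE z in \<sigma>'. {w \<in> sphere 0 1. z * w \<in> E} \<in> null_sets \<tau>"
      by (rule absolutely_continuous_AE[OF _ ac(1) E(2)])
         (simp add: circle_measureD(2)[OF \<sigma>] circle_measureD(2)[OF \<sigma>'])
    then have "AE z in \<sigma>'. {w \<in> sphere 0 1. z * w \<in> E} \<in> null_sets \<tau>'"
      using ac(2) unfolding absolutely_continuous_def by (auto elim: eventually_mono)
    then show "E \<in> null_sets (circle_convolution \<sigma>' \<tau>')" using sec[OF \<sigma>' \<tau>'] E(1) by auto
  qed
qed

lemma circle_measure_return: "circle_measure (return circle 1)"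
  unfolding circle_measure_def using prob_space_return[of 1 circle]
  by (auto simp: circle_def space_restrict_space prob_space_def)

lemma circle_measure_convolution_power:
  "circle_measure \<sigma> \<Longrightarrow> circle_measure (convolution_power \<sigma> n)"
  by (induction n) (auto intro: circle_measure_return circle_measure_convolution)

lemma moment_convolution_power:
  assumes "circle_measure \<sigma>"
  shows "(LINT z|convolution_power \<sigma> n. z ^ k) = (LINT z|\<sigma>. z ^ k) ^ n"
proof (induction n)
  case 0
  have "(\<lambda>z. z ^ k) \<in> borel_measurable circle" unfolding circle_def by (intro measurable_restrict_space1) measurable
  then show ?case by (simp add: integral_return circle_def space_restrict_space)
next
  case (Suc n)
  then show ?case
    using moment_circle_convolution[OF assms circle_measure_convolution_power[OF assms]] by simp
qed

lemma convolution_power_ac: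
  assumes "circle_measure \<sigma>" "circle_measure \<nu>" "absolutely_continuous \<sigma> \<nu>"
  shows "absolutely_continuous (convolution_power \<sigma> n) (convolution_power \<nu> n)"
proof (induction n)
  case 0
  show ?case by (simp add: absolutely_continuous_def)
next
  case (Suc n)
  show ?case unfolding convolution_power.simps
    by (intro circle_convolution_ac circle_measure_convolution_power assms Suc)
qed

text \<open>The weighted sum of the measures \<open>m k\<close>. Its moments are computed by passing from nonnegative functions,
  where monotone convergence applies, to bounded real and then complex ones.\<close>

lemma mixture_of_circle_measures:
  fixes m :: "nat \<Rightarrow> complex measure" and w :: "nat \<Rightarrow> real"
  assumes m: "\<And>k. circle_measure (m k)" and w: "\<And>k. w k \<ge> 0"
    and sum: "summable (\<lambda>k. w k * measure (m k) (sphere 0 1))"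
  shows "\<exists>\<tau>. circle_measure \<tau> \<and> (\<forall>E. (\<forall>k. E \<in> null_sets (m k)) \<longrightarrow> E \<in> null_sets \<tau>) \<and>
     (\<forall>j::nat. (\<lambda>k. w k * (LINT z|m k. z ^ j)) sums (LINT z|\<tau>. z ^ j))"
proof -
  define \<tau> where "\<tau> = measure_of (sphere 0 1) (sets circle) (\<lambda>A. \<Sum>k. ennreal (w k) * emeasure (m k) A)"
  have sp: "space circle = sphere 0 1" by (simp add: circle_def space_restrict_space)
  have Pow: "sets circle \<subseteq> Pow (sphere 0 1)" using sets.space_closed[of circle] sp by simp
  have alg: "sigma_algebra (sphere 0 1) (sets circle)" using sets.sigma_algebra_axioms[of circle] sp by simp
  have sets_m: "sets (m k) = sets circle" and space_m: "space (m k) = sphere 0 1" for k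
    using circle_measureD[OF m[of k]] by auto
  have sets_\<tau>: "sets \<tau> = sets circle" unfolding \<tau>_def sets_measure_of[OF Pow] using sets.sigma_sets_eq[of circle] sp by simp
  have space_\<tau>: "space \<tau> = sphere 0 1" unfolding \<tau>_def using Pow by (simp add: space_measure_of)
  have em: "emeasure \<tau> A = (\<Sum>k. ennreal (w k) * emeasure (m k) A)" if "A \<in> sets circle" for A
    unfolding \<tau>_def
  proof (rule emeasure_measure_of_sigma[OF alg _ _ that])
    show "positive (sets circle) (\<lambda>A. \<Sum>k. ennreal (w k) * emeasure (m k) A)" by (simp add: positive_def)
    show "countably_additive (sets circle) (\<lambda>A. \<Sum>k. ennreal (w k) * emeasure (m k) A)"
    proof (rule countably_additiveI)
      fix A :: "nat \<Rightarrow> complex set"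
      assume A: "range A \<subseteq> sets circle" "disjoint_family A" "\<Union> (range A) \<in> sets circle"
      have "(\<Sum>i. \<Sum>k. ennreal (w k) * emeasure (m k) (A i)) = (\<Sum>i. \<integral>\<^sup>+k. ennreal (w k) * emeasure (m k) (A i) \<partial>count_space UNIV)"
        by (simp add: nn_integral_count_space_nat)
      also have "\<dots> = (\<integral>\<^sup>+k. (\<Sum>i. ennreal (w k) * emeasure (m k) (A i)) \<partial>count_space UNIV)"
        by (rule nn_integral_suminf[symmetric]) simp
      also have "\<dots> = (\<Sum>k. \<Sum>i. ennreal (w k) * emeasure (m k) (A i))"
        by (simp add: nn_integral_count_space_nat)
      also have "\<dots> = (\<Sum>k. ennreal (w k) * emeasure (m k) (\<Union> (range A)))"
        using A sets_m by (simp add: suminf_emeasure)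
      finally show "(\<Sum>i. \<Sum>k. ennreal (w k) * emeasure (m k) (A i)) = (\<Sum>k. ennreal (w k) * emeasure (m k) (\<Union> (range A)))" .
    qed
  qed
  have fin_m: "finite_measure (m k)" for k using circle_measureD[OF m[of k]] by simp
  have fin: "finite_measure \<tau>"
  proof
    have "emeasure \<tau> (space \<tau>) = (\<Sum>k. ennreal (w k) * emeasure (m k) (sphere 0 1))"
      using em[of "sphere 0 1"] sp space_\<tau> by (metis sets.top)
    also have "\<dots> = (\<Sum>k. ennreal (w k * measure (m k) (sphere 0 1)))"
      using w by (simp add: finite_measure.emeasure_eq_measure[OF fin_m] ennreal_mult)
    also have "\<dots> < \<infinity>" using sum w by (simp add: suminf_ennreal2 less_top[symmetric])
    finally show "emeasure \<tau> (space \<tau>) \<noteq> \<infinity>" by simp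
  qed
  have \<tau>: "circle_measure \<tau>" unfolding circle_measure_def using fin sets_\<tau> by simp
  have nn: "(\<integral>\<^sup>+z. f z \<partial>\<tau>) = (\<Sum>k. ennreal (w k) * (\<integral>\<^sup>+z. f z \<partial>m k))"
    if "f \<in> borel_measurable \<tau>" for f
    using that
  proof (induction rule: borel_measurable_induct)
    case (cong f g)
    have "(\<integral>\<^sup>+z. f z \<partial>m k) = (\<integral>\<^sup>+z. g z \<partial>m k)" for k
      using cong(3) space_\<tau> space_m by (intro nn_integral_cong) auto
    moreover have "(\<integral>\<^sup>+z. f z \<partial>\<tau>) = (\<integral>\<^sup>+z. g z \<partial>\<tau>)" using cong(3) by (intro nn_integral_cong) auto
    ultimately show ?case using cong by simp
  next
    case (set A)
    then show ?case using em sets_m sets_\<tau> by simp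
  next
    case (mult u c)
    have "u \<in> borel_measurable (m k)" for k
      using mult(2) sets_m sets_\<tau> by (simp cong: measurable_cong_sets)
    then have "(\<Sum>k. ennreal (w k) * (\<integral>\<^sup>+z. c * u z \<partial>m k)) = (\<Sum>k. c * (ennreal (w k) * (\<integral>\<^sup>+z. u z \<partial>m k)))"
      by (simp add: nn_integral_cmult mult.left_commute)
    also have "\<dots> = c * (\<Sum>k. ennreal (w k) * (\<integral>\<^sup>+z. u z \<partial>m k))" by (rule ennreal_suminf_cmult)
    finally show ?case using mult by (simp add: nn_integral_cmult)
  next
    case (add u v)
    have "u \<in> borel_measurable (m k)" "v \<in> borel_measurable (m k)" for k
      using add sets_m sets_\<tau> by (simp_all cong: measurable_cong_sets)
    then show ?case using add by (simp add: nn_integral_add distrib_left suminf_add)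
  next
    case (seq U)
    have Um: "U i \<in> borel_measurable (m k)" for i k
      using seq(1) sets_m sets_\<tau> by (simp cong: measurable_cong_sets)
    have "(\<integral>\<^sup>+z. (SUP i. U i) z \<partial>\<tau>) = (SUP i. \<integral>\<^sup>+z. U i z \<partial>\<tau>)"
      using seq by (simp add: nn_integral_monotone_convergence_SUP image_comp)
    also have "\<dots> = (SUP i. \<integral>\<^sup>+k. ennreal (w k) * (\<integral>\<^sup>+z. U i z \<partial>m k) \<partial>count_space UNIV)"
      using seq by (simp add: nn_integral_count_space_nat)
    also have "\<dots> = (\<integral>\<^sup>+k. (SUP i. ennreal (w k) * (\<integral>\<^sup>+z. U i z \<partial>m k)) \<partial>count_space UNIV)"
      using seq(3) by (intro nn_integral_monotone_convergence_SUP[symmetric])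
        (auto simp: incseq_def le_fun_def intro!: mult_left_mono nn_integral_mono)
    also have "\<dots> = (\<Sum>k. ennreal (w k) * (SUP i. \<integral>\<^sup>+z. U i z \<partial>m k))"
      by (simp add: nn_integral_count_space_nat SUP_mult_left_ennreal)
    also have "\<dots> = (\<Sum>k. ennreal (w k) * (\<integral>\<^sup>+z. (SUP i. U i) z \<partial>m k))"
      using Um seq(3) by (simp add: nn_integral_monotone_convergence_SUP image_comp)
    finally show ?case .
  qed
  have nonneg: "(\<lambda>k. w k * (LINT z|m k. f z)) sums (LINT z|\<tau>. f z)"
    if f: "continuous_on UNIV f" "\<And>z. cmod z = 1 \<Longrightarrow> 0 \<le> f z" "\<And>z. cmod z = 1 \<Longrightarrow> f z \<le> 2" for f :: "complex \<Rightarrow> real"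
  proof -
    have int: "integrable \<nu> f" if "circle_measure \<nu>" for \<nu>
      by (rule continuous_circle_integrable[OF that f(1)])
    have AE: "AE z in \<nu>. 0 \<le> f z" "AE z in \<nu>. f z \<le> 2" if "circle_measure \<nu>" for \<nu>
      using f(2,3) circle_measureD(3)[OF that] by (auto intro!: AE_I2)
    have pos: "0 \<le> w k * (LINT z|m k. f z)" for k
      using w AE[OF m] by (intro mult_nonneg_nonneg integral_nonneg_AE) auto
    have le: "w k * (LINT z|m k. f z) \<le> 2 * (w k * measure (m k) (sphere 0 1))" for k
    proof -
      interpret finite_measure "m k" by (rule fin_m)
      have "(LINT z|m k. f z) \<le> (LINT z|m k. 2)"
        using int[OF m] AE[OF m] by (intro integral_mono_AE) auto
      then show ?thesis using w[of k] space_m by (simp add: mult_left_mono mult.left_commute)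
    qed
    have summ: "summable (\<lambda>k. w k * (LINT z|m k. f z))"
      using pos le by (intro summable_comparison_test'[OF summable_mult[OF sum, of 2]]) auto
    have "ennreal (LINT z|\<tau>. f z) = (\<integral>\<^sup>+z. f z \<partial>\<tau>)"
      by (rule nn_integral_eq_integral[symmetric, OF int[OF \<tau>] AE(1)[OF \<tau>]])
    also have "\<dots> = (\<Sum>k. ennreal (w k) * (\<integral>\<^sup>+z. f z \<partial>m k))"
      using int[OF \<tau>] by (intro nn) auto
    also have "\<dots> = (\<Sum>k. ennreal (w k * (LINT z|m k. f z)))"
      using w by (simp add: nn_integral_eq_integral[OF int[OF m] AE(1)[OF m]] ennreal_mult integral_nonneg_AE[OF AE(1)[OF m]])
    also have "\<dots> = ennreal (\<Sum>k. w k * (LINT z|m k. f z))"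
      using pos summ by (intro suminf_ennreal2) auto
    finally have "(LINT z|\<tau>. f z) = (\<Sum>k. w k * (LINT z|m k. f z))"
      using pos summ AE(1)[OF \<tau>] by (subst (asm) ennreal_inj) (auto intro: suminf_nonneg integral_nonneg_AE)
    then show ?thesis using summ by (simp add: summable_sums)
  qed
  have real: "(\<lambda>k. w k * (LINT z|m k. f z)) sums (LINT z|\<tau>. f z)"
    if f: "continuous_on UNIV f" "\<And>z. cmod z = 1 \<Longrightarrow> \<bar>f z\<bar> \<le> 1" for f :: "complex \<Rightarrow> real"
  proof -
    have b: "-1 \<le> f z \<and> f z \<le> 1" if "cmod z = 1" for z using f(2)[OF that] by (simp add: abs_le_iff)
    have int: "integrable \<nu> f" "integrable \<nu> (\<lambda>z. 1::real)" if "circle_measure \<nu>" for \<nu>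
      using f(1) by (auto intro!: continuous_circle_integrable[OF that])
    have "(\<lambda>k. w k * (LINT z|m k. f z + 1) - w k * (LINT z|m k. 1)) sums ((LINT z|\<tau>. f z + 1) - (LINT z|\<tau>. 1))"
      using b f(1) by (intro sums_diff nonneg continuous_intros) force+
    then show ?thesis
      using int[OF m] int[OF \<tau>] by (simp add: algebra_simps)
  qed
  have "(\<lambda>k. w k * (LINT z|m k. z ^ j)) sums (LINT z|\<tau>. z ^ j)" for j
  proof -
    have int: "integrable \<nu> (\<lambda>z. z ^ j)" if "circle_measure \<nu>" for \<nu>
      using that by (intro continuous_circle_integrable continuous_intros)
    have "\<bar>Re (z ^ j)\<bar> \<le> 1" "\<bar>Im (z ^ j)\<bar> \<le> 1" if "cmod z = 1" for z
      using that abs_Re_le_cmod[of "z ^ j"] abs_Im_le_cmod[of "z ^ j"] by (simp_all add: norm_power)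
    then have "(\<lambda>k. w k * (LINT z|m k. Re (z ^ j))) sums (LINT z|\<tau>. Re (z ^ j))"
        "(\<lambda>k. w k * (LINT z|m k. Im (z ^ j))) sums (LINT z|\<tau>. Im (z ^ j))"
      by (intro real continuous_intros; simp)+
    then show ?thesis
      using int[OF m] int[OF \<tau>] by (simp add: sums_complex_iff)
  qed
  moreover have "E \<in> null_sets \<tau>" if "\<forall>k. E \<in> null_sets (m k)" for E
    using that em[of E] sets_m sets_\<tau> by (auto simp: null_sets_def)
  ultimately show ?thesis using \<tau> by blast
qed

section \<open>Poisson measures\<close>

lemma poisson_generating_function:
  fixes Y :: "'b \<Rightarrow> nat" and c :: complex
  assumes P: "prob_space P" and Y: "Y \<in> measurable P (count_space UNIV)"
    and law: "\<And>k. measure P {\<omega> \<in> space P. Y \<omega> = k} = a ^ k / fact k * exp (- a)" and c: "cmod c \<le> 1" and a: "a \<ge> 0"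
  shows "(LINT \<omega>|P. c ^ Y \<omega>) = exp (of_real a * (c - 1))"
proof -
  interpret prob_space P by fact
  let ?p = "\<lambda>k. a ^ k / fact k * exp (- a)"
  have D: "distr P (count_space UNIV) Y = density (count_space UNIV) (\<lambda>k. ennreal (?p k))"
  proof (rule measure_eqI_countable[of _ UNIV])
    fix k :: nat
    have "emeasure (distr P (count_space UNIV) Y) {k} = emeasure P {\<omega> \<in> space P. Y \<omega> = k}"
      using Y by (subst emeasure_distr) (auto simp: vimage_def Int_def conj_commute intro!: arg_cong2[where f = emeasure])
    also have "\<dots> = ennreal (?p k)" using law[of k] by (simp add: emeasure_eq_measure)
    also have "\<dots> = emeasure (density (count_space UNIV) (\<lambda>k. ennreal (?p k))) {k}"
      by (simp add: emeasure_density)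
    finally show "emeasure (distr P (count_space UNIV) Y) {k} = emeasure (density (count_space UNIV) (\<lambda>k. ennreal (?p k))) {k}" .
  qed auto
  have s: "(\<lambda>k. ?p k *\<^sub>R c ^ k) sums exp (of_real a * (c - 1))"
  proof -
    have "(\<lambda>k. of_real (exp (-a)) * ((of_real a * c) ^ k /\<^sub>R fact k)) sums (of_real (exp (-a)) * exp (of_real a * c))"
      by (intro sums_mult exp_converges)
    also have "(\<lambda>k. complex_of_real (exp (-a)) * ((of_real a * c) ^ k /\<^sub>R fact k)) = (\<lambda>k. ?p k *\<^sub>R c ^ k)"
      by (simp add: fun_eq_iff scaleR_conv_of_real power_mult_distrib field_simps)
    also have "complex_of_real (exp (-a)) * exp (of_real a * c) = exp (of_real a * (c - 1))"
      by (simp add: exp_of_real[symmetric] exp_add[symmetric] algebra_simps del: exp_of_real)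
    finally show ?thesis .
  qed
  have int: "integrable (count_space UNIV) (\<lambda>k. ?p k *\<^sub>R c ^ k)"
    unfolding integrable_count_space_nat_iff
  proof (rule summable_comparison_test')
    have "summable (\<lambda>k. exp (- a) * (inverse (fact k) * a ^ k))" by (intro summable_mult summable_exp)
    then show "summable ?p" by (simp add: field_simps)
    show "norm (norm (?p k *\<^sub>R c ^ k)) \<le> ?p k" if "k \<ge> 0" for k
    proof -
      have "norm (norm (?p k *\<^sub>R c ^ k)) = ?p k * cmod c ^ k" using a by (simp add: norm_power)
      also have "\<dots> \<le> ?p k * 1" using a c by (intro mult_left_mono power_le_one) auto
      finally show ?thesis by simp
    qed
  qed
  have "(LINT \<omega>|P. c ^ Y \<omega>) = (LINT k|distr P (count_space UNIV) Y. c ^ k)"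
    using Y by (subst integral_distr) auto
  also have "\<dots> = (LINT k|count_space UNIV. ?p k *\<^sub>R c ^ k)"
    unfolding D using a by (subst integral_density) auto
  also have "\<dots> = exp (of_real a * (c - 1))"
    using sums_integral_count_space_nat[OF int] s by (rule sums_unique2)
  finally show ?thesis .
qed

text \<open>Fatou's lemma gives integrability of \<open>f\<close>, and then \<open>f\<close> itself dominates the sequence. Below the minorants
  are difference quotients of exponentials, so that moments become derivatives of Laplace
  transforms.\<close>

lemma integral_of_minorants:
  fixes f :: "'a \<Rightarrow> real"
  assumes s: "\<And>n. integrable P (s n)" and bounds: "\<And>n. AE x in P. 0 \<le> s n x \<and> s n x \<le> f x"
    and lim: "AE x in P. (\<lambda>n. s n x) \<longlonglongrightarrow> f x" and L: "(\<lambda>n. LINT x|P. s n x) \<longlonglongrightarrow> L"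
    and f: "f \<in> borel_measurable P"
  shows "integrable P f" and "(LINT x|P. f x) = L"
proof -
  have "(\<integral>\<^sup>+x. ennreal (f x) \<partial>P) = (\<integral>\<^sup>+x. liminf (\<lambda>n. ennreal (s n x)) \<partial>P)"
  proof (rule nn_integral_cong_AE)
    show "AE x in P. ennreal (f x) = liminf (\<lambda>n. ennreal (s n x))"
      using lim by eventually_elim (auto intro!: lim_imp_Liminf[symmetric] tendsto_ennrealI)
  qed
  also have "\<dots> \<le> liminf (\<lambda>n. \<integral>\<^sup>+x. ennreal (s n x) \<partial>P)"
    using s by (intro nn_integral_liminf) auto
  also have "(\<lambda>n. \<integral>\<^sup>+x. ennreal (s n x) \<partial>P) = (\<lambda>n. ennreal (LINT x|P. s n x))"
    using s bounds by (intro ext nn_integral_eq_integral) (auto elim: eventually_mono)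
  also have "liminf \<dots> = ennreal L"
    using L by (intro lim_imp_Liminf tendsto_ennrealI) auto
  finally have fin: "(\<integral>\<^sup>+x. ennreal (f x) \<partial>P) < \<infinity>" using ennreal_less_top by (simp add: le_less_trans)
  have pos: "AE x in P. 0 \<le> f x" using bounds[of 0] by eventually_elim simp
  show int: "integrable P f" using f fin pos by (intro integrableI_nonneg) auto
  have "(\<lambda>n. LINT x|P. s n x) \<longlonglongrightarrow> (LINT x|P. f x)"
  proof (rule integral_dominated_convergence[where w = f])
    show "AE x in P. norm (s n x) \<le> f x" for n using bounds[of n] by eventually_elim simp
  qed (use f s int lim in auto)
  then show "(LINT x|P. f x) = L" using L LIMSEQ_unique by blast
qed

lemma has_real_derivative_sequence:
  fixes g :: "real \<Rightarrow> real"
  assumes "(g has_real_derivative D) (at 0)"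
  shows "(\<lambda>n. (g (1 / Suc n) - g 0) * Suc n) \<longlonglongrightarrow> D"
proof -
  have "((\<lambda>h. (g (0 + h) - g 0) / h) \<longlongrightarrow> D) (at 0)"
    using assms by (simp add: DERIV_def)
  moreover have "filterlim (\<lambda>n. 1 / real (Suc n)) (at 0) sequentially"
    unfolding filterlim_at using LIMSEQ_inverse_real_of_nat by (auto simp: inverse_eq_divide)
  ultimately have "(\<lambda>n. (g (0 + 1 / real (Suc n)) - g 0) / (1 / real (Suc n))) \<longlonglongrightarrow> D"
    by (rule filterlim_compose)
  then show ?thesis by simp
qed

lemma one_minus_exp_difference_quotient:
  fixes x :: real
  assumes "x \<ge> 0"
  shows "0 \<le> (1 - exp (- x / Suc n)) * Suc n" "(1 - exp (- x / Suc n)) * Suc n \<le> x"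
    "(\<lambda>n. (1 - exp (- x / Suc n)) * Suc n) \<longlonglongrightarrow> x"
proof -
  show "0 \<le> (1 - exp (- x / Suc n)) * Suc n" using assms by (intro mult_nonneg_nonneg) (auto simp: divide_nonpos_pos)
  have "1 - exp (- x / Suc n) \<le> x / Suc n" using exp_ge_add_one_self[of "- x / Suc n"] by simp
  then show "(1 - exp (- x / Suc n)) * Suc n \<le> x" by (simp add: field_simps)
  have "((\<lambda>t. - exp (- x * t)) has_real_derivative x) (at 0)"
    by (auto intro!: derivative_eq_intros)
  from has_real_derivative_sequence[OF this] show "(\<lambda>n. (1 - exp (- x / Suc n)) * Suc n) \<longlonglongrightarrow> x"
    by (simp add: field_simps)
qed

abbreviation step_function :: "'a measure \<Rightarrow> ('a \<Rightarrow> 'b::real_vector) \<Rightarrow> bool" where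
  "step_function \<equiv> Bochner_Integration.simple_bochner_integrable"

lemma step_function_support:
  assumes "step_function M f"
  shows "simple_function M f" "{x \<in> space M. f x \<noteq> 0} \<in> fmeasurable M"
    "y \<noteq> 0 \<Longrightarrow> {x \<in> space M. f x = y} \<in> fmeasurable M" "finite (f ` space M)"
proof -
  show sf: "simple_function M f" using assms by (auto elim: simple_bochner_integrable.cases)
  have fin: "emeasure M {x \<in> space M. f x \<noteq> 0} \<noteq> \<infinity>" using assms by (auto elim: simple_bochner_integrable.cases)
  have "f -` (- {0}) \<inter> space M \<in> sets M" using sf by (intro simple_functionD)
  moreover have "f -` (- {0}) \<inter> space M = {x \<in> space M. f x \<noteq> 0}" by auto
  ultimately show 1: "{x \<in> space M. f x \<noteq> 0} \<in> fmeasurable M"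
    using fin by (auto simp: fmeasurable_def less_top)
  show "{x \<in> space M. f x = y} \<in> fmeasurable M" if "y \<noteq> 0"
  proof (rule fmeasurableI2[OF 1])
    have "f -` {y} \<inter> space M \<in> sets M" using sf by (intro simple_functionD)
    moreover have "f -` {y} \<inter> space M = {x \<in> space M. f x = y}" by auto
    ultimately show "{x \<in> space M. f x = y} \<in> sets M" by simp
  qed (use that in auto)
  show "finite (f ` space M)" using sf by (rule simple_functionD)
qed

lemma step_functionI:
  assumes "simple_function M f" "A \<in> fmeasurable M" "\<And>x. x \<in> space M \<Longrightarrow> x \<notin> A \<Longrightarrow> f x = 0"
  shows "step_function M f"
proof (rule simple_bochner_integrable.intros[OF assms(1)])
  have "emeasure M {y \<in> space M. f y \<noteq> 0} \<le> emeasure M A"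
    using assms by (intro emeasure_mono) auto
  then show "emeasure M {y \<in> space M. f y \<noteq> 0} \<noteq> \<infinity>"
    using assms(2) by (auto simp: fmeasurable_def less_top top_unique)
qed

lemma step_function_compose:
  assumes "step_function M f" "p 0 = 0"
  shows "step_function M (\<lambda>x. p (f x))"
  using simple_bochner_integrable_compose2[of "\<lambda>a b. p a" M f f] assms by simp

lemma step_function_indicator:
  assumes "A \<in> fmeasurable M"
  shows "step_function M (\<lambda>x. indicator A x *\<^sub>R c)"
  using assms by (intro step_functionI[of _ _ A])
    (auto intro: simple_function_compose1 simple_function_indicator fmeasurableD)

lemma step_function_integral:
  fixes f :: "'a \<Rightarrow> 'b::{banach, second_countable_topology}"
  assumes "step_function M f"
  shows "integrable M f" "(LINT x|M. f x) = Bochner_Integration.simple_bochner_integral M f"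
  using has_bochner_integral_simple_bochner_integrable[OF assms] by (auto simp: has_bochner_integral_iff)

locale poisson_process =
  fixes M :: "'a measure" and P :: "'a measure measure"
  assumes poisson: "poisson_measure M P"
begin

sublocale prob_space P using poisson by (simp add: poisson_measure_def)

lemma sets_P: "sets P = sets (configuration_algebra M)" and space_P: "space P = configurations M"
  using poisson sets_eq_imp_space_eq[of P "configuration_algebra M"]
  by (auto simp: poisson_measure_def space_configuration_algebra)

lemma configuration_sets:
  assumes "N \<in> space P"
  shows "sets N = sets M" "space N = space M"
  using assms by (auto simp: space_P configurations_def)

lemma emeasure_configuration_cases:
  assumes "N \<in> space P" "A \<in> sets M"
  shows "emeasure N A = \<infinity> \<or> (\<exists>k::nat. emeasure N A = of_nat k)"
proof -
  obtain I :: "nat set" and x where "x \<in> I \<rightarrow> space M" "N = distr (count_space I) M x"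
    using assms(1) by (auto simp: space_P configurations_def)
  then have "emeasure N A = emeasure (count_space I) {i \<in> I. x i \<in> A}"
    using emeasure_configuration assms(2) by blast
  then show ?thesis by (cases "finite {i \<in> I. x i \<in> A}") (auto simp: emeasure_count_space)
qed

lemma measurable_count [measurable]:
  assumes "A \<in> sets M"
  shows "(\<lambda>N. emeasure N A) \<in> borel_measurable P" "(\<lambda>N. measure N A) \<in> borel_measurable P"
proof -
  have "(\<lambda>N. emeasure N A) \<in> borel_measurable (configuration_algebra M)"
    unfolding configuration_algebra_def using assms
    by (intro measurable_Sup1[of "vimage_algebra (configurations M) (\<lambda>N. emeasure N A) borel"]
              imageI measurable_vimage_algebra1) auto
  then show 1: "(\<lambda>N. emeasure N A) \<in> borel_measurable P"
    using sets_P by (simp cong: measurable_cong_sets)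
  then show "(\<lambda>N. measure N A) \<in> borel_measurable P" unfolding measure_def by measurable
qed

text \<open>A set with infinitely many points of the configuration gets the default value \<open>0\<close>, like its \<open>measure\<close>.\<close>

definition count :: "'a set \<Rightarrow> 'a measure \<Rightarrow> nat" where
  "count A N = nat \<lfloor>measure N A\<rfloor>"

lemma measurable_count_nat [measurable]:
  assumes "A \<in> sets M"
  shows "count A \<in> measurable P (count_space UNIV)"
  unfolding count_def using assms by measurable

lemma real_count: "N \<in> space P \<Longrightarrow> A \<in> sets M \<Longrightarrow> real (count A N) = measure N A"
  using emeasure_configuration_cases[of N A]
  by (auto simp: count_def measure_def) (metis of_int_of_nat_eq)

lemma emeasure_eq_count:
  "N \<in> space P \<Longrightarrow> A \<in> sets M \<Longrightarrow> emeasure N A < \<infinity> \<Longrightarrow> emeasure N A = of_nat (count A N)"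
  using emeasure_configuration_cases[of N A] by (auto simp: count_def measure_def)

lemma prob_emeasure_eq:
  assumes "A \<in> fmeasurable M"
  shows "prob {N \<in> space P. emeasure N A = of_nat k} = measure M A ^ k / fact k * exp (- measure M A)"
  using poisson assms by (auto simp: poisson_measure_def fmeasurable_def)

lemma AE_finite:
  assumes A: "A \<in> fmeasurable M"
  shows "AE N in P. emeasure N A < \<infinity>"
proof -
  have [measurable]: "A \<in> sets M" using A by auto
  let ?B = "\<lambda>k::nat. {N \<in> space P. emeasure N A = of_nat k}"
  have "(\<lambda>k. prob (?B k)) sums prob (\<Union>k. ?B k)"
    by (intro finite_measure_UNION) (auto simp: disjoint_family_on_def)
  moreover have "(\<lambda>k. prob (?B k)) sums 1"
  proof -
    have "(\<lambda>k. exp (- measure M A) * (measure M A ^ k /\<^sub>R fact k)) sums (exp (- measure M A) * exp (measure M A))"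
      by (intro sums_mult exp_converges)
    then show ?thesis
      unfolding prob_emeasure_eq[OF A] by (simp add: exp_minus field_simps)
  qed
  ultimately have "prob (\<Union>k. ?B k) = 1" by (rule sums_unique2)
  then have "AE N in P. N \<in> (\<Union>k. ?B k)" by (intro AE_prob_1)
  then show ?thesis by eventually_elim (auto simp: ennreal_of_nat_eq_real_of_nat)
qed

lemma prob_count_eq:
  assumes A: "A \<in> fmeasurable M"
  shows "prob {N \<in> space P. count A N = k} = measure M A ^ k / fact k * exp (- measure M A)"
proof -
  have [measurable]: "A \<in> sets M" using A by auto
  have "AE N in P. (count A N = k) = (emeasure N A = of_nat k)"
    using AE_finite[OF A] AE_space
  proof eventually_elim
    case (elim N)
    then have "emeasure N A = of_nat (count A N)" using A by (intro emeasure_eq_count) auto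
    then show ?case by (auto simp: ennreal_of_nat_eq_real_of_nat)
  qed
  then have "prob {N \<in> space P. count A N = k} = prob {N \<in> space P. emeasure N A = of_nat k}"
    by (intro finite_measure_eq_AE) auto
  then show ?thesis using prob_emeasure_eq[OF A] by simp
qed

lemma AE_null:
  assumes "A \<in> null_sets M"
  shows "AE N in P. emeasure N A = 0"
proof -
  have A: "A \<in> fmeasurable M" using assms by (auto simp: null_sets_def fmeasurable_def)
  then have [measurable]: "A \<in> sets M" by auto
  have "measure M A = 0" using assms by (simp add: measure_def null_setsD1)
  then have "prob {N \<in> space P. emeasure N A = 0} = 1"
    using prob_emeasure_eq[OF A, of 0] by simp
  then have "AE N in P. N \<in> {N \<in> space P. emeasure N A = 0}" by (rule AE_prob_1)
  then show ?thesis by eventually_elim auto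
qed

lemma exponential_moment_set:
  fixes \<zeta> :: complex
  assumes A: "A \<in> fmeasurable M" and \<zeta>: "Re \<zeta> \<le> 0"
  shows "(LINT N|P. exp (of_real (measure N A) * \<zeta>)) = exp (of_real (measure M A) * (exp \<zeta> - 1))"
proof -
  have [measurable]: "A \<in> sets M" using A by auto
  have "(LINT N|P. exp (of_real (measure N A) * \<zeta>)) = (LINT N|P. exp \<zeta> ^ count A N)"
    by (intro Bochner_Integration.integral_cong) (simp_all add: real_count[symmetric] exp_of_nat_mult)
  also have "\<dots> = exp (of_real (measure M A) * (exp \<zeta> - 1))"
    using prob_count_eq[OF A] \<zeta> by (intro poisson_generating_function) (auto intro: prob_space_axioms)
  finally show ?thesis .
qed

text \<open>Independence factors the expectation over the sets of the family.\<close>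

lemma exponential_moment_finite_family:
  fixes \<zeta> :: "'a set \<Rightarrow> complex"
  assumes \<A>: "finite \<A>" "disjoint \<A>" "\<A> \<subseteq> fmeasurable M" and \<zeta>: "\<And>A. A \<in> \<A> \<Longrightarrow> Re (\<zeta> A) \<le> 0"
  shows "(LINT N|P. exp (\<Sum>A\<in>\<A>. of_real (measure N A) * \<zeta> A)) = exp (\<Sum>A\<in>\<A>. of_real (measure M A) * (exp (\<zeta> A) - 1))"
proof -
  have sets: "A \<in> sets M" if "A \<in> \<A>" for A using \<A>(3) that by auto
  have "indep_vars (\<lambda>_. borel) (\<lambda>A N. emeasure N A) \<A>"
    using poisson \<A>(2) sets unfolding poisson_measure_def by blast
  then have ind: "indep_vars (\<lambda>_. borel) (\<lambda>A N. exp (of_real (enn2real (emeasure N A)) * \<zeta> A)) \<A>"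
    by (rule indep_vars_compose2[where Y = "\<lambda>A v. exp (of_real (enn2real v) * \<zeta> A)"]) measurable
  have int: "integrable P (\<lambda>N. exp (of_real (enn2real (emeasure N A)) * \<zeta> A))" if "A \<in> \<A>" for A
  proof (rule integrable_const_bound[of _ 1])
    show "AE N in P. norm (exp (complex_of_real (enn2real (emeasure N A)) * \<zeta> A)) \<le> 1"
      using \<zeta>[OF that] by (intro AE_I2) (auto intro: mult_nonneg_nonpos)
  qed (use sets[OF that] in measurable)
  have "(LINT N|P. exp (\<Sum>A\<in>\<A>. of_real (measure N A) * \<zeta> A)) = (LINT N|P. (\<Prod>A\<in>\<A>. exp (of_real (enn2real (emeasure N A)) * \<zeta> A)))"
    using \<A>(1) by (simp add: exp_sum measure_def)
  also have "\<dots> = (\<Prod>A\<in>\<A>. LINT N|P. exp (of_real (enn2real (emeasure N A)) * \<zeta> A))"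
    using \<A>(1) ind int by (rule indep_vars_lebesgue_integral)
  also have "\<dots> = (\<Prod>A\<in>\<A>. exp (of_real (measure M A) * (exp (\<zeta> A) - 1)))"
    using \<A>(3) \<zeta> by (intro prod.cong refl, fold measure_def, intro exponential_moment_set) auto
  finally show ?thesis using \<A>(1) by (simp add: exp_sum)
qed

text \<open>The sum of \<open>f\<close> over the points of a configuration. For a step function this is a finite sum, measurable
  on all configurations; linearity in \<open>f\<close> holds on configurations with finitely many points in the
  supports, thus almost surely.\<close>

abbreviation stat :: "('a \<Rightarrow> 'b::real_vector) \<Rightarrow> 'a measure \<Rightarrow> 'b" where
  "stat f N \<equiv> Bochner_Integration.simple_bochner_integral N f"

lemma stat_eq:
  assumes "N \<in> space P" "simple_function M f"
  shows "stat f N = (\<Sum>y\<in>f ` space M - {0}. measure N {x \<in> space M. f x = y} *\<^sub>R y)"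
  unfolding simple_bochner_integral_def configuration_sets[OF assms(1)]
  using simple_functionD(1)[OF assms(2)] by (intro sum.mono_neutral_right) auto

lemma measurable_stat:
  fixes f :: "'a \<Rightarrow> 'b::{banach, second_countable_topology}"
  assumes "step_function M f"
  shows "stat f \<in> borel_measurable P"
proof (subst measurable_cong[OF stat_eq])
  show "simple_function M f" using step_function_support[OF assms] by simp
  have "{x \<in> space M. f x = y} \<in> sets M" if "y \<in> f ` space M - {0}" for y
    using step_function_support(3)[OF assms, of y] that by auto
  then show "(\<lambda>N. \<Sum>y\<in>f ` space M - {0}. measure N {x \<in> space M. f x = y} *\<^sub>R y) \<in> borel_measurable P"
    by (intro borel_measurable_sum borel_measurable_scaleR measurable_count) auto
qed auto

lemma AE_step_function:
  assumes f: "step_function M f"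
  shows "AE N in P. step_function N f"
proof -
  note s = step_function_support[OF f]
  show ?thesis
    using AE_finite[OF s(2)] AE_space
  proof eventually_elim
    case (elim N)
    then show ?case
      using s(1) configuration_sets[OF elim(2)]
      by (intro simple_bochner_integrable.intros) (auto simp: simple_function_def)
  qed
qed

lemma AE_stat_add:
  assumes "step_function M f" "step_function M g"
  shows "AE N in P. stat (\<lambda>x. f x + g x) N = stat f N + stat g N"
  using AE_step_function[OF assms(1)] AE_step_function[OF assms(2)]
  by eventually_elim (rule simple_bochner_integral_add)

lemma AE_stat_linear:
  fixes f :: "'a \<Rightarrow> 'b::real_normed_vector"
  assumes "linear h" "step_function M f"
  shows "AE N in P. stat (\<lambda>x. h (f x)) N = h (stat f N)"
proof -
  interpret linear h by fact
  show ?thesis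
    using AE_step_function[OF assms(2)]
    by eventually_elim (rule simple_bochner_integral_linear[OF linear_axioms])
qed

lemma stat_indicator:
  assumes "N \<in> space P" "A \<in> sets M"
  shows "stat (indicator A :: 'a \<Rightarrow> real) N = measure N A"
proof -
  have A: "A \<subseteq> space M" using assms(2) sets.sets_into_space by blast
  have "stat (indicator A :: 'a \<Rightarrow> real) N = (\<Sum>y\<in>indicator A ` space M - {0::real}. measure N {x \<in> space M. indicator A x = y} *\<^sub>R y)"
    using assms by (intro stat_eq) auto
  also have "\<dots> = (\<Sum>y\<in>{1}. measure N {x \<in> space M. indicator A x = y} *\<^sub>R y)"
  proof (cases "A = {}")
    case False
    then have "indicator A ` space M - {0::real} = {1}" using A by (auto simp: indicator_def image_def)
    then show ?thesis by simp
  qed simp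
  also have "\<dots> = measure N {x \<in> space M. indicator A x = (1::real)}" by simp
  also have "{x \<in> space M. indicator A x = (1::real)} = A" using A by (auto simp: indicator_def)
  finally show ?thesis by simp
qed

text \<open>The Laplace functional and the characteristic function of a linear statistic in one formula: the level
  sets of \<open>z\<close> are disjoint, so their point counts are independent.\<close>

lemma exponential_moment_stat:
  fixes z :: "'a \<Rightarrow> complex"
  assumes z: "step_function M z" and Re: "\<And>x. x \<in> space M \<Longrightarrow> Re (z x) \<le> 0"
  shows "(LINT N|P. exp (stat z N)) = exp (LINT x|M. exp (z x) - 1)"
proof -
  note s = step_function_support[OF z]
  define Y where "Y = z ` space M - {0}"
  define B where "B y = {x \<in> space M. z x = y}" for y
  have B: "B y \<in> fmeasurable M" "B y \<noteq> {}" "z ` B y = {y}" if "y \<in> Y" for y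
    using that s(3) by (auto simp: Y_def B_def)
  have inj: "inj_on B Y" using B(3) by (metis inj_onI singleton_inject)
  have finY: "finite Y" using s(4) by (simp add: Y_def)
  have disj: "disjoint (B ` Y)" by (auto simp: disjoint_def B_def)
  define \<zeta> where "\<zeta> A = the_elem (z ` A)" for A
  have \<zeta>: "\<zeta> (B y) = y" if "y \<in> Y" for y using B(3)[OF that] by (simp add: \<zeta>_def)
  have "(LINT N|P. exp (stat z N)) = (LINT N|P. exp (\<Sum>A\<in>B ` Y. of_real (measure N A) * \<zeta> A))"
  proof (intro Bochner_Integration.integral_cong refl arg_cong[where f = exp])
    fix N assume "N \<in> space P"
    then show "stat z N = (\<Sum>A\<in>B ` Y. of_real (measure N A) * \<zeta> A)"
      using stat_eq[of N z] s(1) \<zeta> by (simp add: sum.reindex[OF inj] Y_def[symmetric] B_def[symmetric] scaleR_conv_of_real)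
  qed
  also have "\<dots> = exp (\<Sum>A\<in>B ` Y. of_real (measure M A) * (exp (\<zeta> A) - 1))"
  proof (rule exponential_moment_finite_family)
    fix A assume "A \<in> B ` Y"
    then obtain x where "x \<in> space M" "\<zeta> A = z x" using \<zeta> by (auto simp: Y_def)
    then show "Re (\<zeta> A) \<le> 0" using Re by simp
  qed (use finY disj B(1) in auto)
  also have "(\<Sum>A\<in>B ` Y. of_real (measure M A) * (exp (\<zeta> A) - 1)) = (\<Sum>y\<in>Y. of_real (measure M (B y)) * (exp y - 1))"
    using \<zeta> by (simp add: sum.reindex[OF inj])
  also have "\<dots> = (LINT x|M. exp (z x) - 1)"
  proof -
    have "(LINT x|M. exp (z x) - 1) = (LINT x|M. (\<Sum>y\<in>Y. indicator (B y) x *\<^sub>R (exp y - 1)))"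
    proof (intro Bochner_Integration.integral_cong refl)
      fix x assume x: "x \<in> space M"
      have "(\<Sum>y\<in>Y. indicator (B y) x *\<^sub>R (exp y - 1)) = (\<Sum>y\<in>Y. if y = z x then exp y - 1 else 0)"
        using x by (intro sum.cong) (auto simp: B_def indicator_def)
      also have "\<dots> = exp (z x) - 1" using x finY by (auto simp: Y_def)
      finally show "exp (z x) - 1 = (\<Sum>y\<in>Y. indicator (B y) x *\<^sub>R (exp y - 1))" ..
    qed
    also have "\<dots> = (\<Sum>y\<in>Y. measure M (B y) *\<^sub>R (exp y - 1))"
      using B(1) by (subst Bochner_Integration.integral_sum)
        (auto simp: fmeasurable_def less_top intro!: sum.cong integrable_scaleR_left integrable_real_indicator arg_cong2[where f = measure] dest: sets.sets_into_space)
    finally show ?thesis by (simp add: scaleR_conv_of_real)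
  qed
  finally show ?thesis .
qed

end

section \<open>Moments of linear statistics\<close>

lemma step_function_partition:
  fixes h :: "'a \<Rightarrow> real" and \<phi> :: "'a \<Rightarrow> real"
  assumes h: "step_function M h" and \<phi>: "\<And>A. A \<in> fmeasurable M \<Longrightarrow> integrable M (\<lambda>x. indicator A x * \<phi> x)"
  shows "integrable M (\<lambda>x. h x * \<phi> x)"
    and "(LINT x|M. h x * \<phi> x) = (\<Sum>y\<in>h ` space M - {0}. y * (LINT x|M. indicator {x \<in> space M. h x = y} x * \<phi> x))"
proof -
  note s = step_function_support[OF h]
  have eq: "h x * \<phi> x = (\<Sum>y\<in>h ` space M - {0}. y * (indicator {x \<in> space M. h x = y} x * \<phi> x))"
    if x: "x \<in> space M" for x
  proof -
    have "(\<Sum>y\<in>h ` space M - {0}. y * (indicator {x \<in> space M. h x = y} x * \<phi> x)) =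
        (\<Sum>y\<in>h ` space M - {0}. if y = h x then h x * \<phi> x else 0)"
      using x by (intro sum.cong) (auto simp: indicator_def)
    also have "\<dots> = h x * \<phi> x" using x s(4) by (auto simp: sum.delta)
    finally show ?thesis ..
  qed
  have int: "integrable M (\<lambda>x. y * (indicator {x \<in> space M. h x = y} x * \<phi> x))" if "y \<in> h ` space M - {0}" for y
    using that s(3) by (intro integrable_mult_right \<phi>) auto
  have "integrable M (\<lambda>x. \<Sum>y\<in>h ` space M - {0}. y * (indicator {x \<in> space M. h x = y} x * \<phi> x))"
    using int by (rule Bochner_Integration.integrable_sum)
  then show "integrable M (\<lambda>x. h x * \<phi> x)" by (subst Bochner_Integration.integrable_cong[OF refl eq]) auto
  have "(LINT x|M. h x * \<phi> x) = (LINT x|M. (\<Sum>y\<in>h ` space M - {0}. y * (indicator {x \<in> space M. h x = y} x * \<phi> x)))"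
    using eq by (intro Bochner_Integration.integral_cong) auto
  also have "\<dots> = (\<Sum>y\<in>h ` space M - {0}. LINT x|M. y * (indicator {x \<in> space M. h x = y} x * \<phi> x))"
    using int by (rule Bochner_Integration.integral_sum)
  finally show "(LINT x|M. h x * \<phi> x) = (\<Sum>y\<in>h ` space M - {0}. y * (LINT x|M. indicator {x \<in> space M. h x = y} x * \<phi> x))"
    by simp
qed

lemma integrable_indicator_mult_exp:
  fixes u :: "'a \<Rightarrow> real"
  assumes u: "step_function M u" and A: "A \<in> fmeasurable M"
  shows "integrable M (\<lambda>x. indicator A x * exp (- u x))"
proof -
  have sf: "simple_function M u" using step_function_support[OF u] by simp
  have "step_function M (\<lambda>x. indicator A x * exp (- u x))"
    using sf A by (intro step_functionI[of _ _ A] simple_function_mult simple_function_compose1[of M u "\<lambda>y. exp (- y)"] simple_function_indicator) auto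
  then show ?thesis by (rule step_function_integral)
qed

lemma step_function_exp_minus_one:
  fixes u :: "'a \<Rightarrow> real"
  assumes "step_function M u"
  shows "step_function M (\<lambda>x. exp (- u x) - 1)"
  using step_function_compose[OF assms, of "\<lambda>y. exp (- y) - 1"] by simp

lemma step_function_add:
  assumes "step_function M f" "step_function M g"
  shows "step_function M (\<lambda>x. f x + g x)"
  using simple_bochner_integrable_compose2[of "(+)" M f g] assms by simp

lemma step_function_mult:
  fixes f :: "'a \<Rightarrow> real"
  assumes "step_function M f" "step_function M g"
  shows "step_function M (\<lambda>x. f x * g x)"
  using simple_bochner_integrable_compose2[of "(*)" M f g] assms by simp

lemma step_function_cmult:
  fixes f :: "'a \<Rightarrow> real"
  assumes "step_function M f"
  shows "step_function M (\<lambda>x. c * f x)"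
  using step_function_compose[OF assms, of "\<lambda>y. c * y"] by simp

lemma step_function_indicator_real:
  assumes "A \<in> fmeasurable M"
  shows "step_function M (indicator A :: 'a \<Rightarrow> real)"
  using step_function_indicator[OF assms, of "1::real"] by simp

lemma step_function_preserves:
  assumes T: "preserves M T" and f: "step_function M f"
  shows "step_function M (\<lambda>x. f (T x))"
proof (rule step_functionI)
  show "simple_function M (\<lambda>x. f (T x))"
    using simple_function_comp[OF preserves_measurable[OF T] step_function_support(1)[OF f]] .
  show "T -` {x \<in> space M. f x \<noteq> 0} \<inter> space M \<in> fmeasurable M"
    using preserves_fmeasurable[OF T] step_function_support(2)[OF f] by blast
  show "f (T x) = 0" if "x \<in> space M" "x \<notin> T -` {x \<in> space M. f x \<noteq> 0} \<inter> space M" for x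
    using that measurable_space[OF preserves_measurable[OF T]] by auto
qed

lemma simple_bochner_integral_zero [simp]: "Bochner_Integration.simple_bochner_integral N (\<lambda>x. 0::real) = 0"
  unfolding Bochner_Integration.simple_bochner_integral_def by (intro sum.neutral) auto

context poisson_process
begin

lemma stat_nonneg:
  fixes u :: "'a \<Rightarrow> real"
  assumes "N \<in> space P" "simple_function M u" "\<And>x. x \<in> space M \<Longrightarrow> 0 \<le> u x"
  shows "0 \<le> stat u N"
  unfolding stat_eq[OF assms(1,2)] using assms(3) by (intro sum_nonneg) auto

lemma exp_stat_bounds:
  fixes u :: "'a \<Rightarrow> real"
  assumes "step_function M u" "\<And>x. x \<in> space M \<Longrightarrow> 0 \<le> u x" "N \<in> space P"
  shows "0 < exp (- stat u N)" "exp (- stat u N) \<le> 1"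
  using stat_nonneg[OF assms(3) step_function_support(1)[OF assms(1)] assms(2)] by auto

lemma integrable_exp_stat:
  fixes u :: "'a \<Rightarrow> real"
  assumes "step_function M u" "\<And>x. x \<in> space M \<Longrightarrow> 0 \<le> u x"
  shows "integrable P (\<lambda>N. exp (- stat u N))"
proof (rule integrable_const_bound[of _ 1])
  show "AE N in P. norm (exp (- stat u N)) \<le> 1" using exp_stat_bounds[OF assms] by (intro AE_I2) auto
  show "(\<lambda>N. exp (- stat u N)) \<in> borel_measurable P"
    using measurable_stat[OF assms(1)] by measurable
qed

lemma Laplace_functional:
  fixes u :: "'a \<Rightarrow> real"
  assumes u: "step_function M u" and nonneg: "\<And>x. x \<in> space M \<Longrightarrow> 0 \<le> u x"
  shows "(LINT N|P. exp (- stat u N)) = exp (LINT x|M. exp (- u x) - 1)"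
proof -
  have lin: "linear (\<lambda>r. complex_of_real (- r))"
    by (rule linearI) (auto simp: scaleR_conv_of_real)
  have z: "step_function M (\<lambda>x. complex_of_real (- u x))"
    using step_function_compose[OF u, of "\<lambda>r. complex_of_real (- r)"] by simp
  have "complex_of_real (LINT N|P. exp (- stat u N)) = (LINT N|P. complex_of_real (exp (- stat u N)))"
    by (rule integral_complex_of_real[symmetric])
  also have "\<dots> = (LINT N|P. exp (stat (\<lambda>x. complex_of_real (- u x)) N))"
  proof (rule integral_cong_AE)
    show "AE N in P. complex_of_real (exp (- stat u N)) = exp (stat (\<lambda>x. complex_of_real (- u x)) N)"
      using AE_stat_linear[OF lin u] by eventually_elim (simp flip: exp_of_real)
    show "(\<lambda>N. complex_of_real (exp (- stat u N))) \<in> borel_measurable P"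
        "(\<lambda>N. exp (stat (\<lambda>x. complex_of_real (- u x)) N)) \<in> borel_measurable P"
      using measurable_stat[OF u] measurable_stat[OF z] by measurable
  qed
  also have "\<dots> = exp (LINT x|M. exp (complex_of_real (- u x)) - 1)"
    using nonneg by (intro exponential_moment_stat[OF z]) simp
  also have "(LINT x|M. exp (complex_of_real (- u x)) - 1) = (LINT x|M. complex_of_real (exp (- u x) - 1))"
    by (simp flip: exp_of_real)
  also have "exp \<dots> = complex_of_real (exp (LINT x|M. exp (- u x) - 1))"
    by (simp only: integral_complex_of_real exp_of_real)
  finally show ?thesis by (simp only: of_real_eq_iff)
qed

lemma AE_stat_add_indicator:
  fixes u :: "'a \<Rightarrow> real"
  assumes u: "step_function M u" and A: "A \<in> fmeasurable M"
  shows "AE N in P. stat (\<lambda>x. u x + t * indicator A x) N = stat u N + t * measure N A"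
proof -
  have lin: "linear (\<lambda>r::real. t * r)" by (rule linearI) (auto simp: algebra_simps)
  have i: "step_function M (indicator A :: 'a \<Rightarrow> real)" by (rule step_function_indicator_real[OF A])
  show ?thesis
    using AE_stat_add[OF u step_function_cmult[OF i, of t]] AE_stat_linear[OF lin i] AE_space
    by eventually_elim (use A in \<open>auto simp: stat_indicator fmeasurableD\<close>)
qed

text \<open>Minus the right derivative at \<open>t = 0\<close> of the Laplace functional of \<open>u + t 1\<^sub>A\<close>.\<close>

lemma count_exp_moment:
  fixes u :: "'a \<Rightarrow> real"
  assumes A: "A \<in> fmeasurable M" and u: "step_function M u" and nonneg: "\<And>x. x \<in> space M \<Longrightarrow> 0 \<le> u x"
  shows "integrable P (\<lambda>N. measure N A * exp (- stat u N))"
    and "(LINT N|P. measure N A * exp (- stat u N)) =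
      (LINT x|M. indicator A x * exp (- u x)) * exp (LINT x|M. exp (- u x) - 1)"
proof -
  have [measurable]: "A \<in> sets M" using A by auto
  note [measurable] = measurable_stat[OF u]
  define c where "c = (LINT x|M. exp (- u x) - 1)"
  define m where "m = (LINT x|M. indicator A x * exp (- u x))"
  \<comment> \<open>Minus the Laplace functional of \<open>u + t 1\<^sub>A\<close>.\<close>
  define g where "g t = - exp (c + (exp (- t) - 1) * m)" for t
  define s where "s n N = (1 - exp (- measure N A / Suc n)) * Suc n * exp (- stat u N)" for n N
  have step: "step_function M (\<lambda>x. u x + t * indicator A x)" for t
    by (intro step_function_add u step_function_cmult step_function_indicator_real A)
  have L: "(LINT N|P. exp (- stat u N) * exp (- t * measure N A)) = - g t"
    and Li: "integrable P (\<lambda>N. exp (- stat u N) * exp (- t * measure N A))" if t: "t \<ge> 0" for t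
  proof -
    have pos: "0 \<le> u x + t * indicator A x" if "x \<in> space M" for x using nonneg[OF that] t by simp
    have ae: "AE N in P. exp (- stat (\<lambda>x. u x + t * indicator A x) N) = exp (- stat u N) * exp (- t * measure N A)"
      using AE_stat_add_indicator[OF u A, of t] by eventually_elim (simp add: exp_add[symmetric])
    have "integrable P (\<lambda>N. exp (- stat (\<lambda>x. u x + t * indicator A x) N))"
      using step pos by (rule integrable_exp_stat)
    moreover have [measurable]: "stat (\<lambda>x. u x + t * indicator A x) \<in> borel_measurable P"
      by (rule measurable_stat[OF step])
    ultimately show "integrable P (\<lambda>N. exp (- stat u N) * exp (- t * measure N A))"
      using ae by (subst (asm) integrable_cong_AE) auto
    have "(LINT N|P. exp (- stat u N) * exp (- t * measure N A)) = (LINT N|P. exp (- stat (\<lambda>x. u x + t * indicator A x) N))"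
      using ae measurable_stat[OF step] by (intro integral_cong_AE) auto
    also have "\<dots> = exp (LINT x|M. exp (- (u x + t * indicator A x)) - 1)"
      using step pos by (rule Laplace_functional)
    also have "(LINT x|M. exp (- (u x + t * indicator A x)) - 1) =
        (LINT x|M. (exp (- u x) - 1) + (exp (- t) - 1) * (indicator A x * exp (- u x)))"
      by (intro Bochner_Integration.integral_cong) (auto simp: indicator_def algebra_simps exp_add[symmetric])
    also have "\<dots> = c + (exp (- t) - 1) * m"
      unfolding c_def m_def
      using step_function_integral(1)[OF step_function_exp_minus_one[OF u]] integrable_indicator_mult_exp[OF u A]
      by (subst Bochner_Integration.integral_add) auto
    finally show "(LINT N|P. exp (- stat u N) * exp (- t * measure N A)) = - g t" by (simp add: g_def)
  qed
  have s_eq: "s n N = (exp (- stat u N) * exp (- 0 * measure N A) - exp (- stat u N) * exp (- (1 / Suc n) * measure N A)) * Suc n" for n N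
    by (simp add: s_def algebra_simps)
  have s_int: "integrable P (s n)" for n
    unfolding s_eq[abs_def] by (intro integrable_mult_left Bochner_Integration.integrable_diff Li) auto
  have s_val: "(LINT N|P. s n N) = (g (1 / Suc n) - g 0) * Suc n" for n
  proof -
    have "(LINT N|P. s n N) = ((LINT N|P. exp (- stat u N) * exp (- 0 * measure N A)) - (LINT N|P. exp (- stat u N) * exp (- (1 / Suc n) * measure N A))) * Suc n"
      unfolding s_eq[abs_def] integral_mult_left_zero
      by (subst Bochner_Integration.integral_diff[OF Li Li]) simp_all
    also have "\<dots> = (- g 0 - - g (1 / Suc n)) * Suc n" by (subst (1 2) L) auto
    finally show ?thesis by simp
  qed
  have "(g has_real_derivative m * exp c) (at 0)"
    unfolding g_def by (auto intro!: derivative_eq_intros)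
  from has_real_derivative_sequence[OF this] have lim: "(\<lambda>n. LINT N|P. s n N) \<longlonglongrightarrow> m * exp c"
    unfolding s_val .
  have b: "AE N in P. 0 \<le> s n N \<and> s n N \<le> measure N A * exp (- stat u N)" for n
    unfolding s_def using one_minus_exp_difference_quotient(1,2)[OF measure_nonneg]
    by (intro AE_I2 conjI mult_nonneg_nonneg mult_right_mono) auto
  have conv: "AE N in P. (\<lambda>n. s n N) \<longlonglongrightarrow> measure N A * exp (- stat u N)"
    unfolding s_def using one_minus_exp_difference_quotient(3)[OF measure_nonneg]
    by (intro AE_I2 tendsto_mult tendsto_const) auto
  show "integrable P (\<lambda>N. measure N A * exp (- stat u N))"
    by (rule integral_of_minorants(1)[OF s_int b conv lim]) measurable
  show "(LINT N|P. measure N A * exp (- stat u N)) =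
      (LINT x|M. indicator A x * exp (- u x)) * exp (LINT x|M. exp (- u x) - 1)"
    unfolding c_def[symmetric] m_def[symmetric]
    by (rule integral_of_minorants(2)[OF s_int b conv lim]) measurable
qed

lemma count_moment:
  assumes A: "A \<in> fmeasurable M"
  shows "integrable P (\<lambda>N. measure N A)" "(LINT N|P. measure N A) = measure M A"
proof -
  have z: "step_function M (\<lambda>x. 0::real)" by (intro step_functionI[of _ _ "{}"]) auto
  then show "integrable P (\<lambda>N. measure N A)" "(LINT N|P. measure N A) = measure M A"
    using count_exp_moment[OF A z] A by (simp_all add: fmeasurable_def sets.Int_space_eq2)
qed

text \<open>Minus the right derivative at \<open>t = 0\<close> of the formula \<open>count_exp_moment\<close> for \<open>u = t 1\<^sub>B\<close>.\<close>

lemma count_product_moment: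
  assumes A: "A \<in> fmeasurable M" and B: "B \<in> fmeasurable M"
  shows "integrable P (\<lambda>N. measure N A * measure N B)"
    and "(LINT N|P. measure N A * measure N B) = measure M (A \<inter> B) + measure M A * measure M B"
proof -
  have [measurable]: "A \<in> sets M" "B \<in> sets M" using A B by auto
  define g where "g t = - ((measure M A + (exp (- t) - 1) * measure M (A \<inter> B)) * exp ((exp (- t) - 1) * measure M B))" for t
  define s where "s n N = measure N A * ((1 - exp (- measure N B / Suc n)) * Suc n)" for n N
  have step: "step_function M (\<lambda>x. t * indicator B x :: real)" for t
    by (intro step_function_cmult step_function_indicator_real B)
  have L: "(LINT N|P. measure N A * exp (- t * measure N B)) = - g t"
    and Li: "integrable P (\<lambda>N. measure N A * exp (- t * measure N B))" if t: "t \<ge> 0" for t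
  proof -
    have pos: "0 \<le> (t * indicator B x :: real)" for x using t by simp
    have z: "step_function M (\<lambda>x. 0::real)" by (intro step_functionI[of _ _ "{}"]) auto
    have ae: "AE N in P. measure N A * exp (- stat (\<lambda>x. t * indicator B x :: real) N) = measure N A * exp (- t * measure N B)"
      using AE_stat_add_indicator[OF z B, of t]
      by eventually_elim simp
    have [measurable]: "stat (\<lambda>x. t * indicator B x :: real) \<in> borel_measurable P"
      by (rule measurable_stat[OF step])
    note m = count_exp_moment[OF A step pos]
    show "integrable P (\<lambda>N. measure N A * exp (- t * measure N B))"
      using m(1) ae by (subst integrable_cong_AE[of _ _ "\<lambda>N. measure N A * exp (- stat (\<lambda>x. t * indicator B x :: real) N)"]) auto
    have "(LINT N|P. measure N A * exp (- t * measure N B)) = (LINT N|P. measure N A * exp (- stat (\<lambda>x. t * indicator B x :: real) N))"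
      using ae measurable_stat[OF step] by (intro integral_cong_AE) auto
    also have "\<dots> = (LINT x|M. indicator A x * exp (- (t * indicator B x))) * exp (LINT x|M. exp (- (t * indicator B x)) - 1)"
      by (rule m(2))
    also have "(LINT x|M. indicator A x * exp (- (t * indicator B x))) = (LINT x|M. indicator A x + (exp (- t) - 1) * indicator (A \<inter> B) x)"
      by (intro Bochner_Integration.integral_cong) (auto simp: indicator_def)
    also have "\<dots> = measure M A + (exp (- t) - 1) * measure M (A \<inter> B)"
      using A B fmeasurable_Int_fmeasurable[OF A, of B]
      by (subst Bochner_Integration.integral_add) (auto simp: fmeasurable_def sets.Int_space_eq2)
    also have "(LINT x|M. exp (- (t * indicator B x)) - 1) = (LINT x|M. (exp (- t) - 1) * indicator B x)"
      by (intro Bochner_Integration.integral_cong) (auto simp: indicator_def)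
    also have "\<dots> = (exp (- t) - 1) * measure M B"
      using B by (simp add: sets.Int_space_eq2)
    finally show "(LINT N|P. measure N A * exp (- t * measure N B)) = - g t" by (simp add: g_def)
  qed
  have s_eq: "s n N = (measure N A * exp (- 0 * measure N B) - measure N A * exp (- (1 / Suc n) * measure N B)) * Suc n" for n N
    by (simp add: s_def algebra_simps)
  have s_int: "integrable P (s n)" for n
    unfolding s_eq[abs_def] by (intro integrable_mult_left Bochner_Integration.integrable_diff Li) auto
  have s_val: "(LINT N|P. s n N) = (g (1 / Suc n) - g 0) * Suc n" for n
  proof -
    have "(LINT N|P. s n N) = ((LINT N|P. measure N A * exp (- 0 * measure N B)) - (LINT N|P. measure N A * exp (- (1 / Suc n) * measure N B))) * Suc n"
      unfolding s_eq[abs_def] integral_mult_left_zero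
      by (subst Bochner_Integration.integral_diff[OF Li Li]) simp_all
    also have "\<dots> = (- g 0 - - g (1 / Suc n)) * Suc n" by (subst (1 2) L) auto
    finally show ?thesis by simp
  qed
  have "(g has_real_derivative measure M (A \<inter> B) + measure M A * measure M B) (at 0)"
    unfolding g_def by (auto intro!: derivative_eq_intros)
  from has_real_derivative_sequence[OF this]
  have lim: "(\<lambda>n. LINT N|P. s n N) \<longlonglongrightarrow> measure M (A \<inter> B) + measure M A * measure M B"
    unfolding s_val .
  have b: "AE N in P. 0 \<le> s n N \<and> s n N \<le> measure N A * measure N B" for n
    unfolding s_def using one_minus_exp_difference_quotient(1,2)[OF measure_nonneg]
    by (intro AE_I2 conjI mult_nonneg_nonneg mult_left_mono) auto
  have conv: "AE N in P. (\<lambda>n. s n N) \<longlonglongrightarrow> measure N A * measure N B"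
    unfolding s_def using one_minus_exp_difference_quotient(3)[OF measure_nonneg]
    by (intro AE_I2 tendsto_mult tendsto_const) auto
  show "integrable P (\<lambda>N. measure N A * measure N B)"
    by (rule integral_of_minorants(1)[OF s_int b conv lim]) measurable
  show "(LINT N|P. measure N A * measure N B) = measure M (A \<inter> B) + measure M A * measure M B"
    by (rule integral_of_minorants(2)[OF s_int b conv lim]) measurable
qed

lemma stat_exp_moment:
  fixes h u :: "'a \<Rightarrow> real"
  assumes h: "step_function M h" and u: "step_function M u" and nonneg: "\<And>x. x \<in> space M \<Longrightarrow> 0 \<le> u x"
  shows "integrable P (\<lambda>N. stat h N * exp (- stat u N))"
    and "(LINT N|P. stat h N * exp (- stat u N)) = (LINT x|M. h x * exp (- u x)) * exp (LINT x|M. exp (- u x) - 1)"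
proof -
  note s = step_function_support[OF h]
  let ?Y = "h ` space M - {0}" and ?B = "\<lambda>y. {x \<in> space M. h x = y}"
  note m = count_exp_moment[OF s(3) u nonneg]
  have eq: "stat h N * exp (- stat u N) = (\<Sum>y\<in>?Y. y * (measure N (?B y) * exp (- stat u N)))" if "N \<in> space P" for N
    using stat_eq[OF that s(1)] by (simp add: sum_distrib_right sum_distrib_left mult_ac)
  have int: "integrable P (\<lambda>N. y * (measure N (?B y) * exp (- stat u N)))" if "y \<in> ?Y" for y
    using that m(1) by (intro integrable_mult_right) auto
  have "integrable P (\<lambda>N. \<Sum>y\<in>?Y. y * (measure N (?B y) * exp (- stat u N)))"
    using int by (rule Bochner_Integration.integrable_sum)
  then show "integrable P (\<lambda>N. stat h N * exp (- stat u N))"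
    by (subst Bochner_Integration.integrable_cong[OF refl eq]) auto
  have "(LINT N|P. stat h N * exp (- stat u N)) = (LINT N|P. (\<Sum>y\<in>?Y. y * (measure N (?B y) * exp (- stat u N))))"
    using eq by (intro Bochner_Integration.integral_cong) auto
  also have "\<dots> = (\<Sum>y\<in>?Y. LINT N|P. y * (measure N (?B y) * exp (- stat u N)))"
    using int by (rule Bochner_Integration.integral_sum)
  also have "\<dots> = (\<Sum>y\<in>?Y. y * ((LINT x|M. indicator (?B y) x * exp (- u x)) * exp (LINT x|M. exp (- u x) - 1)))"
    using m(2) by (intro sum.cong) auto
  also have "\<dots> = (LINT x|M. h x * exp (- u x)) * exp (LINT x|M. exp (- u x) - 1)"
    by (subst step_function_partition(2)[OF h]) (auto simp: sum_distrib_right mult.assoc intro: integrable_indicator_mult_exp[OF u])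
  finally show "(LINT N|P. stat h N * exp (- stat u N)) = (LINT x|M. h x * exp (- u x)) * exp (LINT x|M. exp (- u x) - 1)" .
qed

lemma stat_moment:
  fixes h :: "'a \<Rightarrow> real"
  assumes h: "step_function M h"
  shows "integrable P (stat h)" "(LINT N|P. stat h N) = (LINT x|M. h x)"
proof -
  have z: "step_function M (\<lambda>x. 0::real)" by (intro step_functionI[of _ _ "{}"]) auto
  then show "integrable P (stat h)" "(LINT N|P. stat h N) = (LINT x|M. h x)"
    using stat_exp_moment[OF h z] by simp_all
qed

lemma stat_product_moment:
  fixes h h' :: "'a \<Rightarrow> real"
  assumes h: "step_function M h" and h': "step_function M h'"
  shows "integrable P (\<lambda>N. stat h N * stat h' N)"
    and "(LINT N|P. stat h N * stat h' N) = (LINT x|M. h x * h' x) + (LINT x|M. h x) * (LINT x|M. h' x)"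
proof -
  note s = step_function_support[OF h] and s' = step_function_support[OF h']
  let ?Y = "h ` space M - {0}" and ?B = "\<lambda>y. {x \<in> space M. h x = y}"
  let ?Y' = "h' ` space M - {0}" and ?B' = "\<lambda>y. {x \<in> space M. h' x = y}"
  note m = count_product_moment[OF s(3) s'(3)]
  have eq: "stat h N * stat h' N = (\<Sum>y\<in>?Y. \<Sum>y'\<in>?Y'. y * y' * (measure N (?B y) * measure N (?B' y')))" if "N \<in> space P" for N
    using stat_eq[OF that s(1)] stat_eq[OF that s'(1)] by (simp add: sum_product mult_ac)
  have int: "integrable P (\<lambda>N. y * y' * (measure N (?B y) * measure N (?B' y')))" if "y \<in> ?Y" "y' \<in> ?Y'" for y y'
    using that m(1) by (intro integrable_mult_right) auto
  have "integrable P (\<lambda>N. \<Sum>y\<in>?Y. \<Sum>y'\<in>?Y'. y * y' * (measure N (?B y) * measure N (?B' y')))"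
    using int by (intro Bochner_Integration.integrable_sum)
  then show "integrable P (\<lambda>N. stat h N * stat h' N)"
    by (subst Bochner_Integration.integrable_cong[OF refl eq]) auto
  have ind: "integrable M (\<lambda>x. indicator A x * (1::real))" if "A \<in> fmeasurable M" for A
    using that by (simp add: fmeasurable_def sets.Int_space_eq2)
  have h'i: "integrable M (\<lambda>x. indicator A x * h' x)" if "A \<in> fmeasurable M" for A
    using step_function_integral(1)[OF step_function_mult[OF step_function_indicator_real[OF that] h']] .
  have ih: "(LINT x|M. h x) = (\<Sum>y\<in>?Y. y * measure M (?B y))"
    using step_function_partition(2)[OF h ind] by (simp add: Int_absorb2 subset_eq)
  have ih': "(LINT x|M. h' x) = (\<Sum>y\<in>?Y'. y * measure M (?B' y))"
    using step_function_partition(2)[OF h' ind] by (simp add: Int_absorb2 subset_eq)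
  have ihh': "(LINT x|M. h x * h' x) = (\<Sum>y\<in>?Y. y * (\<Sum>y'\<in>?Y'. y' * measure M (?B y \<inter> ?B' y')))"
  proof (subst step_function_partition(2)[OF h], erule h'i, intro sum.cong refl arg_cong2[where f = "(*)"])
    fix y assume "y \<in> ?Y"
    then have B: "?B y \<in> fmeasurable M" using s(3) by auto
    have "(LINT x|M. indicator (?B y) x * h' x) = (LINT x|M. h' x * indicator (?B y) x)" by (simp add: mult.commute)
    also have "\<dots> = (\<Sum>y'\<in>?Y'. y' * (LINT x|M. indicator (?B' y') x * indicator (?B y) x))"
    proof (rule step_function_partition(2)[OF h'])
      show "integrable M (\<lambda>x. indicator A x * indicator (?B y) x :: real)" if "A \<in> fmeasurable M" for A
        using step_function_integral(1)[OF step_function_mult[OF step_function_indicator_real[OF that] step_function_indicator_real[OF B]]] .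
    qed
    also have "\<dots> = (\<Sum>y'\<in>?Y'. y' * measure M (?B y \<inter> ?B' y'))"
      by (intro sum.cong refl arg_cong2[where f = "(*)"])
         (auto simp: indicator_inter_arith[symmetric] intro!: arg_cong2[where f = measure])
    finally show "(LINT x|M. indicator (?B y) x * h' x) = (\<Sum>y'\<in>?Y'. y' * measure M (?B y \<inter> ?B' y'))" .
  qed
  have "(LINT N|P. stat h N * stat h' N) = (LINT N|P. (\<Sum>y\<in>?Y. \<Sum>y'\<in>?Y'. y * y' * (measure N (?B y) * measure N (?B' y'))))"
    using eq by (intro Bochner_Integration.integral_cong) auto
  also have "\<dots> = (\<Sum>y\<in>?Y. LINT N|P. (\<Sum>y'\<in>?Y'. y * y' * (measure N (?B y) * measure N (?B' y'))))"
    by (rule Bochner_Integration.integral_sum) (intro Bochner_Integration.integrable_sum int)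
  also have "\<dots> = (\<Sum>y\<in>?Y. \<Sum>y'\<in>?Y'. LINT N|P. y * y' * (measure N (?B y) * measure N (?B' y')))"
    by (intro sum.cong refl Bochner_Integration.integral_sum int)
  also have "\<dots> = (\<Sum>y\<in>?Y. \<Sum>y'\<in>?Y'. y * y' * (measure M (?B y \<inter> ?B' y') + measure M (?B y) * measure M (?B' y')))"
    using m(2) by (intro sum.cong refl) auto
  also have "\<dots> = (LINT x|M. h x * h' x) + (LINT x|M. h x) * (LINT x|M. h' x)"
    unfolding ih ih' ihh' sum_product by (simp add: sum_distrib_left sum.distrib[symmetric] algebra_simps)
  finally show "(LINT N|P. stat h N * stat h' N) = (LINT x|M. h x * h' x) + (LINT x|M. h x) * (LINT x|M. h' x)" .
qed

lemma stat_poisson_suspension: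
  fixes f :: "'a \<Rightarrow> real"
  assumes T: "preserves M T" and f: "step_function M f" and N: "N \<in> space P"
  shows "stat f (poisson_suspension M T N) = stat (\<lambda>x. f (T x)) N"
proof -
  have Tm: "T \<in> N \<rightarrow>\<^sub>M M" using preserves_measurable[OF T] configuration_sets[OF N] by (simp cong: measurable_cong_sets)
  have eq: "measure (distr N M T) {x \<in> space M. f x = y} = measure N {x \<in> space M. f (T x) = y}" if "y \<noteq> 0" for y
  proof -
    have "measure (distr N M T) {x \<in> space M. f x = y} = measure N (T -` {x \<in> space M. f x = y} \<inter> space N)"
      using Tm step_function_support(3)[OF f that] by (intro measure_distr) auto
    also have "T -` {x \<in> space M. f x = y} \<inter> space N = {x \<in> space M. f (T x) = y}"
      using configuration_sets[OF N] measurable_space[OF preserves_measurable[OF T]] by auto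
    finally show ?thesis .
  qed
  have "stat f (poisson_suspension M T N) = (\<Sum>y\<in>f ` space M. measure (distr N M T) {x \<in> space M. f x = y} *\<^sub>R y)"
    by (simp add: poisson_suspension_def Bochner_Integration.simple_bochner_integral_def)
  also have "\<dots> = (\<Sum>y\<in>f ` space M. measure N {x \<in> space M. f (T x) = y} *\<^sub>R y)"
    using eq by (intro sum.cong refl) (metis scaleR_zero_right)
  also have "\<dots> = (\<Sum>y\<in>(\<lambda>x. f (T x)) ` space M. measure N {x \<in> space M. f (T x) = y} *\<^sub>R y)"
  proof (rule sum.mono_neutral_right)
    show "\<forall>y\<in>f ` space M - (\<lambda>x. f (T x)) ` space M. measure N {x \<in> space M. f (T x) = y} *\<^sub>R y = 0"
    proof
      fix y assume "y \<in> f ` space M - (\<lambda>x. f (T x)) ` space M"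
      then have "{x \<in> space M. f (T x) = y} = {}" unfolding image_def by blast
      then show "measure N {x \<in> space M. f (T x) = y} *\<^sub>R y = 0" by (simp only: measure_empty scaleR_zero_left)
    qed
  qed (use step_function_support(4)[OF f] measurable_space[OF preserves_measurable[OF T]] in auto)
  also have "\<dots> = stat (\<lambda>x. f (T x)) N"
    by (simp add: Bochner_Integration.simple_bochner_integral_def configuration_sets[OF N])
  finally show ?thesis .
qed

end

section \<open>Density of an algebra of bounded functions\<close>

text \<open>An algebra of bounded functions that generates the sigma-algebra is dense in \<open>L\<^sub>2\<close>, because the
  functions that it approximates form a closed subspace. It contains the
  indicators of finite intersections of sublevel sets by the Weierstrass theorem, hence all indicators
  by Dynkin's argument, hence everything by approximation with simple functions.\<close>

locale generating_algebra = prob_space P for P :: "'b measure" +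
  fixes \<E> :: "('b \<Rightarrow> real) set"
  assumes const: "(\<lambda>_. c) \<in> \<E>"
    and add: "f \<in> \<E> \<Longrightarrow> g \<in> \<E> \<Longrightarrow> (\<lambda>x. f x + g x) \<in> \<E>"
    and mult: "f \<in> \<E> \<Longrightarrow> g \<in> \<E> \<Longrightarrow> (\<lambda>x. f x * g x) \<in> \<E>"
    and meas [measurable_dest]: "f \<in> \<E> \<Longrightarrow> f \<in> borel_measurable P"
    and bounded: "f \<in> \<E> \<Longrightarrow> \<exists>B. \<forall>x\<in>space P. \<bar>f x\<bar> \<le> B"
    and generates: "sets P \<subseteq> sigma_sets (space P) {{x \<in> space P. f x < c} | f c. f \<in> \<E>}"
begin

lemma integrable_bounded:
  fixes f :: "'b \<Rightarrow> real"
  assumes "f \<in> borel_measurable P" "\<And>x. x \<in> space P \<Longrightarrow> \<bar>f x\<bar> \<le> B"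
  shows "integrable P f"
  by (rule integrable_const_bound[of _ B]) (use assms in \<open>auto intro!: AE_I2\<close>)

lemma algebra_square_integrable:
  assumes "f \<in> \<E>"
  shows "integrable P (\<lambda>x. (f x)\<^sup>2)"
proof -
  obtain B where "\<And>x. x \<in> space P \<Longrightarrow> \<bar>f x\<bar> \<le> B" using bounded[OF assms] by blast
  then have "\<bar>(f x)\<^sup>2\<bar> \<le> B\<^sup>2" if "x \<in> space P" for x
    using power_mono[of "\<bar>f x\<bar>" B 2] that by simp
  then show ?thesis
    using meas[OF assms] by (intro integrable_bounded[of _ "B\<^sup>2"]) auto
qed

definition approximable :: "('b \<Rightarrow> real) \<Rightarrow> bool" where
  "approximable g \<longleftrightarrow> g \<in> borel_measurable P \<and> integrable P (\<lambda>x. (g x)\<^sup>2) \<and>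
     (\<forall>e>0. \<exists>f\<in>\<E>. (LINT x|P. (g x - f x)\<^sup>2) < e)"

lemma integrable_square_diff:
  fixes f g :: "'b \<Rightarrow> real"
  assumes "f \<in> borel_measurable P" "g \<in> borel_measurable P" "integrable P (\<lambda>x. (f x)\<^sup>2)" "integrable P (\<lambda>x. (g x)\<^sup>2)"
  shows "integrable P (\<lambda>x. (f x - g x)\<^sup>2)"
  using assms integrable_mult_L2[of f P g] by (simp add: power2_diff mult.assoc)

lemma square_distance_triangle:
  fixes f g h :: "'b \<Rightarrow> real"
  assumes "f \<in> borel_measurable P" "g \<in> borel_measurable P" "h \<in> borel_measurable P"
    "integrable P (\<lambda>x. (f x)\<^sup>2)" "integrable P (\<lambda>x. (g x)\<^sup>2)" "integrable P (\<lambda>x. (h x)\<^sup>2)"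
  shows "(LINT x|P. (f x - h x)\<^sup>2) \<le> 2 * (LINT x|P. (f x - g x)\<^sup>2) + 2 * (LINT x|P. (g x - h x)\<^sup>2)"
proof -
  have "(f x - h x)\<^sup>2 \<le> 2 * (f x - g x)\<^sup>2 + 2 * (g x - h x)\<^sup>2" for x
    using sum_squares_bound[of "f x - g x" "g x - h x"] power2_sum[of "f x - g x" "g x - h x"] by simp
  then have "(LINT x|P. (f x - h x)\<^sup>2) \<le> (LINT x|P. 2 * (f x - g x)\<^sup>2 + 2 * (g x - h x)\<^sup>2)"
    using assms by (intro integral_mono) (auto intro!: integrable_square_diff)
  also have "\<dots> = 2 * (LINT x|P. (f x - g x)\<^sup>2) + 2 * (LINT x|P. (g x - h x)\<^sup>2)"
    using assms by (subst Bochner_Integration.integral_add) (auto intro!: integrable_square_diff)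
  finally show ?thesis .
qed

lemma approximable_limit:
  assumes g: "g \<in> borel_measurable P" "integrable P (\<lambda>x. (g x)\<^sup>2)" and G: "\<And>n. approximable (G n)"
    and lim: "(\<lambda>n. LINT x|P. (g x - G n x)\<^sup>2) \<longlonglongrightarrow> 0"
  shows "approximable g"
  unfolding approximable_def
proof (intro conjI g allI impI)
  fix e :: real assume e: "e > 0"
  have "eventually (\<lambda>n. (LINT x|P. (g x - G n x)\<^sup>2) < e / 4) sequentially"
    using lim e by (intro order_tendstoD(2)) auto
  then obtain n where n: "(LINT x|P. (g x - G n x)\<^sup>2) < e / 4" by (auto simp: eventually_sequentially)
  obtain f where f: "f \<in> \<E>" "(LINT x|P. (G n x - f x)\<^sup>2) < e / 4"
    using G[of n] e by (auto simp: approximable_def elim!: allE[of _ "e / 4"])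
  have "(LINT x|P. (g x - f x)\<^sup>2) \<le> 2 * (LINT x|P. (g x - G n x)\<^sup>2) + 2 * (LINT x|P. (G n x - f x)\<^sup>2)"
    using g G[of n] meas[OF f(1)] algebra_square_integrable[OF f(1)] by (intro square_distance_triangle) (auto simp: approximable_def)
  then show "\<exists>f\<in>\<E>. (LINT x|P. (g x - f x)\<^sup>2) < e" using n f by (intro bexI[of _ f]) auto
qed

lemma approximable_bounded_limit:
  assumes g: "g \<in> borel_measurable P" and G: "\<And>n. approximable (G n)"
    and lim: "\<And>x. x \<in> space P \<Longrightarrow> (\<lambda>n. G n x) \<longlonglongrightarrow> g x"
    and dom: "\<And>n x. x \<in> space P \<Longrightarrow> \<bar>G n x\<bar> \<le> w x" "integrable P (\<lambda>x. (w x)\<^sup>2)"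
  shows "approximable g"
proof -
  have Gm: "G n \<in> borel_measurable P" for n using G[of n] by (simp add: approximable_def)
  have gw: "\<bar>g x\<bar> \<le> w x" if "x \<in> space P" for x
    by (rule LIMSEQ_le_const2[OF tendsto_rabs[OF lim[OF that]]]) (use dom(1)[OF that] in auto)
  have sq: "(g x - G n x)\<^sup>2 \<le> 4 * (w x)\<^sup>2" if "x \<in> space P" for x n
  proof -
    have "\<bar>g x - G n x\<bar> \<le> 2 * w x" using gw[OF that] dom(1)[OF that, of n] by linarith
    then have "\<bar>g x - G n x\<bar>\<^sup>2 \<le> (2 * w x)\<^sup>2" by (intro power_mono) auto
    then show ?thesis by (simp add: power_mult_distrib)
  qed
  have g2: "integrable P (\<lambda>x. (g x)\<^sup>2)"
  proof (rule Bochner_Integration.integrable_bound[OF dom(2)])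
    show "AE x in P. norm ((g x)\<^sup>2) \<le> norm ((w x)\<^sup>2)"
      using gw by (intro AE_I2) (simp add: abs_le_square_iff[symmetric], smt (verit))
  qed (use g in measurable)
  have "(\<lambda>n. LINT x|P. (g x - G n x)\<^sup>2) \<longlonglongrightarrow> (LINT x|P. 0)"
  proof (rule integral_dominated_convergence[where w = "\<lambda>x. 4 * (w x)\<^sup>2"])
    show "AE x in P. (\<lambda>n. (g x - G n x)\<^sup>2) \<longlonglongrightarrow> 0"
    proof (rule AE_I2)
      fix x assume "x \<in> space P"
      then have "(\<lambda>n. (g x - G n x)\<^sup>2) \<longlonglongrightarrow> (g x - g x)\<^sup>2" by (intro tendsto_intros lim)
      then show "(\<lambda>n. (g x - G n x)\<^sup>2) \<longlonglongrightarrow> 0" by simp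
    qed
  qed (use g Gm dom(2) sq in \<open>auto intro!: AE_I2\<close>)
  then show ?thesis by (intro approximable_limit[OF g g2 G]) simp
qed

lemma approximable_algebra: "f \<in> \<E> \<Longrightarrow> approximable f"
  unfolding approximable_def using algebra_square_integrable meas by (auto intro!: bexI[of _ f])

lemma approximable_add:
  assumes "approximable f" "approximable g"
  shows "approximable (\<lambda>x. f x + g x)"
  unfolding approximable_def
proof (intro conjI allI impI)
  have m: "f \<in> borel_measurable P" "g \<in> borel_measurable P" "integrable P (\<lambda>x. (f x)\<^sup>2)" "integrable P (\<lambda>x. (g x)\<^sup>2)"
    using assms by (auto simp: approximable_def)
  then show "(\<lambda>x. f x + g x) \<in> borel_measurable P" by simp
  show "integrable P (\<lambda>x. (f x + g x)\<^sup>2)"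
    using integrable_square_diff[of f "\<lambda>x. - g x"] m by simp
  fix e :: real assume e: "e > 0"
  obtain f' g' where f': "f' \<in> \<E>" "(LINT x|P. (f x - f' x)\<^sup>2) < e / 4" and g': "g' \<in> \<E>" "(LINT x|P. (g x - g' x)\<^sup>2) < e / 4"
    using assms e unfolding approximable_def by (meson divide_pos_pos zero_less_numeral)
  note m' = meas[OF f'(1)] meas[OF g'(1)] algebra_square_integrable[OF f'(1)] algebra_square_integrable[OF g'(1)]
  have i: "integrable P (\<lambda>x. (f x - f' x)\<^sup>2)" "integrable P (\<lambda>x. (g x - g' x)\<^sup>2)"
    using m m' by (auto intro: integrable_square_diff)
  have le: "(f x + g x - (f' x + g' x))\<^sup>2 \<le> 2 * (f x - f' x)\<^sup>2 + 2 * (g x - g' x)\<^sup>2" for x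
    using sum_squares_bound[of "f x - f' x" "g x - g' x"] power2_sum[of "f x - f' x" "g x - g' x"]
    by (simp add: algebra_simps)
  have "(LINT x|P. (f x + g x - (f' x + g' x))\<^sup>2) \<le> (LINT x|P. 2 * (f x - f' x)\<^sup>2 + 2 * (g x - g' x)\<^sup>2)"
  proof (rule integral_mono)
    show "integrable P (\<lambda>x. (f x + g x - (f' x + g' x))\<^sup>2)"
      by (rule Bochner_Integration.integrable_bound[where f = "\<lambda>x. 2 * (f x - f' x)\<^sup>2 + 2 * (g x - g' x)\<^sup>2"])
         (use i m m' le in \<open>auto intro!: AE_I2\<close>)
  qed (use i le in auto)
  also have "\<dots> = 2 * (LINT x|P. (f x - f' x)\<^sup>2) + 2 * (LINT x|P. (g x - g' x)\<^sup>2)"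
    using i by (subst Bochner_Integration.integral_add) auto
  also have "\<dots> < e" using f' g' by simp
  finally show "\<exists>h\<in>\<E>. (LINT x|P. (f x + g x - h x)\<^sup>2) < e"
    using add[OF f'(1) g'(1)] by (intro bexI[of _ "\<lambda>x. f' x + g' x"]) auto
qed

lemma approximable_cmult:
  assumes "approximable f"
  shows "approximable (\<lambda>x. c * f x)"
proof (cases "c = 0")
  case True
  then show ?thesis using approximable_algebra[OF const[of 0]] by simp
next
  case False
  have m: "f \<in> borel_measurable P" "integrable P (\<lambda>x. (f x)\<^sup>2)" using assms by (auto simp: approximable_def)
  show ?thesis
    unfolding approximable_def
  proof (intro conjI allI impI)
    show "(\<lambda>x. c * f x) \<in> borel_measurable P" "integrable P (\<lambda>x. (c * f x)\<^sup>2)"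
      using m by (auto simp: power_mult_distrib)
    fix e :: real assume e: "e > 0"
    then obtain f' where f': "f' \<in> \<E>" "(LINT x|P. (f x - f' x)\<^sup>2) < e / c\<^sup>2"
      using assms False unfolding approximable_def by (meson divide_pos_pos zero_less_power2)
    have "(c * f x - c * f' x)\<^sup>2 = c\<^sup>2 * (f x - f' x)\<^sup>2" for x
      by (simp add: power_mult_distrib[symmetric] right_diff_distrib)
    then have "(LINT x|P. (c * f x - c * f' x)\<^sup>2) < e"
      using f'(2) False by (simp add: field_simps)
    then show "\<exists>h\<in>\<E>. (LINT x|P. (c * f x - h x)\<^sup>2) < e"
      using mult[OF const[of c] f'(1)] by (intro bexI[of _ "\<lambda>x. c * f' x"]) auto
  qed
qed

definition uniform_limit_of_algebra :: "('b \<Rightarrow> real) \<Rightarrow> bool" where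
  "uniform_limit_of_algebra g \<longleftrightarrow> (\<forall>e>0. \<exists>f\<in>\<E>. \<forall>x\<in>space P. \<bar>g x - f x\<bar> < e)"

lemma uniform_limit_continuous:
  assumes f: "f \<in> \<E>" and \<psi>: "continuous_on UNIV \<psi>"
  shows "uniform_limit_of_algebra (\<lambda>x. \<psi> (f x))"
  unfolding uniform_limit_of_algebra_def
proof (intro allI impI)
  fix e :: real assume e: "e > 0"
  obtain B where B: "\<And>x. x \<in> space P \<Longrightarrow> \<bar>f x\<bar> \<le> B" using bounded[OF f] by blast
  obtain p where p: "real_polynomial_function p" "\<And>y. y \<in> {-B..B} \<Longrightarrow> \<bar>\<psi> y - p y\<bar> < e"
    using Stone_Weierstrass_real_polynomial_function[of "{-B..B}" \<psi> e] \<psi> e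
    by (auto intro: continuous_on_subset)
  from p(1) have "(\<lambda>x. p (f x)) \<in> \<E>"
  proof (induction rule: real_polynomial_function.induct)
    case (linear h)
    have "h y = h 1 * y" for y using linear_simps(5)[OF linear, of y 1] by simp
    then have "(\<lambda>x. h (f x)) = (\<lambda>x. h 1 * f x)" by (intro ext)
    then show ?case using mult[OF const[of "h 1"] f] by (simp only:)
  qed (auto intro: const add mult)
  then show "\<exists>g\<in>\<E>. \<forall>x\<in>space P. \<bar>\<psi> (f x) - g x\<bar> < e"
  proof (rule bexI[rotated], intro ballI)
    fix x assume "x \<in> space P"
    then show "\<bar>\<psi> (f x) - p (f x)\<bar> < e" using B[of x] p(2)[of "f x"] by (auto simp: abs_le_iff)
  qed
qed

lemma uniform_limit_mult:
  assumes "uniform_limit_of_algebra g" "uniform_limit_of_algebra h"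
    and bound: "\<And>x. x \<in> space P \<Longrightarrow> \<bar>g x\<bar> \<le> 1" "\<And>x. x \<in> space P \<Longrightarrow> \<bar>h x\<bar> \<le> 1"
  shows "uniform_limit_of_algebra (\<lambda>x. g x * h x)"
  unfolding uniform_limit_of_algebra_def
proof (intro allI impI)
  fix e :: real assume e: "e > 0"
  define d where "d = min 1 (e / 4)"
  have d: "d > 0" "d \<le> 1" "d \<le> e / 4" using e by (auto simp: d_def)
  obtain g' h' where g': "g' \<in> \<E>" "\<And>x. x \<in> space P \<Longrightarrow> \<bar>g x - g' x\<bar> < d" and h': "h' \<in> \<E>" "\<And>x. x \<in> space P \<Longrightarrow> \<bar>h x - h' x\<bar> < d"
    using assms(1,2) d(1) unfolding uniform_limit_of_algebra_def by meson
  have "\<bar>g x * h x - g' x * h' x\<bar> < e" if x: "x \<in> space P" for x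
  proof -
    have "g x * h x - g' x * h' x = g x * (h x - h' x) + (g x - g' x) * h' x" by (simp add: algebra_simps)
    also have "\<bar>\<dots>\<bar> \<le> \<bar>g x\<bar> * \<bar>h x - h' x\<bar> + \<bar>g x - g' x\<bar> * \<bar>h' x\<bar>"
      by (metis abs_mult abs_triangle_ineq)
    also have "\<dots> \<le> 1 * d + d * 2"
    proof (intro add_mono mult_mono)
      show "\<bar>h' x\<bar> \<le> 2" using h'(2)[OF x] bound(2)[OF x] d by linarith
    qed (use g'(2)[OF x] h'(2)[OF x] bound(1)[OF x] d in auto)
    finally show ?thesis using d e by linarith
  qed
  then show "\<exists>f\<in>\<E>. \<forall>x\<in>space P. \<bar>g x * h x - f x\<bar> < e"
    using mult[OF g'(1) h'(1)] by (intro bexI[of _ "\<lambda>x. g' x * h' x"]) auto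
qed

lemma uniform_limit_approximable:
  assumes g: "uniform_limit_of_algebra g" "g \<in> borel_measurable P" "\<And>x. x \<in> space P \<Longrightarrow> \<bar>g x\<bar> \<le> 1"
  shows "approximable g"
proof -
  have "\<exists>f\<in>\<E>. \<forall>x\<in>space P. \<bar>g x - f x\<bar> < 1 / Suc n" for n
    using g(1) unfolding uniform_limit_of_algebra_def by (meson divide_pos_pos of_nat_0_less_iff zero_less_Suc zero_less_one)
  then obtain f where f: "\<And>n. f n \<in> \<E>" "\<And>n x. x \<in> space P \<Longrightarrow> \<bar>g x - f n x\<bar> < 1 / Suc n" by metis
  show ?thesis
  proof (rule approximable_bounded_limit[where G = f and w = "\<lambda>_. 2"])
    show "(\<lambda>n. f n x) \<longlonglongrightarrow> g x" if "x \<in> space P" for x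
    proof (rule Lim_transform2)
      show "(\<lambda>n. g x) \<longlonglongrightarrow> g x" by simp
      show "(\<lambda>n. g x - f n x) \<longlonglongrightarrow> 0"
        by (rule tendsto_rabs_zero_cancel, rule tendsto_sandwich[of "\<lambda>_. 0" _ _ "\<lambda>n. 1 / Suc n"])
           (use f(2)[OF that] LIMSEQ_inverse_real_of_nat in \<open>auto simp: inverse_eq_divide less_imp_le intro!: always_eventually\<close>)
    qed
    show "\<bar>f n x\<bar> \<le> 2" if x: "x \<in> space P" for n x
    proof -
      have "1 / real (Suc n) \<le> 1" by simp
      then show ?thesis using f(2)[OF x, of n] g(3)[OF x] by linarith
    qed
  qed (use f(1) g(2) in \<open>auto intro: approximable_algebra\<close>)
qed

text \<open>A generating family that is stable under intersection.\<close>

definition cells :: "'b set set" where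
  "cells = {{x \<in> space P. \<forall>i\<in>I. f i x < c i} | I f c. finite (I :: nat set) \<and> (\<forall>i\<in>I. f i \<in> \<E>)}"

text \<open>The indicator is the pointwise limit of products of clamped multiples of \<open>c\<^sub>i - f\<^sub>i\<close>. Each factor is a
  continuous function of \<open>f\<^sub>i\<close>, hence a uniform limit of polynomials in \<open>f\<^sub>i\<close>.\<close>

lemma approximable_cell:
  fixes I :: "'i set"
  assumes I: "finite I" "\<And>i. i \<in> I \<Longrightarrow> f i \<in> \<E>"
  shows "approximable (indicator {x \<in> space P. \<forall>i\<in>I. f i x < c i})"
proof -
  define \<phi> :: "nat \<Rightarrow> real \<Rightarrow> real" where "\<phi> n t = max 0 (min 1 (real n * t))" for n t
  have \<phi>: "0 \<le> \<phi> n t" "\<phi> n t \<le> 1" for n t by (auto simp: \<phi>_def)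
  have \<phi>_le: "\<phi> n t = 0" if "t \<le> 0" for n t
    using mult_nonneg_nonpos[of "real n" t] that by (simp add: \<phi>_def)
  have \<phi>_ev: "eventually (\<lambda>n. \<phi> n t = 1) sequentially" if "t > 0" for t
  proof -
    have "eventually (\<lambda>n. real n \<ge> 1 / t) sequentially"
      by (rule eventually_ge_at_top[THEN filterlim_real_sequentially[THEN filterlim_iff[THEN iffD1], rule_format]])
    then show ?thesis by eventually_elim (use that in \<open>auto simp: \<phi>_def field_simps\<close>)
  qed
  have prod: "uniform_limit_of_algebra (\<lambda>x. \<Prod>i\<in>J. \<phi> n (c i - f i x))"
    "\<And>x. (\<Prod>i\<in>J. \<phi> n (c i - f i x)) \<in> {0..1}" if "finite J" "\<And>i. i \<in> J \<Longrightarrow> f i \<in> \<E>" for J :: "'i set" and n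
  proof -
    show *: "(\<Prod>i\<in>J. \<phi> n (c i - f i x)) \<in> {0..1}" for x and J :: "'i set"
      using \<phi> by (auto intro!: prod_nonneg prod_le_1)
    show "uniform_limit_of_algebra (\<lambda>x. \<Prod>i\<in>J. \<phi> n (c i - f i x))" using that
    proof (induction J rule: finite_induct)
      case empty
      show ?case unfolding uniform_limit_of_algebra_def by (auto intro!: bexI[OF _ const[of 1]])
    next
      case (insert i J)
      have "uniform_limit_of_algebra (\<lambda>x. \<phi> n (c i - f i x))"
        by (rule uniform_limit_continuous[where \<psi> = "\<lambda>y. \<phi> n (c i - y)"])
           (use insert in \<open>auto simp: \<phi>_def intro!: continuous_intros\<close>)
      then have "uniform_limit_of_algebra (\<lambda>x. \<phi> n (c i - f i x) * (\<Prod>i\<in>J. \<phi> n (c i - f i x)))"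
        using insert \<phi> *[of _ J] by (intro uniform_limit_mult) (auto simp: abs_le_iff)
      then show ?case using insert by simp
    qed
  qed
  have m: "f i \<in> borel_measurable P" if "i \<in> I" for i using meas I(2)[OF that] .
  show ?thesis
  proof (rule approximable_bounded_limit[where G = "\<lambda>n x. \<Prod>i\<in>I. \<phi> n (c i - f i x)" and w = "\<lambda>_. 1"])
    show "approximable (\<lambda>x. \<Prod>i\<in>I. \<phi> n (c i - f i x))" for n
    proof (rule uniform_limit_approximable)
      show "(\<lambda>x. \<Prod>i\<in>I. \<phi> n (c i - f i x)) \<in> borel_measurable P"
        unfolding \<phi>_def using m by measurable
      show "uniform_limit_of_algebra (\<lambda>x. \<Prod>i\<in>I. \<phi> n (c i - f i x))" by (rule prod(1)[OF I])
      show "\<bar>\<Prod>i\<in>I. \<phi> n (c i - f i x)\<bar> \<le> 1" for x using prod(2)[OF I, of n x] by simp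
    qed
    show "indicator {x \<in> space P. \<forall>i\<in>I. f i x < c i} \<in> borel_measurable P"
      using I m by measurable
    show "(\<lambda>n. \<Prod>i\<in>I. \<phi> n (c i - f i x)) \<longlonglongrightarrow> indicator {x \<in> space P. \<forall>i\<in>I. f i x < c i} x" if x: "x \<in> space P" for x
    proof (cases "\<forall>i\<in>I. f i x < c i")
      case True
      then have "eventually (\<lambda>n. \<forall>i\<in>I. \<phi> n (c i - f i x) = 1) sequentially"
        using I(1) \<phi>_ev by (intro eventually_ball_finite) auto
      then have "eventually (\<lambda>n. (\<Prod>i\<in>I. \<phi> n (c i - f i x)) = 1) sequentially"
        by eventually_elim simp
      then show ?thesis using True x by (auto intro: tendsto_eventually)
    next
      case False
      then obtain i where i: "i \<in> I" "c i - f i x \<le> 0" by force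
      have "(\<Prod>i\<in>I. \<phi> n (c i - f i x)) = 0" for n
        using \<phi>_le[OF i(2), of n] i(1) by (intro prod_zero[OF I(1)]) blast
      then show ?thesis using False by simp
    qed
    show "\<bar>\<Prod>i\<in>I. \<phi> n (c i - f i x)\<bar> \<le> 1" for n x using prod(2)[OF I, of n x] by auto
  qed auto
qed

lemma approximable_indicator:
  assumes "A \<in> sets P"
  shows "approximable (indicator A)"
proof -
  have cells_sets: "cells \<subseteq> sets P"
  proof
    fix A assume "A \<in> cells"
    then obtain I :: "nat set" and f c where A: "finite I" "\<And>i. i \<in> I \<Longrightarrow> f i \<in> \<E>" "A = {x \<in> space P. \<forall>i\<in>I. f i x < c i}"
      unfolding cells_def by blast
    then have "f i \<in> borel_measurable P" if "i \<in> I" for i using meas that by blast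
    then show "A \<in> sets P" using A(1) unfolding A(3) by measurable
  qed
  have "{x \<in> space P. f x < c} \<in> cells" if "f \<in> \<E>" for f c
    unfolding cells_def using that by (auto intro!: exI[of _ "{0::nat}"] exI[of _ "\<lambda>_. f"] exI[of _ "\<lambda>_. c"])
  then have "sets P \<subseteq> sigma_sets (space P) cells"
    using generates sigma_sets_mono[of "{{x \<in> space P. f x < c} | f c. f \<in> \<E>}" "space P" cells] by (auto intro: sigma_sets.Basic)
  then have A: "A \<in> sigma_sets (space P) cells" using assms by blast
  have stable: "Int_stable cells"
  proof (rule Int_stableI)
    fix A B assume "A \<in> cells" "B \<in> cells"
    then obtain I J :: "nat set" and f g c d where
      A: "finite I" "\<forall>i\<in>I. f i \<in> \<E>" "A = {x \<in> space P. \<forall>i\<in>I. f i x < c i}" and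
      B: "finite J" "\<forall>i\<in>J. g i \<in> \<E>" "B = {x \<in> space P. \<forall>i\<in>J. g i x < d i}"
      unfolding cells_def by blast
    \<comment> \<open>even and odd indices keep the two index sets apart\<close>
    define K where "K = (\<lambda>i. 2 * i) ` I \<union> (\<lambda>i. 2 * i + 1) ` J"
    define h where "h k = (if even k then f (k div 2) else g (k div 2))" for k
    define e where "e k = (if even k then c (k div 2) else d (k div 2))" for k
    have "A \<inter> B = {x \<in> space P. \<forall>k\<in>K. h k x < e k}" unfolding A B K_def h_def e_def by (auto simp: ball_Un)
    moreover have "finite K" "\<forall>k\<in>K. h k \<in> \<E>" using A B by (auto simp: K_def h_def)
    ultimately show "A \<inter> B \<in> cells" unfolding cells_def by blast
  qed
  have sig: "sigma_sets (space P) cells \<subseteq> sets P" using cells_sets by (rule sets.sigma_sets_subset)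
  show ?thesis
  proof (rule sigma_sets_induct_disjoint[OF stable _ A])
    show "cells \<subseteq> Pow (space P)" using cells_sets sets.sets_into_space by blast
    show "approximable (indicator A)" if "A \<in> cells" for A
      using that approximable_cell unfolding cells_def by force
    show "approximable (indicator {})" using approximable_algebra[OF const[of 0]] by (simp add: indicator_def[abs_def])
    show "approximable (indicator (space P - A))" if "A \<in> sigma_sets (space P) cells" "approximable (indicator A)" for A
    proof -
      have "approximable (\<lambda>x. 1 + (- 1) * indicator A x)"
        by (intro approximable_add approximable_cmult that approximable_algebra const)
      then have 1: "approximable (\<lambda>x. 1 - indicator A x)" by simp
      show ?thesis
      proof (rule approximable_bounded_limit[where G = "\<lambda>n x. 1 - indicator A x" and w = "\<lambda>_. 1"])
        show "indicator (space P - A) \<in> borel_measurable P" using that sig by (intro borel_measurable_indicator) auto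
        show "(\<lambda>n. 1 - indicator A x :: real) \<longlonglongrightarrow> indicator (space P - A) x" if "x \<in> space P" for x
          using that by (cases "x \<in> A") simp_all
        show "\<bar>1 - indicator A x :: real\<bar> \<le> 1" for x by (cases "x \<in> A") simp_all
      qed (use 1 in simp_all)
    qed
    fix A :: "nat \<Rightarrow> 'b set"
    assume A: "disjoint_family A" "range A \<subseteq> sigma_sets (space P) cells" "\<And>i. approximable (indicator (A i))"
    have fin: "approximable (indicator (\<Union>i<n. A i))" for n
    proof (induction n)
      case 0
      then show ?case using approximable_algebra[OF const[of 0]] by simp
    next
      case (Suc n)
      have "(\<lambda>x. indicator (\<Union>i<n. A i) x + indicator (A n) x :: real) = indicator (\<Union>i<Suc n. A i)"
      proof -
        have "x \<notin> A i" if "i < n" "x \<in> A n" for i x using disjoint_family_onD[OF A(1), of i n] that by auto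
        then show ?thesis by (auto simp: indicator_def lessThan_Suc fun_eq_iff)
      qed
      then show ?case using approximable_add[OF Suc A(3)[of n]] by simp
    qed
    show "approximable (indicator (\<Union> (range A)))"
    proof (rule approximable_bounded_limit[where G = "\<lambda>n. indicator (\<Union>i<n. A i)" and w = "\<lambda>_. 1"])
      show "indicator (\<Union> (range A)) \<in> borel_measurable P"
        using A(2) sig by (intro borel_measurable_indicator sets.countable_UN) auto
      show "(\<lambda>n. indicator (\<Union>i<n. A i) x :: real) \<longlonglongrightarrow> indicator (\<Union> (range A)) x" for x
        by (rule LIMSEQ_indicator_UN)
    qed (use fin in auto)
  qed
qed

theorem dense_in_L2:
  assumes g: "g \<in> borel_measurable P" "integrable P (\<lambda>x. (g x)\<^sup>2)" and e: "e > 0"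
  shows "\<exists>f\<in>\<E>. (LINT x|P. (g x - f x)\<^sup>2) < e"
proof -
  obtain s where s: "\<And>i. simple_function P (s i)" "\<And>x. x \<in> space P \<Longrightarrow> (\<lambda>i. s i x) \<longlonglongrightarrow> g x"
      "\<And>i x. x \<in> space P \<Longrightarrow> norm (s i x) \<le> 2 * norm (g x)"
  proof -
    from borel_measurable_implies_sequence_metric[OF g(1), of 0] obtain s where
      "\<forall>i. simple_function P (s i)" "\<forall>x\<in>space P. (\<lambda>i. s i x) \<longlonglongrightarrow> g x" "\<forall>i. \<forall>x\<in>space P. dist (s i x) 0 \<le> 2 * dist (g x) 0"
      by blast
    then show thesis by (intro that[of s]) simp_all
  qed
  have "approximable (s i)" for i
  proof -
    have sum: "approximable (\<lambda>x. \<Sum>y\<in>Y. y * indicator (s i -` {y} \<inter> space P) x)" if "finite Y" for Y :: "real set"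
      using that
    proof (induction Y rule: finite_induct)
      case empty
      show ?case using approximable_algebra[OF const[of 0]] by simp
    next
      case (insert y Y)
      have "approximable (\<lambda>x. y * indicator (s i -` {y} \<inter> space P) x)"
        using s(1)[of i] by (intro approximable_cmult approximable_indicator) (rule simple_functionD)
      from approximable_add[OF this insert(3)] show ?case using insert(1,2) by (simp only: sum.insert not_False_eq_True)
    qed
    have "(\<Sum>y\<in>s i ` space P. y * indicator (s i -` {y} \<inter> space P) x) = s i x" if "x \<in> space P" for x
    proof -
      have "(\<Sum>y\<in>s i ` space P. y * indicator (s i -` {y} \<inter> space P) x) = (\<Sum>y\<in>s i ` space P. if y = s i x then s i x else 0)"
        using that by (intro sum.cong) (auto simp: indicator_def)
      then show ?thesis using simple_functionD(1)[OF s(1)[of i]] that by simp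
    qed
    then have eq: "(\<Sum>y\<in>s i ` space P. y * indicator (s i -` {y} \<inter> space P) x) = s i x" if "x \<in> space P" for x
      using that by blast
    show ?thesis
    proof (rule approximable_bounded_limit[where G = "\<lambda>n x. \<Sum>y\<in>s i ` space P. y * indicator (s i -` {y} \<inter> space P) x" and w = "\<lambda>x. 2 * \<bar>g x\<bar>"])
      show "s i \<in> borel_measurable P" using s(1) by (rule borel_measurable_simple_function)
      show "approximable (\<lambda>x. \<Sum>y\<in>s i ` space P. y * indicator (s i -` {y} \<inter> space P) x)"
        by (rule sum[OF simple_functionD(1)[OF s(1)]])
      show "integrable P (\<lambda>x. (2 * \<bar>g x\<bar>)\<^sup>2)" using g(2) by (simp add: power_mult_distrib)
    qed (use s(3)[of _ i] in \<open>simp_all only: eq real_norm_def tendsto_const\<close>)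
  qed
  moreover have "integrable P (\<lambda>x. (2 * \<bar>g x\<bar>)\<^sup>2)" using g(2) by (simp add: power_mult_distrib)
  ultimately have "approximable g"
    using s(2,3) by (rule_tac approximable_bounded_limit[where G = s and w = "\<lambda>x. 2 * \<bar>g x\<bar>", OF g(1)]) auto
  then show ?thesis using e by (auto simp: approximable_def)
qed

end

section \<open>The first chaos and the exponentials\<close>

context poisson_process
begin

definition centred :: "('a \<Rightarrow> real) \<Rightarrow> 'a measure \<Rightarrow> real" where
  "centred h N = stat h N - (LINT x|M. h x)"

lemma centred_measurable: "step_function M h \<Longrightarrow> centred h \<in> borel_measurable P"
  unfolding centred_def[abs_def] using measurable_stat[of h] by measurable

lemma centred_moments:
  assumes h: "step_function M h" and h': "step_function M h'"
  shows "integrable P (centred h)" "(LINT N|P. centred h N) = 0"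
    and "integrable P (\<lambda>N. centred h N * centred h' N)" "(LINT N|P. centred h N * centred h' N) = (LINT x|M. h x * h' x)"
proof -
  note m = stat_moment[OF h] and m' = stat_moment[OF h'] and p = stat_product_moment[OF h h']
  show "integrable P (centred h)" "(LINT N|P. centred h N) = 0"
    unfolding centred_def[abs_def] using m by (auto simp: prob_space)
  have eq: "centred h N * centred h' N = stat h N * stat h' N - (LINT x|M. h' x) * stat h N - (LINT x|M. h x) * stat h' N
      + (LINT x|M. h x) * (LINT x|M. h' x)" for N
    by (simp add: centred_def algebra_simps)
  show "integrable P (\<lambda>N. centred h N * centred h' N)" "(LINT N|P. centred h N * centred h' N) = (LINT x|M. h x * h' x)"
    unfolding eq using m m' p by (auto simp: prob_space)
qed

lemma centred_square:
  assumes h: "step_function M h"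
  shows "integrable P (\<lambda>N. (centred h N)\<^sup>2)" "(LINT N|P. (centred h N)\<^sup>2) = (LINT x|M. (h x)\<^sup>2)"
  using centred_moments(3,4)[OF h h] by (simp_all add: power2_eq_square)

lemma AE_centred_add:
  assumes "step_function M h" "step_function M h'"
  shows "AE N in P. centred (\<lambda>x. h x + h' x) N = centred h N + centred h' N"
  using AE_stat_add[OF assms]
  by eventually_elim (simp add: centred_def step_function_integral(1)[OF assms(1)] step_function_integral(1)[OF assms(2)])

lemma AE_centred_cmult:
  assumes "step_function M h"
  shows "AE N in P. centred (\<lambda>x. c * h x) N = c * centred h N"
proof -
  have lin: "linear (\<lambda>r::real. c * r)" by (rule linearI) (auto simp: algebra_simps)
  show ?thesis
    using AE_stat_linear[OF lin assms] by eventually_elim (simp add: centred_def algebra_simps)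
qed

lemma AE_centred_diff:
  assumes "step_function M h" "step_function M h'"
  shows "AE N in P. centred (\<lambda>x. h x - h' x) N = centred h N - centred h' N"
  using AE_centred_add[OF assms(1) step_function_cmult[OF assms(2), of "-1"]] AE_centred_cmult[OF assms(2), of "-1"]
  by eventually_elim simp

text \<open>The exponentials are the coherent vectors of Fock space: with \<open>f = e\<^sup>-\<^sup>u - 1\<close> and \<open>g = e\<^sup>-\<^sup>v - 1\<close>, the
  exponentials of \<open>u\<close> and \<open>v\<close> have inner product \<open>e\<^sup>r\<close>, where \<open>r\<close> is the inner product of \<open>f\<close> and \<open>g\<close>.
  The term \<open>r\<^sup>n / n!\<close> is the contribution of the chaos of order \<open>n\<close>.\<close>

definition exponential :: "('a \<Rightarrow> real) \<Rightarrow> 'a measure \<Rightarrow> real" where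
  "exponential u N = exp (- stat u N) * exp (- (LINT x|M. exp (- u x) - 1))"

text \<open>The projection of an exponential to the chaoses of order at least two.\<close>

definition wick :: "('a \<Rightarrow> real) \<Rightarrow> 'a measure \<Rightarrow> real" where
  "wick u N = exponential u N - 1 - centred (\<lambda>x. exp (- u x) - 1) N"

abbreviation nonneg_step :: "('a \<Rightarrow> real) \<Rightarrow> bool" where
  "nonneg_step u \<equiv> step_function M u \<and> (\<forall>x\<in>space M. 0 \<le> u x)"

lemma exponential_measurable: "nonneg_step u \<Longrightarrow> exponential u \<in> borel_measurable P"
  unfolding exponential_def[abs_def] using measurable_stat[of u] by measurable

lemma exponential_moments:
  assumes u: "nonneg_step u"
  shows "integrable P (exponential u)" "(LINT N|P. exponential u N) = 1"
proof -
  show "integrable P (exponential u)"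
    unfolding exponential_def[abs_def] using integrable_exp_stat[of u] u by auto
  show "(LINT N|P. exponential u N) = 1"
    unfolding exponential_def using Laplace_functional[of u] u by (simp add: exp_minus_inverse)
qed

lemma exponential_product:
  assumes u: "nonneg_step u" and v: "nonneg_step v"
  shows "integrable P (\<lambda>N. exponential u N * exponential v N)"
    and "(LINT N|P. exponential u N * exponential v N) = exp (LINT x|M. (exp (- u x) - 1) * (exp (- v x) - 1))"
proof -
  have uv: "nonneg_step (\<lambda>x. u x + v x)" using u v step_function_add by auto
  have s: "step_function M (\<lambda>x. exp (- u x) - 1)" "step_function M (\<lambda>x. exp (- v x) - 1)"
    using u v by (auto intro: step_function_exp_minus_one)
  let ?r = "LINT x|M. (exp (- u x) - 1) * (exp (- v x) - 1)"
  have "(LINT x|M. exp (- (u x + v x)) - 1) = (LINT x|M. (exp (- u x) - 1) * (exp (- v x) - 1) + ((exp (- u x) - 1) + (exp (- v x) - 1)))"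
    by (intro Bochner_Integration.integral_cong) (auto simp: algebra_simps exp_add[symmetric])
  also have "\<dots> = ?r + ((LINT x|M. exp (- u x) - 1) + (LINT x|M. exp (- v x) - 1))"
    using step_function_integral(1)[OF step_function_mult[OF s]] step_function_integral(1)[OF s(1)] step_function_integral(1)[OF s(2)]
    by (simp only: Bochner_Integration.integral_add Bochner_Integration.integrable_add)
  finally have I: "(LINT x|M. exp (- (u x + v x)) - 1) = ?r + ((LINT x|M. exp (- u x) - 1) + (LINT x|M. exp (- v x) - 1))" .
  have ae: "AE N in P. exponential u N * exponential v N = exp ?r * exponential (\<lambda>x. u x + v x) N"
    using AE_stat_add[OF conjunct1[OF u] conjunct1[OF v]]
    by eventually_elim (unfold exponential_def I mult_exp_exp, rule arg_cong[where f = exp], simp)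
  note [measurable] = exponential_measurable[OF u] exponential_measurable[OF v] exponential_measurable[OF uv]
  show "integrable P (\<lambda>N. exponential u N * exponential v N)"
    using exponential_moments(1)[OF uv] ae by (subst integrable_cong_AE[OF _ _ ae]) auto
  have "(LINT N|P. exponential u N * exponential v N) = (LINT N|P. exp ?r * exponential (\<lambda>x. u x + v x) N)"
    using ae by (intro integral_cong_AE) auto
  then show "(LINT N|P. exponential u N * exponential v N) = exp ?r"
    using exponential_moments(2)[OF uv] by simp
qed

lemma centred_exponential:
  assumes h: "step_function M h" and u: "nonneg_step u"
  shows "integrable P (\<lambda>N. centred h N * exponential u N)"
    and "(LINT N|P. centred h N * exponential u N) = (LINT x|M. h x * (exp (- u x) - 1))"
proof -
  define c where "c = exp (- (LINT x|M. exp (- u x) - 1))"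
  have m: "integrable P (\<lambda>N. stat h N * exp (- stat u N))"
    "(LINT N|P. stat h N * exp (- stat u N)) = (LINT x|M. h x * exp (- u x)) * exp (LINT x|M. exp (- u x) - 1)"
    using stat_exp_moment[OF h, of u] u by auto
  have eq: "centred h N * exponential u N = c * (stat h N * exp (- stat u N)) - (LINT x|M. h x) * exponential u N" for N
    by (simp add: centred_def exponential_def c_def algebra_simps)
  show "integrable P (\<lambda>N. centred h N * exponential u N)"
    unfolding eq using m(1) exponential_moments(1)[OF u] by simp
  have hu: "integrable M (\<lambda>x. h x * exp (- u x))"
  proof -
    have "integrable M (\<lambda>x. h x * (exp (- u x) - 1) + h x)"
      using step_function_integral(1)[OF step_function_mult[OF h step_function_exp_minus_one[of M u]]] step_function_integral(1)[OF h] u by simp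
    then show ?thesis by (simp add: algebra_simps)
  qed
  have "c * exp (LINT x|M. exp (- u x) - 1) = 1" by (simp add: c_def mult_exp_exp)
  then have "(LINT N|P. centred h N * exponential u N) = (LINT x|M. h x * exp (- u x)) - (LINT x|M. h x)"
    unfolding eq using m exponential_moments[OF u] by (simp add: mult.left_commute)
  also have "\<dots> = (LINT x|M. h x * (exp (- u x) - 1))"
    using hu step_function_integral(1)[OF h] by (simp add: algebra_simps)
  finally show "(LINT N|P. centred h N * exponential u N) = (LINT x|M. h x * (exp (- u x) - 1))" .
qed

lemma wick_measurable:
  assumes "nonneg_step u"
  shows "wick u \<in> borel_measurable P"
  unfolding wick_def[abs_def]
  using exponential_measurable[OF assms] centred_measurable[OF step_function_exp_minus_one[of M u]] assms by simp

lemma wick_covariance: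
  assumes u: "nonneg_step u" and v: "nonneg_step v"
  defines "r \<equiv> LINT x|M. (exp (- u x) - 1) * (exp (- v x) - 1)"
  shows "integrable P (\<lambda>N. wick u N * wick v N)" "(LINT N|P. wick u N * wick v N) = exp r - 1 - r"
proof -
  let ?f = "\<lambda>x. exp (- u x) - 1" and ?g = "\<lambda>x. exp (- v x) - 1"
  have f: "step_function M ?f" "step_function M ?g" using u v by (auto intro: step_function_exp_minus_one)
  note m = exponential_moments[OF u] exponential_moments[OF v] exponential_product[OF u v]
    centred_exponential[OF f(1) v] centred_exponential[OF f(2) u] centred_moments(1,2)[OF f] centred_moments(1,2)[OF f(2,1)] centred_moments(3,4)[OF f]
  have r: "(LINT x|M. ?f x * ?g x) = r" "(LINT x|M. ?g x * ?f x) = r" by (simp_all add: r_def mult.commute)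
  have eq: "wick u N * wick v N = exponential u N * exponential v N - exponential u N - exponential v N + 1
     - centred ?g N * exponential u N - centred ?f N * exponential v N + centred ?f N + centred ?g N + centred ?f N * centred ?g N" for N
    by (simp add: wick_def algebra_simps)
  show "integrable P (\<lambda>N. wick u N * wick v N)" unfolding eq using m by simp
  show "(LINT N|P. wick u N * wick v N) = exp r - 1 - r" unfolding eq using m r by (simp add: prob_space)
qed

lemma wick_square_integrable:
  assumes "nonneg_step u"
  shows "integrable P (\<lambda>N. (wick u N)\<^sup>2)"
  using wick_covariance(1)[OF assms assms] by (simp add: power2_eq_square)

lemma wick_orthogonal:
  assumes u: "nonneg_step u" and h: "step_function M h"
  shows "integrable P (wick u)" "(LINT N|P. wick u N) = 0" "(LINT N|P. centred h N * wick u N) = 0"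
proof -
  let ?f = "\<lambda>x. exp (- u x) - 1"
  have f: "step_function M ?f" using u by (auto intro: step_function_exp_minus_one)
  note m = exponential_moments[OF u] centred_exponential[OF h u] centred_moments(1,2)[OF f f] centred_moments[OF h f]
  show "integrable P (wick u)" "(LINT N|P. wick u N) = 0"
    unfolding wick_def[abs_def] using m by (simp_all add: prob_space)
  have "centred h N * wick u N = centred h N * exponential u N - centred h N - centred h N * centred ?f N" for N
    by (simp add: wick_def algebra_simps)
  then show "(LINT N|P. centred h N * wick u N) = 0" using m by simp
qed

inductive_set exp_span :: "('a measure \<Rightarrow> real) set" where
  exp: "nonneg_step u \<Longrightarrow> (\<lambda>N. exp (- stat u N)) \<in> exp_span"
| scale: "f \<in> exp_span \<Longrightarrow> (\<lambda>N. c * f N) \<in> exp_span"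
| add: "f \<in> exp_span \<Longrightarrow> g \<in> exp_span \<Longrightarrow> (\<lambda>N. f N + g N) \<in> exp_span"

text \<open>Products of exponentials are exponentials by linearity of the statistics, thus up to null sets.\<close>

lemma exp_span_mult:
  assumes "f \<in> exp_span" "g \<in> exp_span"
  shows "\<exists>h\<in>exp_span. AE N in P. f N * g N = h N"
  using assms
proof (induction f rule: exp_span.induct)
  case (exp u)
  note u = exp(1)
  from exp(2) show ?case
  proof (induction g rule: exp_span.induct)
    case (exp v)
    have "AE N in P. exp (- stat u N) * exp (- stat v N) = exp (- stat (\<lambda>x. u x + v x) N)"
      using AE_stat_add[OF conjunct1[OF u] conjunct1[OF exp]] by eventually_elim (simp add: mult_exp_exp)
    moreover have "nonneg_step (\<lambda>x. u x + v x)" using u exp step_function_add by auto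
    ultimately show ?case by (intro bexI[OF _ exp_span.exp])
  next
    case (scale g c)
    then obtain h where "h \<in> exp_span" "AE N in P. exp (- stat u N) * g N = h N" by blast
    then show ?case by (intro bexI[OF _ exp_span.scale[of h c]]) (auto elim!: eventually_mono)
  next
    case (add g1 g2)
    then obtain h1 h2 where h: "h1 \<in> exp_span" "AE N in P. exp (- stat u N) * g1 N = h1 N" "h2 \<in> exp_span" "AE N in P. exp (- stat u N) * g2 N = h2 N" by blast
    from h(2,4) have "AE N in P. exp (- stat u N) * (g1 N + g2 N) = h1 N + h2 N"
      by eventually_elim (simp add: algebra_simps)
    then show ?case by (intro bexI[OF _ exp_span.add[OF h(1,3)]])
  qed
next
  case (scale f c)
  then obtain h where "h \<in> exp_span" "AE N in P. f N * g N = h N" by blast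
  then show ?case by (intro bexI[OF _ exp_span.scale[of h c]]) (auto elim!: eventually_mono)
next
  case (add f1 f2)
  then obtain h1 h2 where h: "h1 \<in> exp_span" "AE N in P. f1 N * g N = h1 N" "h2 \<in> exp_span" "AE N in P. f2 N * g N = h2 N" by blast
  from h(2,4) have "AE N in P. (f1 N + f2 N) * g N = h1 N + h2 N"
    by eventually_elim (simp add: algebra_simps)
  then show ?case by (intro bexI[OF _ exp_span.add[OF h(1,3)]])
qed

text \<open>Because the exponentials multiply like exponentials only almost surely, the algebra is closed under
  changes on null sets.\<close>

definition exp_algebra :: "('a measure \<Rightarrow> real) set" where
  "exp_algebra = {f \<in> borel_measurable P. (\<exists>B. \<forall>N\<in>space P. \<bar>f N\<bar> \<le> B) \<and> (\<exists>g\<in>exp_span. AE N in P. f N = g N)}"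

text \<open>The number of points in a set of finite measure is a decreasing function of the exponential of its
  indicator; other sets are exhausted by sets of finite measure.\<close>

lemma generating_algebra_exp:
  assumes sf: "sigma_finite_measure M"
  shows "generating_algebra P exp_algebra"
proof
  show "(\<lambda>_. c) \<in> exp_algebra" for c
  proof -
    have "nonneg_step (\<lambda>x. 0)" by (auto intro!: step_functionI[of _ _ "{}"])
    then have "(\<lambda>N. c * exp (- stat (\<lambda>x. 0) N)) \<in> exp_span" by (intro exp_span.intros)
    then show ?thesis by (auto simp: exp_algebra_def intro!: exI[of _ "\<bar>c\<bar>"])
  qed
  show "(\<lambda>x. f x + g x) \<in> exp_algebra" if fg: "f \<in> exp_algebra" "g \<in> exp_algebra" for f g
  proof -
    obtain B B' f' g' where b: "\<forall>N\<in>space P. \<bar>f N\<bar> \<le> B" "\<forall>N\<in>space P. \<bar>g N\<bar> \<le> B'"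
      and "f' \<in> exp_span" "AE N in P. f N = f' N" "g' \<in> exp_span" "AE N in P. g N = g' N"
      using fg by (auto simp: exp_algebra_def)
    then have "(\<lambda>N. f' N + g' N) \<in> exp_span" "AE N in P. f N + g N = f' N + g' N"
      by (auto intro: exp_span.add elim: eventually_elim2)
    moreover have "\<forall>N\<in>space P. \<bar>f N + g N\<bar> \<le> B + B'" using b by (auto intro: order_trans[OF abs_triangle_ineq] add_mono)
    ultimately show ?thesis using fg by (auto simp: exp_algebra_def)
  qed
  show "(\<lambda>x. f x * g x) \<in> exp_algebra" if fg: "f \<in> exp_algebra" "g \<in> exp_algebra" for f g
  proof -
    obtain B B' f' g' where b: "\<forall>N\<in>space P. \<bar>f N\<bar> \<le> B" "\<forall>N\<in>space P. \<bar>g N\<bar> \<le> B'"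
      and s: "f' \<in> exp_span" "AE N in P. f N = f' N" "g' \<in> exp_span" "AE N in P. g N = g' N"
      using fg by (auto simp: exp_algebra_def)
    obtain h where h: "h \<in> exp_span" "AE N in P. f' N * g' N = h N" using exp_span_mult[OF s(1,3)] by blast
    have "AE N in P. f N * g N = h N" using s(2,4) h(2) by eventually_elim simp
    moreover have "\<bar>f N * g N\<bar> \<le> \<bar>B\<bar> * \<bar>B'\<bar>" if "N \<in> space P" for N
    proof -
      have "\<bar>f N\<bar> \<le> \<bar>B\<bar>" "\<bar>g N\<bar> \<le> \<bar>B'\<bar>" using b that by fastforce+
      then show ?thesis unfolding abs_mult by (intro mult_mono) auto
    qed
    ultimately show ?thesis using fg h(1) by (auto simp: exp_algebra_def)
  qed
  show "f \<in> borel_measurable P" "\<exists>B. \<forall>x\<in>space P. \<bar>f x\<bar> \<le> B" if "f \<in> exp_algebra" for f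
    using that by (auto simp: exp_algebra_def)
  define Gen where "Gen = {{N \<in> space P. f N < c} | f c. f \<in> exp_algebra}"
  define S where "S = sigma (space P) Gen"
  have Gen: "Gen \<subseteq> Pow (space P)" by (auto simp: Gen_def)
  have S: "space S = space P" "sets S = sigma_sets (space P) Gen" using Gen by (auto simp: S_def)
  have fin: "(\<lambda>N. emeasure N B) \<in> borel_measurable S" if B: "B \<in> fmeasurable M" for B
  proof (rule borel_measurableI_greater)
    have [measurable]: "B \<in> sets M" using B by auto
    fix y :: ennreal
    \<comment> \<open>At infinitely many points the value \<open>0\<close> continues the monotone dependence on the number of points.\<close>
    define f where "f N = (if emeasure N B < \<infinity> then exp (- measure N B) else 0)" for N
    have ind: "nonneg_step (indicator B)" using step_function_indicator_real[OF B] by auto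
    have "AE N in P. f N = exp (- stat (indicator B) N)"
      using AE_finite[OF B] AE_space by eventually_elim (use B in \<open>auto simp: f_def stat_indicator fmeasurableD\<close>)
    moreover have "f \<in> borel_measurable P" unfolding f_def by measurable
    moreover have "\<bar>f N\<bar> \<le> 1" for N by (simp add: f_def)
    ultimately have f: "f \<in> exp_algebra"
      using exp_span.exp[OF ind] unfolding exp_algebra_def by (auto intro!: exI[of _ 1])
    show "{N \<in> space S. y < emeasure N B} \<in> sets S"
    proof (cases y)
      case (real r)
      have "y < emeasure N B \<longleftrightarrow> f N < exp (- r)" for N
      proof (cases "emeasure N B < \<infinity>")
        case True
        then have "emeasure N B = ennreal (measure N B)" by (simp add: emeasure_eq_ennreal_measure less_top[symmetric])
        then show ?thesis using True real by (simp add: f_def ennreal_less_iff)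
      next
        case False
        then show ?thesis using real by (simp add: f_def top.not_eq_extremum[symmetric])
      qed
      then have "{N \<in> space S. y < emeasure N B} = {N \<in> space P. f N < exp (- r)}" by (simp add: S)
      also have "\<dots> \<in> sets S" unfolding S using f by (intro sigma_sets.Basic) (auto simp: Gen_def)
      finally show ?thesis .
    next
      case top
      then show ?thesis by simp
    qed
  qed
  have all: "(\<lambda>N. emeasure N A) \<in> borel_measurable S" if A: "A \<in> sets M" for A
  proof -
    interpret sigma_finite_measure M by fact
    obtain X :: "nat \<Rightarrow> 'a set" where X: "range X \<subseteq> sets M" "(\<Union>i. X i) = space M" "\<And>i. emeasure M (X i) \<noteq> \<infinity>" "incseq X"
      using sigma_finite_incseq by blast
    have AX: "A \<inter> X i \<in> fmeasurable M" for i
    proof (rule fmeasurableI2)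
      show "X i \<in> fmeasurable M" using X(3)[of i] X(1) by (intro fmeasurableI) (auto simp: less_top[symmetric])
    qed (use A X in auto)
    have "emeasure N A = (SUP i. emeasure N (A \<inter> X i))" if "N \<in> space S" for N
    proof -
      have N: "sets N = sets M" using configuration_sets that S(1) by auto
      have "(SUP i. emeasure N (A \<inter> X i)) = emeasure N (\<Union>i. A \<inter> X i)"
      proof (rule SUP_emeasure_incseq)
        show "incseq (\<lambda>i. A \<inter> X i)" using X(4) unfolding incseq_def by blast
      qed (use X(1) A in \<open>auto simp: N\<close>)
      also have "(\<Union>i. A \<inter> X i) = A" using X(2) sets.sets_into_space[OF A] by auto
      finally show ?thesis ..
    qed
    then show ?thesis using fin[OF AX] by (subst measurable_cong) auto
  qed
  have "sets (configuration_algebra M) \<subseteq> sets S"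
    unfolding configuration_algebra_def
  proof (rule sets_Sup_in_sets)
    fix V assume "V \<in> (\<lambda>A. vimage_algebra (configurations M) (\<lambda>N. emeasure N A) borel) ` sets M"
    then obtain A where A: "A \<in> sets M" "V = vimage_algebra (configurations M) (\<lambda>N. emeasure N A) borel" by auto
    show "space V = space S" by (simp add: A S space_P)
    show "sets V \<subseteq> sets S"
      using sets_image_in_sets[of S "configurations M", OF _ all[OF A(1)]] S(1) space_P by (simp add: A)
  qed auto
  then show "sets P \<subseteq> sigma_sets (space P) {{x \<in> space P. f x < c} | f c. f \<in> exp_algebra}"
    using S(2) sets_P by (simp add: Gen_def)
qed

text \<open>Every combination of exponentials splits into a constant, an element of the first chaos and a
  combination \<open>W\<close> of projected exponentials. Here \<open>W\<close> is described only by the orthogonality relations that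
  it satisfies.\<close>

lemma exp_span_chaos:
  assumes g: "g \<in> exp_span" and G: "G \<in> borel_measurable P" "integrable P (\<lambda>N. (G N)\<^sup>2)"
    and orth: "\<And>u. nonneg_step u \<Longrightarrow> (LINT N|P. G N * wick u N) = 0"
  shows "\<exists>c h W. step_function M h \<and> W \<in> borel_measurable P \<and> integrable P (\<lambda>N. (W N)\<^sup>2) \<and>
     (LINT N|P. G N * W N) = 0 \<and> (\<forall>h'. step_function M h' \<longrightarrow> (LINT N|P. centred h' N * W N) = 0) \<and>
     (AE N in P. g N = c + centred h N + W N)"
  using g
proof (induction g rule: exp_span.induct)
  case (exp u)
  define a where "a = exp (LINT x|M. exp (- u x) - 1)"
  let ?f = "\<lambda>x. exp (- u x) - 1"
  have f: "step_function M ?f" using exp by (auto intro: step_function_exp_minus_one)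
  have eq: "exp (- stat u N) = a + a * centred ?f N + a * wick u N" for N
  proof -
    have "a * exponential u N = exp (- stat u N)"
      by (simp add: exponential_def a_def mult_exp_exp)
    then show ?thesis by (simp add: wick_def algebra_simps)
  qed
  have "AE N in P. exp (- stat u N) = a + centred (\<lambda>x. a * ?f x) N + a * wick u N"
    using AE_centred_cmult[OF f, of a] by eventually_elim (simp add: eq)
  moreover have "(LINT N|P. G N * (a * wick u N)) = 0" "\<forall>h'. step_function M h' \<longrightarrow> (LINT N|P. centred h' N * (a * wick u N)) = 0"
    using orth[OF exp] wick_orthogonal(3)[OF exp] by (simp_all add: mult.left_commute)
  moreover have "(\<lambda>N. a * wick u N) \<in> borel_measurable P" "integrable P (\<lambda>N. (a * wick u N)\<^sup>2)"
    using wick_measurable[OF exp] wick_square_integrable[OF exp] by (auto simp: power_mult_distrib)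
  ultimately show ?case using step_function_cmult[OF f, of a]
    by (intro exI[of _ a] exI[of _ "\<lambda>x. a * ?f x"] exI[of _ "\<lambda>N. a * wick u N"]) simp
next
  case (scale g b)
  then obtain c h W where IH: "step_function M h" "W \<in> borel_measurable P" "integrable P (\<lambda>N. (W N)\<^sup>2)"
     "(LINT N|P. G N * W N) = 0" "\<And>h'. step_function M h' \<Longrightarrow> (LINT N|P. centred h' N * W N) = 0"
     "AE N in P. g N = c + centred h N + W N" by blast
  have "AE N in P. b * g N = b * c + centred (\<lambda>x. b * h x) N + b * W N"
    using IH(6) AE_centred_cmult[OF IH(1), of b] by eventually_elim (simp add: algebra_simps)
  moreover have "(LINT N|P. G N * (b * W N)) = 0" "\<forall>h'. step_function M h' \<longrightarrow> (LINT N|P. centred h' N * (b * W N)) = 0"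
    using IH(4,5) by (simp_all add: mult.left_commute)
  moreover have "(\<lambda>N. b * W N) \<in> borel_measurable P" "integrable P (\<lambda>N. (b * W N)\<^sup>2)"
    using IH(2,3) by (auto simp: power_mult_distrib)
  ultimately show ?case using step_function_cmult[OF IH(1), of b]
    by (intro exI[of _ "b * c"] exI[of _ "\<lambda>x. b * h x"] exI[of _ "\<lambda>N. b * W N"]) simp
next
  case (add g1 g2)
  then obtain c1 h1 W1 where 1: "step_function M h1" "W1 \<in> borel_measurable P" "integrable P (\<lambda>N. (W1 N)\<^sup>2)"
     "(LINT N|P. G N * W1 N) = 0" "\<And>h'. step_function M h' \<Longrightarrow> (LINT N|P. centred h' N * W1 N) = 0"
     "AE N in P. g1 N = c1 + centred h1 N + W1 N" by blast
  from add obtain c2 h2 W2 where 2: "step_function M h2" "W2 \<in> borel_measurable P" "integrable P (\<lambda>N. (W2 N)\<^sup>2)"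
     "(LINT N|P. G N * W2 N) = 0" "\<And>h'. step_function M h' \<Longrightarrow> (LINT N|P. centred h' N * W2 N) = 0"
     "AE N in P. g2 N = c2 + centred h2 N + W2 N" by blast
  have int: "integrable P (\<lambda>N. H N * W1 N)" "integrable P (\<lambda>N. H N * W2 N)"
    if "H \<in> borel_measurable P" "integrable P (\<lambda>N. (H N)\<^sup>2)" for H :: "'a measure \<Rightarrow> real"
    using that 1(2,3) 2(2,3) by (auto intro!: integrable_mult_L2)
  have z: "(LINT N|P. H N * (W1 N + W2 N)) = 0"
    if "H \<in> borel_measurable P" "integrable P (\<lambda>N. (H N)\<^sup>2)" "(LINT N|P. H N * W1 N) = 0" "(LINT N|P. H N * W2 N) = 0" for H :: "'a measure \<Rightarrow> real"
    using int[OF that(1,2)] that(3,4) by (simp add: distrib_left)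
  have "AE N in P. g1 N + g2 N = (c1 + c2) + centred (\<lambda>x. h1 x + h2 x) N + (W1 N + W2 N)"
    using 1(6) 2(6) AE_centred_add[OF 1(1) 2(1)] by eventually_elim simp
  moreover have "integrable P (\<lambda>N. (W1 N + W2 N)\<^sup>2)"
    using 1(2,3) 2(2,3) integrable_mult_L2[OF 1(2) 2(2)] by (simp add: power2_sum mult.assoc)
  moreover have "\<forall>h'. step_function M h' \<longrightarrow> (LINT N|P. centred h' N * (W1 N + W2 N)) = 0"
    using z[OF centred_measurable centred_square(1)] 1(5) 2(5) by blast
  ultimately show ?case using step_function_add[OF 1(1) 2(1)] z[OF G 1(4) 2(4)] 1(2) 2(2)
    by (intro exI[of _ "c1 + c2"] exI[of _ "\<lambda>x. h1 x + h2 x"] exI[of _ "\<lambda>N. W1 N + W2 N"]) simp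
qed

text \<open>Approximate \<open>G\<close> by \<open>c + centred h + W\<close>. The part \<open>c + W\<close> is orthogonal to \<open>G - centred h\<close>, so dropping it
  brings the approximation closer to \<open>G\<close>.\<close>

lemma first_chaos:
  assumes sf: "sigma_finite_measure M"
    and G: "G \<in> borel_measurable P" "integrable P (\<lambda>N. (G N)\<^sup>2)" "(LINT N|P. G N) = 0"
    and orth: "\<And>u. nonneg_step u \<Longrightarrow> (LINT N|P. G N * wick u N) = 0" and e: "e > 0"
  shows "\<exists>h. step_function M h \<and> (LINT N|P. (G N - centred h N)\<^sup>2) < e"
proof -
  interpret generating_algebra P exp_algebra by (rule generating_algebra_exp[OF sf])
  obtain f where f: "f \<in> exp_algebra" "(LINT N|P. (G N - f N)\<^sup>2) < e"
    using dense_in_L2[OF G(1,2) e] by blast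
  then obtain g where g: "g \<in> exp_span" "AE N in P. f N = g N" and fm: "f \<in> borel_measurable P" by (auto simp: exp_algebra_def)
  obtain c h W where h: "step_function M h" and W: "W \<in> borel_measurable P" "integrable P (\<lambda>N. (W N)\<^sup>2)"
     "(LINT N|P. G N * W N) = 0" "\<And>h'. step_function M h' \<Longrightarrow> (LINT N|P. centred h' N * W N) = 0"
     "AE N in P. g N = c + centred h N + W N"
    using exp_span_chaos[OF g(1) G(1,2) orth] by blast
  note hm = centred_measurable[OF h] centred_square[OF h] centred_moments(1,2)[OF h h]
  define D where "D N = G N - centred h N" for N
  define Z where "Z N = c + W N" for N
  have D: "D \<in> borel_measurable P" "integrable P (\<lambda>N. (D N)\<^sup>2)"
    unfolding D_def using G(1,2) hm by (auto intro: integrable_square_diff)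
  have Z: "Z \<in> borel_measurable P" "integrable P (\<lambda>N. (Z N)\<^sup>2)"
  proof -
    show "Z \<in> borel_measurable P" unfolding Z_def using W(1) by measurable
    have "integrable P (\<lambda>N. (W N - (- c))\<^sup>2)" using W(1,2) by (intro integrable_square_diff) auto
    then show "integrable P (\<lambda>N. (Z N)\<^sup>2)" by (simp add: Z_def add.commute)
  qed
  have Gi: "integrable P G" using integrable_mult_L2[OF G(1), of "\<lambda>_. 1"] G(2) by simp
  have DZ: "(LINT N|P. D N * Z N) = 0"
  proof -
    have "D N * Z N = c * G N - c * centred h N + G N * W N - centred h N * W N" for N
      by (simp add: D_def Z_def algebra_simps)
    moreover have "integrable P (\<lambda>N. G N * W N)" "integrable P (\<lambda>N. centred h N * W N)"
      using G(1,2) hm W(1,2) by (auto intro!: integrable_mult_L2)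
    ultimately show ?thesis using Gi G(3) hm W(3) W(4)[OF h] by simp
  qed
  have "(LINT N|P. (D N)\<^sup>2) \<le> (LINT N|P. (D N)\<^sup>2) + (LINT N|P. (Z N)\<^sup>2) - 2 * (LINT N|P. D N * Z N)"
    unfolding DZ by simp
  also have "\<dots> = (LINT N|P. (D N - Z N)\<^sup>2)"
    using D Z integrable_mult_L2[OF D(1) Z(1)] by (simp add: power2_diff mult.assoc)
  also have "\<dots> = (LINT N|P. (G N - f N)\<^sup>2)"
  proof (rule integral_cong_AE)
    show "AE N in P. (D N - Z N)\<^sup>2 = (G N - f N)\<^sup>2"
      using W(5) g(2) by eventually_elim (simp add: D_def Z_def algebra_simps)
  qed (use D Z G fm in measurable)
  finally show ?thesis using f(2) h by (auto simp: D_def)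
qed

end

section \<open>Spectral measures of the chaoses\<close>

text \<open>The spectral type refers to complex functions; for a real step function the inner products that define its
  spectral measure are real covariances.\<close>

lemma step_function_spectral_measure:
  fixes f :: "'a \<Rightarrow> real"
  assumes \<sigma>: "maximal_spectral_type M T \<sigma>" and f: "step_function M f"
  shows "\<exists>\<nu>. circle_measure \<nu> \<and> absolutely_continuous \<sigma> \<nu> \<and>
     (\<forall>k. (LINT z|\<nu>. z ^ k) = complex_of_real (LINT x|M. f ((T ^^ k) x) * f x))"
proof -
  have "L2_fun M (\<lambda>x. complex_of_real (f x))"
  proof -
    have "f \<in> borel_measurable M" using step_function_support(1)[OF f] by (rule borel_measurable_simple_function)
    moreover have "integrable M (\<lambda>x. f x * f x)" using step_function_integral(1)[OF step_function_mult[OF f f]] .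
    ultimately show ?thesis by (simp add: L2_fun_def power2_eq_square)
  qed
  then obtain \<nu> where \<nu>: "spectral_measure_of M T (\<lambda>x. complex_of_real (f x)) \<nu>" "absolutely_continuous \<sigma> \<nu>"
    using \<sigma> unfolding maximal_spectral_type_def by blast
  have "(LINT z|\<nu>. z ^ k) = complex_of_real (LINT x|M. f ((T ^^ k) x) * f x)" for k
    using \<nu>(1) by (simp add: spectral_measure_of_def integral_complex_of_real[symmetric] del: integral_complex_of_real)
  then show ?thesis using \<nu> by (auto simp: spectral_measure_of_def)
qed

text \<open>Since \<open>e\<^sup>r - 1 - r\<close> is the sum of \<open>r\<^sup>n / n!\<close> over \<open>n \<ge> 2\<close>, and \<open>r\<^sup>n\<close> is a moment of the \<open>n\<close>-th convolution
  power, these numbers are the moments of a mixture of the convolution powers of order at least two.\<close>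

lemma higher_chaos_spectral_measure:
  assumes \<nu>: "circle_measure \<nu>" and r: "\<And>k::nat. (LINT z|\<nu>. z ^ k) = complex_of_real (r k)"
  shows "\<exists>\<tau>. circle_measure \<tau> \<and> (\<forall>E. (\<forall>n\<ge>2. E \<in> null_sets (convolution_power \<nu> n)) \<longrightarrow> E \<in> null_sets \<tau>) \<and>
     (\<forall>k. (LINT z|\<tau>. z ^ k) = complex_of_real (exp (r k) - 1 - r k))"
proof -
  define m where "m k = convolution_power \<nu> (k + 2)" for k
  define w :: "nat \<Rightarrow> real" where "w k = 1 / fact (k + 2)" for k
  have m: "circle_measure (m k)" for k unfolding m_def by (rule circle_measure_convolution_power[OF \<nu>])
  have tail: "(\<lambda>k. w k * x ^ (k + 2)) sums (exp x - 1 - x)" for x :: real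
  proof -
    have "(\<lambda>k. x ^ k / fact k) sums exp x" using exp_converges[of x] by (simp add: field_simps)
    then have "(\<lambda>k. x ^ (k + 2) / fact (k + 2)) sums (exp x - (\<Sum>k<2. x ^ k / fact k))" by (rule sums_split_initial_segment)
    then show ?thesis by (simp add: w_def numeral_2_eq_2 diff_diff_eq)
  qed
  have mass: "measure (m k) (sphere 0 1) = measure \<nu> (sphere 0 1) ^ (k + 2)" for k
  proof -
    have one: "(LINT z|\<mu>. z ^ 0) = complex_of_real (measure \<mu> (sphere 0 1))" if "circle_measure \<mu>" for \<mu> :: "complex measure"
      using circle_measureD(3)[OF that] by (simp add: scaleR_conv_of_real)
    have "complex_of_real (measure (m k) (sphere 0 1)) = complex_of_real (measure \<nu> (sphere 0 1)) ^ (k + 2)"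
      using moment_convolution_power[OF \<nu>, of "k + 2" 0] one[OF m, of k] one[OF \<nu>] unfolding m_def by metis
    then show ?thesis by (metis of_real_eq_iff of_real_power)
  qed
  have "summable (\<lambda>k. w k * measure (m k) (sphere 0 1))"
    unfolding mass using tail by (rule sums_summable)
  then obtain \<tau> where \<tau>: "circle_measure \<tau>" "\<And>E. (\<And>k. E \<in> null_sets (m k)) \<Longrightarrow> E \<in> null_sets \<tau>"
      "\<And>j::nat. (\<lambda>k. w k * (LINT z|m k. z ^ j)) sums (LINT z|\<tau>. z ^ j)"
    using mixture_of_circle_measures[of m w, OF m] by (auto simp: w_def)
  have "(LINT z|\<tau>. z ^ j) = complex_of_real (exp (r j) - 1 - r j)" for j
  proof -
    have "(\<lambda>k. complex_of_real (w k * r j ^ (k + 2))) sums complex_of_real (exp (r j) - 1 - r j)"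
      using tail by (rule sums_of_real)
    moreover have "complex_of_real (w k) * (LINT z|m k. z ^ j) = complex_of_real (w k * r j ^ (k + 2))" for k
      unfolding m_def moment_convolution_power[OF \<nu>] r by simp
    ultimately have "(\<lambda>k. complex_of_real (w k) * (LINT z|m k. z ^ j)) sums complex_of_real (exp (r j) - 1 - r j)"
      by (simp only:)
    with \<tau>(3)[of j] show ?thesis by (rule sums_unique2)
  qed
  moreover have "E \<in> null_sets \<tau>" if "\<forall>n\<ge>2. E \<in> null_sets (convolution_power \<nu> n)" for E
    by (rule \<tau>(2)) (unfold m_def, rule that[rule_format], simp)
  ultimately show ?thesis using \<tau>(1) by blast
qed

context poisson_process
begin

lemma measurable_suspension:
  assumes "T \<in> M \<rightarrow>\<^sub>M M"
  shows "poisson_suspension M T \<in> P \<rightarrow>\<^sub>M P"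
  using measurable_poisson_suspension[OF assms] sets_P by (simp cong: measurable_cong_sets)

lemma suspension_space:
  assumes "T \<in> M \<rightarrow>\<^sub>M M" "N \<in> space P"
  shows "poisson_suspension M T N \<in> space P"
  using measurable_space[OF measurable_suspension[OF assms(1)] assms(2)] .

lemma centred_suspension:
  assumes T: "preserves M T" and h: "step_function M h" and N: "N \<in> space P"
  shows "centred h (poisson_suspension M T N) = centred (\<lambda>x. h (T x)) N"
  using stat_poisson_suspension[OF assms] preserves_integral[OF T, of h] step_function_support(1)[OF h]
  by (simp add: centred_def borel_measurable_simple_function)

lemma centred_suspension_pow:
  assumes T: "preserves M T" and h: "step_function M h" and N: "N \<in> space P"
  shows "centred h ((poisson_suspension M T ^^ k) N) = centred (\<lambda>x. h ((T ^^ k) x)) N"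
  using h N
proof (induction k arbitrary: N)
  case (Suc k)
  have "centred h ((poisson_suspension M T ^^ Suc k) N) = centred (\<lambda>x. h ((T ^^ k) x)) (poisson_suspension M T N)"
    using Suc suspension_space[OF preserves_measurable[OF T]] by (simp add: funpow_swap1)
  also have "\<dots> = centred (\<lambda>x. h ((T ^^ k) (T x))) N"
    using Suc by (intro centred_suspension[OF T step_function_preserves[OF preserves_funpow[OF T]]])
  finally show ?case by (simp add: funpow_swap1)
qed simp

lemma wick_suspension_pow:
  assumes T: "preserves M T" and u: "nonneg_step u" and N: "N \<in> space P"
  shows "wick u ((poisson_suspension M T ^^ k) N) = wick (\<lambda>x. u ((T ^^ k) x)) N"
proof -
  have Tk: "preserves M (T ^^ k)" by (rule preserves_funpow[OF T])
  have su: "step_function M u" using u by simp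
  have um: "u \<in> borel_measurable M" using step_function_support(1)[OF su] by (rule borel_measurable_simple_function)
  have i: "(LINT x|M. u ((T ^^ k) x)) = (LINT x|M. u x)" "(LINT x|M. exp (- u ((T ^^ k) x)) - 1) = (LINT x|M. exp (- u x) - 1)"
    using preserves_integral[OF Tk um] preserves_integral[OF Tk, of "\<lambda>x. exp (- u x) - 1"] um by simp_all
  have "stat u ((poisson_suspension M T ^^ k) N) = stat (\<lambda>x. u ((T ^^ k) x)) N"
    using centred_suspension_pow[OF T su N, of k] i(1) by (simp add: centred_def)
  moreover have "centred (\<lambda>x. exp (- u x) - 1) ((poisson_suspension M T ^^ k) N) = centred (\<lambda>x. exp (- u ((T ^^ k) x)) - 1) N"
    using centred_suspension_pow[OF T step_function_exp_minus_one[OF su] N] .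
  ultimately show ?thesis by (simp add: wick_def exponential_def i(2))
qed

text \<open>The hypothesis \<open>cov\<close> says that \<open>G\<close> has the same spectral measure as a function on the base, so this
  measure is dominated by \<open>\<sigma>\<close>. The spectral measure of a projected exponential is dominated by the
  convolution powers of \<open>\<sigma>\<close> of order at least two, which are singular to \<open>\<sigma>\<close>.\<close>

lemma perp_orthogonal_to_higher_chaos:
  assumes T: "preserves M T" and perp: "property_perp M T" and \<Phi>: "preserves P (poisson_suspension M T)"
    and G: "G \<in> borel_measurable P" "integrable P (\<lambda>N. (G N)\<^sup>2)" and f: "step_function M f"
    and cov: "\<And>k. (LINT N|P. G ((poisson_suspension M T ^^ k) N) * G N) = (LINT x|M. f ((T ^^ k) x) * f x)"
    and u: "nonneg_step u"
  shows "(LINT N|P. G N * wick u N) = 0"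
proof -
  obtain \<sigma> where \<sigma>: "maximal_spectral_type M T \<sigma>" and sing: "\<And>n. n \<ge> 2 \<Longrightarrow> mutually_singular \<sigma> (convolution_power \<sigma> n)"
    using perp unfolding property_perp_def by blast
  have c\<sigma>: "circle_measure \<sigma>" using \<sigma> by (simp add: maximal_spectral_type_def)
  let ?g = "\<lambda>x. exp (- u x) - 1"
  have g: "step_function M ?g" using u by (auto intro: step_function_exp_minus_one)
  obtain \<nu> where \<nu>: "circle_measure \<nu>" "absolutely_continuous \<sigma> \<nu>"
      "\<And>k. (LINT z|\<nu>. z ^ k) = complex_of_real (LINT x|M. f ((T ^^ k) x) * f x)"
    using step_function_spectral_measure[OF \<sigma> f] by blast
  obtain \<nu>' where \<nu>': "circle_measure \<nu>'" "absolutely_continuous \<sigma> \<nu>'"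
      "\<And>k. (LINT z|\<nu>'. z ^ k) = complex_of_real (LINT x|M. ?g ((T ^^ k) x) * ?g x)"
    using step_function_spectral_measure[OF \<sigma> g] by blast
  obtain \<tau> where \<tau>: "circle_measure \<tau>" "\<And>E. (\<And>n. n \<ge> 2 \<Longrightarrow> E \<in> null_sets (convolution_power \<nu>' n)) \<Longrightarrow> E \<in> null_sets \<tau>"
      "\<And>k. (LINT z|\<tau>. z ^ k) = complex_of_real (exp (LINT x|M. ?g ((T ^^ k) x) * ?g x) - 1 - (LINT x|M. ?g ((T ^^ k) x) * ?g x))"
    using higher_chaos_spectral_measure[OF \<nu>'(1,3)] by blast
  have sp: "space (convolution_power \<mu> n) = sphere 0 1" "sets (convolution_power \<mu> n) = sets circle" if "circle_measure \<mu>" for \<mu> n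
    using circle_measureD[OF circle_measure_convolution_power[OF that]] by auto
  obtain A where A: "\<And>n. n \<ge> 2 \<Longrightarrow> A n \<in> null_sets \<sigma>" "\<And>n. n \<ge> 2 \<Longrightarrow> sphere 0 1 - A n \<in> null_sets (convolution_power \<sigma> n)"
    using sing unfolding mutually_singular_def sp[OF c\<sigma>] by metis
  \<comment> \<open>One set that separates \<open>\<sigma>\<close> from all its convolution powers of order at least two.\<close>
  define E where "E = (\<Union>k. A (k + 2))"
  have E\<sigma>: "E \<in> null_sets \<sigma>" unfolding E_def by (intro null_sets_UN) (simp add: A(1))
  then have E\<nu>: "E \<in> null_sets \<nu>" using \<nu>(2) by (auto simp: absolutely_continuous_def)
  have E_circle: "sphere 0 1 - E \<in> sets circle"
  proof -
    have "E \<in> sets circle" using E\<sigma> circle_measureD(2)[OF c\<sigma>] by auto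
    then have "space circle - E \<in> sets circle" by (rule sets.compl_sets)
    then show ?thesis by (simp add: circle_def space_restrict_space)
  qed
  have "space \<tau> - E \<in> null_sets \<tau>"
  proof (rule \<tau>(2))
    fix n :: nat assume n: "n \<ge> 2"
    have "sphere 0 1 - E \<in> null_sets (convolution_power \<sigma> n)"
    proof (rule null_sets_subset[OF A(2)[OF n]])
      obtain k where "n = k + 2" using n by (metis le_add_diff_inverse2)
      then have "A n \<subseteq> E" by (auto simp: E_def)
      then show "sphere 0 1 - E \<subseteq> sphere 0 1 - A n" by blast
    qed (simp add: sp[OF c\<sigma>] E_circle)
    then show "space \<tau> - E \<in> null_sets (convolution_power \<nu>' n)"
      using convolution_power_ac[OF c\<sigma> \<nu>'(1,2), of n] circle_measureD(3)[OF \<tau>(1)] by (auto simp: absolutely_continuous_def)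
  qed
  moreover have "(LINT z|\<tau>. z ^ k) = complex_of_real (LINT N|P. wick u ((poisson_suspension M T ^^ k) N) * wick u N)" for k
  proof -
    have "nonneg_step (\<lambda>x. u ((T ^^ k) x))"
      using u step_function_preserves[OF preserves_funpow[OF T]] measurable_space[OF preserves_measurable[OF preserves_funpow[OF T]]] by auto
    from wick_covariance(2)[OF this u]
    have "(LINT N|P. wick (\<lambda>x. u ((T ^^ k) x)) N * wick u N) = exp (LINT x|M. ?g ((T ^^ k) x) * ?g x) - 1 - (LINT x|M. ?g ((T ^^ k) x) * ?g x)" .
    moreover have "(LINT N|P. wick u ((poisson_suspension M T ^^ k) N) * wick u N) = (LINT N|P. wick (\<lambda>x. u ((T ^^ k) x)) N * wick u N)"
      using wick_suspension_pow[OF T u] by (intro Bochner_Integration.integral_cong) auto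
    ultimately show ?thesis using \<tau>(3) by simp
  qed
  moreover have "(LINT z|\<nu>. z ^ k) = complex_of_real (LINT N|P. G ((poisson_suspension M T ^^ k) N) * G N)" for k
    using \<nu>(3) cov by simp
  ultimately show ?thesis
    using singular_spectral_measures_orthogonal[OF \<Phi> G wick_measurable[OF u] wick_square_integrable[OF u] \<nu>(1) \<tau>(1) _ _ E\<nu>] by blast
qed

end

section \<open>Limits in \<open>L\<^sub>2\<close> and characteristic functions\<close>

text \<open>The rate of convergence lets Borel-Cantelli produce a pointwise limit; Fatou's lemma then controls the
  distance to it.\<close>

lemma L2_fast_Cauchy_limit:
  fixes h :: "nat \<Rightarrow> 'a \<Rightarrow> real"
  assumes m: "\<And>n. h n \<in> borel_measurable M" and sq: "\<And>n. integrable M (\<lambda>x. (h n x)\<^sup>2)"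
    and cauchy: "\<And>n k. n \<le> k \<Longrightarrow> (LINT x|M. (h n x - h k x)\<^sup>2) \<le> (1 / 16) ^ n"
  shows "\<exists>g. g \<in> borel_measurable M \<and> integrable M (\<lambda>x. (g x)\<^sup>2) \<and> (\<forall>n. integrable M (\<lambda>x. (h n x - g x)\<^sup>2)) \<and>
     (\<lambda>n. LINT x|M. (h n x - g x)\<^sup>2) \<longlonglongrightarrow> 0"
proof -
  have dsq: "integrable M (\<lambda>x. (h n x - h k x)\<^sup>2)" for n k
    using m sq integrable_mult_L2[of "h n" M "h k"] by (simp add: power2_diff mult.assoc)
  \<comment> \<open>By Chebyshev, the measure of this set is at most \<open>4\<^sup>n / 16\<^sup>n\<close>.\<close>
  define B where "B n = {x \<in> space M. (1 / 2) ^ n \<le> \<bar>h n x - h (Suc n) x\<bar>}" for n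
  have [measurable]: "B n \<in> sets M" for n unfolding B_def using m by measurable
  have B: "emeasure M (B n) \<le> ennreal ((1 / 4) ^ n)" for n
  proof -
    have "emeasure M (B n) = (\<integral>\<^sup>+x. indicator (B n) x \<partial>M)" by simp
    also have "\<dots> \<le> (\<integral>\<^sup>+x. ennreal (4 ^ n * (h n x - h (Suc n) x)\<^sup>2) \<partial>M)"
    proof (rule nn_integral_mono)
      fix x assume "x \<in> space M"
      have "1 \<le> 4 ^ n * (h n x - h (Suc n) x)\<^sup>2" if "x \<in> B n"
      proof -
        have "((1 / 2) ^ n)\<^sup>2 \<le> \<bar>h n x - h (Suc n) x\<bar>\<^sup>2" using that by (intro power_mono) (auto simp: B_def)
        moreover have "((1 / 2 :: real) ^ n)\<^sup>2 = 1 / 4 ^ n"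
          by (simp add: power_divide power_mult[symmetric] mult.commute[of n]) (simp add: power_mult)
        ultimately show ?thesis by (simp add: field_simps)
      qed
      then show "indicator (B n) x \<le> ennreal (4 ^ n * (h n x - h (Suc n) x)\<^sup>2)"
        by (auto simp: indicator_def ennreal_1[symmetric] simp del: ennreal_1 intro!: ennreal_leI)
    qed
    also have "\<dots> = ennreal (LINT x|M. 4 ^ n * (h n x - h (Suc n) x)\<^sup>2)"
      using dsq by (intro nn_integral_eq_integral) auto
    also have "\<dots> \<le> ennreal (4 ^ n * (1 / 16) ^ n)"
      using cauchy[of n "Suc n"] by (intro ennreal_leI) simp
    also have "(4 ^ n * (1 / 16) ^ n :: real) = (1 / 4) ^ n" by (simp add: power_mult_distrib[symmetric])
    finally show ?thesis .
  qed
  have "AE x in M. eventually (\<lambda>n. x \<in> space M - B n) sequentially"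
  proof (rule borel_cantelli_AE1)
    show "emeasure M (B n) < \<infinity>" for n using B[of n] ennreal_less_top le_less_trans by (metis infinity_ennreal_def)
    have "measure M (B n) \<le> (1 / 4) ^ n" for n
      unfolding measure_def using enn2real_mono[OF B[of n]] by simp
    then show "summable (\<lambda>n. measure M (B n))"
      by (intro summable_comparison_test'[OF summable_geometric[of "1 / 4 :: real"]]) auto
  qed simp
  then have conv: "AE x in M. convergent (\<lambda>n. h n x)"
    using AE_space
  proof eventually_elim
    case (elim x)
    then obtain N where N: "\<And>n. n \<ge> N \<Longrightarrow> \<bar>h n x - h (Suc n) x\<bar> < (1 / 2) ^ n"
      by (auto simp: eventually_sequentially B_def not_le)
    have "summable (\<lambda>n. h (Suc n) x - h n x)"
      by (rule summable_comparison_test'[OF summable_geometric[of "1 / 2 :: real"], of N])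
         (use N in \<open>auto simp: abs_minus_commute less_imp_le\<close>)
    then obtain l where "(\<lambda>n. \<Sum>i<n. h (Suc i) x - h i x) \<longlonglongrightarrow> l" by (auto simp: summable_def sums_def)
    then have "(\<lambda>n. h n x - h 0 x) \<longlonglongrightarrow> l" using sum_lessThan_telescope[of "\<lambda>i. h i x"] by simp
    then have "(\<lambda>n. (h n x - h 0 x) + h 0 x) \<longlonglongrightarrow> l + h 0 x" by (intro tendsto_intros)
    then show ?case by (auto simp: convergent_def)
  qed
  define g where "g x = lim (\<lambda>n. h n x)" for x
  have g: "g \<in> borel_measurable M" unfolding g_def using m by measurable
  have lim: "AE x in M. (\<lambda>n. h n x) \<longlonglongrightarrow> g x"
    using conv by eventually_elim (simp add: g_def convergent_LIMSEQ_iff)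
  have fatou: "(\<integral>\<^sup>+x. ennreal ((h n x - g x)\<^sup>2) \<partial>M) \<le> ennreal ((1 / 16) ^ n)" for n
  proof -
    have "(\<integral>\<^sup>+x. ennreal ((h n x - g x)\<^sup>2) \<partial>M) = (\<integral>\<^sup>+x. liminf (\<lambda>k. ennreal ((h n x - h k x)\<^sup>2)) \<partial>M)"
    proof (rule nn_integral_cong_AE)
      show "AE x in M. ennreal ((h n x - g x)\<^sup>2) = liminf (\<lambda>k. ennreal ((h n x - h k x)\<^sup>2))"
        using lim by eventually_elim (auto intro!: lim_imp_Liminf[symmetric] tendsto_intros)
    qed
    also have "\<dots> \<le> liminf (\<lambda>k. \<integral>\<^sup>+x. ennreal ((h n x - h k x)\<^sup>2) \<partial>M)"
      using m by (intro nn_integral_liminf) measurable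
    also have "\<dots> \<le> ennreal ((1 / 16) ^ n)"
    proof (rule Liminf_le)
      show "eventually (\<lambda>k. (\<integral>\<^sup>+x. ennreal ((h n x - h k x)\<^sup>2) \<partial>M) \<le> ennreal ((1 / 16) ^ n)) sequentially"
        using eventually_ge_at_top[of n]
      proof eventually_elim
        case (elim k)
        have "(\<integral>\<^sup>+x. ennreal ((h n x - h k x)\<^sup>2) \<partial>M) = ennreal (LINT x|M. (h n x - h k x)\<^sup>2)"
          using dsq by (intro nn_integral_eq_integral) auto
        then show ?case using cauchy[OF elim] by (auto intro: ennreal_leI)
      qed
    qed simp
    finally show ?thesis .
  qed
  have int: "integrable M (\<lambda>x. (h n x - g x)\<^sup>2)" for n
  proof (rule integrableI_nonneg)
    show "(\<lambda>x. (h n x - g x)\<^sup>2) \<in> borel_measurable M" using m g by measurable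
    show "(\<integral>\<^sup>+x. ennreal ((h n x - g x)\<^sup>2) \<partial>M) < \<infinity>" using fatou[of n] ennreal_less_top le_less_trans by (metis infinity_ennreal_def)
  qed auto
  have "(LINT x|M. (h n x - g x)\<^sup>2) \<le> (1 / 16) ^ n" for n
  proof -
    have "ennreal (LINT x|M. (h n x - g x)\<^sup>2) = (\<integral>\<^sup>+x. ennreal ((h n x - g x)\<^sup>2) \<partial>M)"
      using int by (intro nn_integral_eq_integral[symmetric]) auto
    then have "ennreal (LINT x|M. (h n x - g x)\<^sup>2) \<le> ennreal ((1 / 16) ^ n)" using fatou[of n] by (simp only:)
    then show ?thesis by (subst (asm) ennreal_le_iff) auto
  qed
  then have "(\<lambda>n. LINT x|M. (h n x - g x)\<^sup>2) \<longlonglongrightarrow> 0"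
    by (intro tendsto_sandwich[OF _ _ tendsto_const LIMSEQ_power_zero[of "1 / 16"]]) auto
  moreover have "integrable M (\<lambda>x. (g x)\<^sup>2)"
  proof (rule Bochner_Integration.integrable_bound[where f = "\<lambda>x. 2 * (h 0 x - g x)\<^sup>2 + 2 * (h 0 x)\<^sup>2"])
    show "integrable M (\<lambda>x. 2 * (h 0 x - g x)\<^sup>2 + 2 * (h 0 x)\<^sup>2)" using int sq by auto
    have "(g x)\<^sup>2 \<le> 2 * (h 0 x - g x)\<^sup>2 + 2 * (h 0 x)\<^sup>2" for x
    proof -
      have "2 * (h 0 x - g x)\<^sup>2 + 2 * (h 0 x)\<^sup>2 - (g x)\<^sup>2 = (2 * h 0 x - g x)\<^sup>2"
        by (simp add: power2_eq_square algebra_simps)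
      then show ?thesis by (metis diff_ge_0_iff_ge zero_le_power2)
    qed
    then show "AE x in M. norm ((g x)\<^sup>2) \<le> norm (2 * (h 0 x - g x)\<^sup>2 + 2 * (h 0 x)\<^sup>2)" by auto
  qed (use g in measurable)
  ultimately show ?thesis using g int by blast
qed

lemma abs_cos_diff_le: "\<bar>cos a - cos b\<bar> \<le> \<bar>a + b\<bar> * \<bar>a - b\<bar> / 2" for a b :: real
proof -
  have "cos a - cos b = 2 * (sin ((a + b) / 2) * sin ((b - a) / 2))" by (simp add: cos_diff_cos)
  also have "\<bar>\<dots>\<bar> = 2 * (\<bar>sin ((a + b) / 2)\<bar> * \<bar>sin ((b - a) / 2)\<bar>)" by (simp add: abs_mult)
  also have "\<dots> \<le> 2 * (\<bar>(a + b) / 2\<bar> * \<bar>(b - a) / 2\<bar>)"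
    by (intro mult_left_mono mult_mono abs_sin_x_le_abs_x) auto
  finally show ?thesis by (simp add: abs_minus_commute mult.commute)
qed

lemma one_minus_cos_le: "1 - cos a \<le> a\<^sup>2 / 2" for a :: real
  using abs_cos_diff_le[of 0 a] by (simp add: power2_eq_square)

lemma L2_norm_tendsto:
  fixes h :: "nat \<Rightarrow> 'a \<Rightarrow> real"
  assumes m: "\<And>n. h n \<in> borel_measurable M" "g \<in> borel_measurable M"
    and sq: "\<And>n. integrable M (\<lambda>x. (h n x)\<^sup>2)" "integrable M (\<lambda>x. (g x)\<^sup>2)" "\<And>n. integrable M (\<lambda>x. (h n x - g x)\<^sup>2)"
    and lim: "(\<lambda>n. LINT x|M. (h n x - g x)\<^sup>2) \<longlonglongrightarrow> 0"
  shows "(\<lambda>n. LINT x|M. \<bar>h n x + g x\<bar> * \<bar>h n x - g x\<bar>) \<longlonglongrightarrow> 0" "(\<lambda>n. LINT x|M. (h n x)\<^sup>2) \<longlonglongrightarrow> (LINT x|M. (g x)\<^sup>2)"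
    "\<And>n. integrable M (\<lambda>x. \<bar>h n x + g x\<bar> * \<bar>h n x - g x\<bar>)"
proof -
  note [measurable] = m
  define G where "G = (LINT x|M. (g x)\<^sup>2)"
  define d where "d n = (LINT x|M. (h n x - g x)\<^sup>2)" for n
  have le: "(h n x + g x)\<^sup>2 \<le> 2 * (h n x - g x)\<^sup>2 + 8 * (g x)\<^sup>2" for n x
  proof -
    have "2 * (h n x - g x)\<^sup>2 + 8 * (g x)\<^sup>2 - (h n x + g x)\<^sup>2 = (h n x - 3 * g x)\<^sup>2"
      by (simp add: power2_eq_square algebra_simps)
    then show ?thesis by (metis diff_ge_0_iff_ge zero_le_power2)
  qed
  have plus: "integrable M (\<lambda>x. (h n x + g x)\<^sup>2)" for n
    by (rule Bochner_Integration.integrable_bound[where f = "\<lambda>x. 2 * (h n x - g x)\<^sup>2 + 8 * (g x)\<^sup>2"])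
       (use sq le in \<open>auto intro!: AE_I2\<close>)
  have plus_le: "(LINT x|M. (h n x + g x)\<^sup>2) \<le> 2 * d n + 8 * G" for n
  proof -
    have "(LINT x|M. (h n x + g x)\<^sup>2) \<le> (LINT x|M. 2 * (h n x - g x)\<^sup>2 + 8 * (g x)\<^sup>2)"
      using plus sq le by (intro integral_mono) auto
    then show ?thesis using sq by (simp add: d_def G_def)
  qed
  show int: "integrable M (\<lambda>x. \<bar>h n x + g x\<bar> * \<bar>h n x - g x\<bar>)" for n
    using plus sq by (intro integrable_mult_L2) auto
  have bound: "(LINT x|M. \<bar>h n x + g x\<bar> * \<bar>h n x - g x\<bar>) \<le> sqrt (2 * d n + 8 * G) * sqrt (d n)" for n
  proof -
    have "norm (LINT x|M. \<bar>h n x + g x\<bar> * \<bar>h n x - g x\<bar>) \<le> sqrt (LINT x|M. (norm \<bar>h n x + g x\<bar>)\<^sup>2) * sqrt (LINT x|M. (norm \<bar>h n x - g x\<bar>)\<^sup>2)"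
      using plus sq by (intro Cauchy_Schwarz_integral) auto
    also have "\<dots> \<le> sqrt (2 * d n + 8 * G) * sqrt (d n)"
      using plus_le[of n] by (intro mult_mono) (auto simp: d_def G_def)
    finally show ?thesis by simp
  qed
  have "(\<lambda>n. sqrt (2 * d n + 8 * G) * sqrt (d n)) \<longlonglongrightarrow> sqrt (2 * 0 + 8 * G) * sqrt 0"
    using lim unfolding d_def[symmetric] by (intro tendsto_intros)
  then have up: "(\<lambda>n. sqrt (2 * d n + 8 * G) * sqrt (d n)) \<longlonglongrightarrow> 0" by simp
  show c: "(\<lambda>n. LINT x|M. \<bar>h n x + g x\<bar> * \<bar>h n x - g x\<bar>) \<longlonglongrightarrow> 0"
    by (rule tendsto_sandwich[OF _ _ tendsto_const up]) (use bound in auto)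
  have "(\<lambda>n. (LINT x|M. (h n x)\<^sup>2) - G) \<longlonglongrightarrow> 0"
  proof (rule Lim_null_comparison[OF _ c], rule always_eventually, rule allI)
    fix n
    have "(LINT x|M. (h n x)\<^sup>2) - G = (LINT x|M. (h n x + g x) * (h n x - g x))"
      using sq by (simp add: G_def power2_eq_square algebra_simps)
    also have "norm \<dots> \<le> (LINT x|M. \<bar>h n x + g x\<bar> * \<bar>h n x - g x\<bar>)"
      using integral_norm_bound[of M "\<lambda>x. (h n x + g x) * (h n x - g x)"] by (simp add: abs_mult)
    finally show "norm ((LINT x|M. (h n x)\<^sup>2) - G) \<le> (LINT x|M. \<bar>h n x + g x\<bar> * \<bar>h n x - g x\<bar>)" .
  qed
  then show "(\<lambda>n. LINT x|M. (h n x)\<^sup>2) \<longlonglongrightarrow> (LINT x|M. (g x)\<^sup>2)"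
    unfolding G_def[symmetric] by (rule LIM_zero_cancel)
qed

context poisson_process
begin

text \<open>Centred statistics are an isometric image of the step functions.\<close>

lemma indicator_statistics_eq_AE:
  assumes A: "A \<in> fmeasurable M" and B: "B \<in> fmeasurable M" and eq: "AE N in P. measure N A = measure N B"
  shows "AE x in M. x \<in> A \<longleftrightarrow> x \<in> B"
proof -
  have [measurable]: "A \<in> sets M" "B \<in> sets M" using A B by auto
  note i = step_function_indicator_real[OF A] step_function_indicator_real[OF B]
  have mAB: "measure M A = measure M B"
    using integral_cong_AE[OF _ _ eq] count_moment(2)[OF A] count_moment(2)[OF B] by simp
  have z: "AE N in P. centred (\<lambda>x. indicator A x - indicator B x) N = 0"
    using AE_centred_diff[OF i] eq AE_space
    by eventually_elim (simp add: centred_def stat_indicator fmeasurableD[OF A] fmeasurableD[OF B] mAB sets.Int_space_eq2)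
  have d: "step_function M (\<lambda>x. indicator A x - indicator B x :: real)"
    using simple_bochner_integrable_compose2[of "(-)" M "indicator A :: 'a \<Rightarrow> real" "indicator B"] i by simp
  have "(LINT x|M. (indicator A x - indicator B x :: real)\<^sup>2) = (LINT N|P. (centred (\<lambda>x. indicator A x - indicator B x) N)\<^sup>2)"
    using centred_square(2)[OF d] by simp
  also have "\<dots> = (LINT N|P. 0)" using z centred_measurable[OF d] by (intro integral_cong_AE) auto
  finally have "(LINT x|M. (indicator A x - indicator B x :: real)\<^sup>2) = 0" by simp
  moreover have "integrable M (\<lambda>x. (indicator A x - indicator B x :: real)\<^sup>2)"
    using step_function_integral(1)[OF step_function_mult[OF d d]] by (simp add: power2_eq_square)
  ultimately have "AE x in M. (indicator A x - indicator B x :: real)\<^sup>2 = 0"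
    by (subst (asm) integral_nonneg_eq_0_iff_AE) auto
  then show ?thesis by eventually_elim (auto simp: indicator_def split: if_splits)
qed

text \<open>Taking the modulus removes the centring and keeps the real part of the exponent, which is recovered from
  it by the real logarithm.\<close>

lemma cmod_characteristic_function:
  fixes h :: "'a \<Rightarrow> real"
  assumes h: "step_function M h"
  shows "cmod (LINT N|P. cis (s * centred h N)) = exp (- (LINT x|M. 1 - cos (s * h x)))"
proof -
  have lin: "linear (\<lambda>r. \<i> * complex_of_real (s * r))"
    by (rule linearI) (auto simp: scaleR_conv_of_real algebra_simps)
  have z: "step_function M (\<lambda>x. \<i> * complex_of_real (s * h x))"
    using step_function_compose[OF h, of "\<lambda>r. \<i> * complex_of_real (s * r)"] by simp
  define c where "c = (LINT x|M. h x)"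
  have "(LINT N|P. cis (s * centred h N)) = (LINT N|P. cis (- s * c) * exp (stat (\<lambda>x. \<i> * complex_of_real (s * h x)) N))"
  proof (rule integral_cong_AE)
    show "AE N in P. cis (s * centred h N) = cis (- s * c) * exp (stat (\<lambda>x. \<i> * complex_of_real (s * h x)) N)"
      using AE_stat_linear[OF lin h]
    proof eventually_elim
      case (elim N)
      have eq: "s * centred h N = - s * c + s * stat h N" by (simp add: centred_def c_def algebra_simps)
      show ?case unfolding elim eq cis_conv_exp[symmetric] by (rule cis_mult[symmetric])
    qed
    show "(\<lambda>N. cis (s * centred h N)) \<in> borel_measurable P" "(\<lambda>N. cis (- s * c) * exp (stat (\<lambda>x. \<i> * complex_of_real (s * h x)) N)) \<in> borel_measurable P"
      using centred_measurable[OF h] measurable_stat[OF z] by (auto simp: cis_conv_exp)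
  qed
  also have "\<dots> = cis (- s * c) * exp (LINT x|M. exp (\<i> * complex_of_real (s * h x)) - 1)"
    using exponential_moment_stat[OF z] by simp
  also have "cmod \<dots> = exp (Re (LINT x|M. exp (\<i> * complex_of_real (s * h x)) - 1))" by (simp add: norm_mult)
  also have "Re (LINT x|M. exp (\<i> * complex_of_real (s * h x)) - 1) = (LINT x|M. Re (exp (\<i> * complex_of_real (s * h x)) - 1))"
  proof (rule integral_Re[symmetric])
    have "step_function M (\<lambda>x. exp (\<i> * complex_of_real (s * h x)) - 1)"
      using step_function_compose[OF h, of "\<lambda>r. exp (\<i> * complex_of_real (s * r)) - 1"] by simp
    then show "integrable M (\<lambda>x. exp (\<i> * complex_of_real (s * h x)) - 1)" by (rule step_function_integral)
  qed
  also have "\<dots> = (LINT x|M. - (1 - cos (s * h x)))"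
    unfolding cis_conv_exp[symmetric] by (intro Bochner_Integration.integral_cong) auto
  also have "\<dots> = - (LINT x|M. 1 - cos (s * h x))" by (rule Bochner_Integration.integral_minus)
  finally show ?thesis .
qed

lemma characteristic_function_limit:
  assumes G: "G \<in> borel_measurable P" and H: "\<And>n. H n \<in> borel_measurable P"
    and sq: "\<And>n. integrable P (\<lambda>N. (G N - H n N)\<^sup>2)"
    and lim: "(\<lambda>n. LINT N|P. (G N - H n N)\<^sup>2) \<longlonglongrightarrow> 0"
  shows "(\<lambda>n. LINT N|P. cis (s * H n N)) \<longlonglongrightarrow> (LINT N|P. cis (s * G N))"
proof -
  have cisI: "integrable P (\<lambda>N. cis (s * F N))" if "F \<in> borel_measurable P" for F :: "'a measure \<Rightarrow> real"
    by (rule integrable_const_bound[of _ 1]) (use that in \<open>auto simp: cis_conv_exp\<close>)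
  have "norm ((LINT N|P. cis (s * H n N)) - (LINT N|P. cis (s * G N))) \<le> \<bar>s\<bar> * sqrt (LINT N|P. (G N - H n N)\<^sup>2)" for n
  proof -
    have i1: "integrable P (\<lambda>N. \<bar>G N - H n N\<bar> * 1)"
      using sq G H by (intro integrable_mult_L2) auto
    have "(LINT N|P. cis (s * H n N)) - (LINT N|P. cis (s * G N)) = (LINT N|P. cis (s * H n N) - cis (s * G N))"
      using cisI G H by simp
    also have "norm \<dots> \<le> (LINT N|P. norm (cis (s * H n N) - cis (s * G N)))" by (rule integral_norm_bound)
    also have "\<dots> \<le> (LINT N|P. \<bar>s\<bar> * (\<bar>G N - H n N\<bar> * 1))"
    proof (rule integral_mono)
      show "integrable P (\<lambda>N. norm (cis (s * H n N) - cis (s * G N)))" using cisI G H by (intro integrable_norm) auto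
      show "integrable P (\<lambda>N. \<bar>s\<bar> * (\<bar>G N - H n N\<bar> * 1))" using i1 by (rule integrable_mult_right)
      fix N
      have "norm (cis (s * H n N) - cis (s * G N)) \<le> \<bar>s * H n N - s * G N\<bar>"
      proof -
        have "cis (s * H n N) - cis (s * G N) = cis (s * G N) * (cis (s * H n N - s * G N) - 1)"
          by (simp add: right_diff_distrib cis_mult)
        then have "norm (cis (s * H n N) - cis (s * G N)) = cmod (cis (s * H n N - s * G N) - 1)" by (simp add: norm_mult)
        also have "\<dots> \<le> \<bar>s * H n N - s * G N\<bar>"
          using iexp_approx1[of "s * H n N - s * G N" 0] by (simp add: cis_conv_exp)
        finally show ?thesis .
      qed
      also have "\<dots> = \<bar>s\<bar> * (\<bar>G N - H n N\<bar> * 1)" by (simp add: abs_mult[symmetric] right_diff_distrib abs_minus_commute)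
      finally show "norm (cis (s * H n N) - cis (s * G N)) \<le> \<bar>s\<bar> * (\<bar>G N - H n N\<bar> * 1)" .
    qed
    also have "\<dots> = \<bar>s\<bar> * (LINT N|P. \<bar>G N - H n N\<bar> * 1)" by simp
    also have "\<dots> \<le> \<bar>s\<bar> * sqrt (LINT N|P. (G N - H n N)\<^sup>2)"
    proof (rule mult_left_mono)
      have "norm (LINT N|P. \<bar>G N - H n N\<bar> * 1) \<le> sqrt (LINT N|P. (norm \<bar>G N - H n N\<bar>)\<^sup>2) * sqrt (LINT N|P. (norm (1::real))\<^sup>2)"
        using sq G H by (intro Cauchy_Schwarz_integral) auto
      then show "(LINT N|P. \<bar>G N - H n N\<bar> * 1) \<le> sqrt (LINT N|P. (G N - H n N)\<^sup>2)" by (simp add: prob_space)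
    qed simp
    finally show ?thesis .
  qed
  note bound = this
  have "(\<lambda>n. \<bar>s\<bar> * sqrt (LINT N|P. (G N - H n N)\<^sup>2)) \<longlonglongrightarrow> \<bar>s\<bar> * sqrt 0"
    by (intro tendsto_intros lim)
  then have lim0: "(\<lambda>n. \<bar>s\<bar> * sqrt (LINT N|P. (G N - H n N)\<^sup>2)) \<longlonglongrightarrow> 0" by simp
  have "(\<lambda>n. (LINT N|P. cis (s * H n N)) - (LINT N|P. cis (s * G N))) \<longlonglongrightarrow> 0"
    by (rule Lim_null_comparison[OF always_eventually lim0]) (rule allI, rule bound)
  then show ?thesis by (rule LIM_zero_cancel)
qed

text \<open>With positive probability there are no points in \<open>A\<close> and a prescribed number of points in \<open>B\<close>, unless
  \<open>B\<close> is a null set.\<close>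

lemma dominated_counts_null:
  assumes A: "A \<in> fmeasurable M" and B: "B \<in> fmeasurable M" and disj: "A \<inter> B = {}"
    and le: "AE N in P. measure N B \<le> measure N A + c"
  shows "measure M B = 0"
proof (rule ccontr)
  assume nz: "measure M B \<noteq> 0"
  have [measurable]: "A \<in> sets M" "B \<in> sets M" using A B by auto
  have "B \<noteq> {}" using nz by auto
  then have neq: "A \<noteq> B" using disj by auto
  obtain k :: nat where k: "real k > c" using reals_Archimedean2 by blast
  have ind: "indep_vars (\<lambda>_. borel) (\<lambda>A N. emeasure N A) {A, B}"
    using poisson A B disj neq unfolding poisson_measure_def by (auto simp: disjoint_def Int_commute)
  let ?S = "\<lambda>D. if D = A then {of_nat 0} else {of_nat k :: ennreal}"
  have "prob (\<Inter>D\<in>{A, B}. (\<lambda>N. emeasure N D) -` ?S D \<inter> space P) = (\<Prod>D\<in>{A, B}. prob ((\<lambda>N. emeasure N D) -` ?S D \<inter> space P))"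
    by (rule indep_varsD_finite[OF ind]) auto
  moreover have "(\<lambda>N. emeasure N A) -` {of_nat 0} \<inter> space P = {N \<in> space P. emeasure N A = of_nat 0}"
      "(\<lambda>N. emeasure N B) -` {of_nat k} \<inter> space P = {N \<in> space P. emeasure N B = of_nat k}" by auto
  ultimately have "prob ({N \<in> space P. emeasure N A = of_nat 0} \<inter> {N \<in> space P. emeasure N B = of_nat k}) =
     prob {N \<in> space P. emeasure N A = of_nat 0} * prob {N \<in> space P. emeasure N B = of_nat k}"
    using neq by simp
  also have "\<dots> > 0"
    unfolding prob_emeasure_eq[OF A] prob_emeasure_eq[OF B]
  proof -
    have "0 < measure M B ^ k" using nz by (intro zero_less_power) (simp add: zero_less_measure_iff)
    then show "0 < measure M A ^ 0 / fact 0 * exp (- measure M A) * (measure M B ^ k / fact k * exp (- measure M B))" by simp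
  qed
  finally have pos: "prob ({N \<in> space P. emeasure N A = of_nat 0} \<inter> {N \<in> space P. emeasure N B = of_nat k}) > 0" .
  have "AE N in P. N \<notin> {N \<in> space P. emeasure N A = of_nat 0} \<inter> {N \<in> space P. emeasure N B = of_nat k}"
    using le by eventually_elim (use k in \<open>auto simp: measure_def\<close>)
  then have "prob ({N \<in> space P. emeasure N A = of_nat 0} \<inter> {N \<in> space P. emeasure N B = of_nat k}) = 0"
    by (subst (asm) prob_eq_0[symmetric]) auto
  with pos show False by simp
qed

end

section \<open>Counting variables whose image lies in the first chaos\<close>

context poisson_process
begin

text \<open>In the limit, the centred number of points of \<open>S N\<close> in \<open>B\<close> is the stochastic integral of some \<open>g\<close> in \<open>L\<^sub>2\<close>.
  As \<open>S\<close> preserves the distribution, comparing the moduli of the characteristic functions gives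
  \<open>\<integral> (1 - cos (s g)) = b (1 - cos s)\<close> for all \<open>s\<close>, where \<open>b\<close> is the measure of \<open>B\<close>. For \<open>s = 2\<pi>\<close> this makes
  \<open>g\<close> integer-valued; for \<open>s = \<pi>\<close>, together with \<open>\<integral> g\<^sup>2 = b\<close>, it restricts the values to \<open>-1\<close>, \<open>0\<close>
  and \<open>1\<close>. So the number of points of \<open>S N\<close> in \<open>B\<close> is, up to a constant, the number of points of \<open>N\<close> in
  \<open>{g = 1}\<close> minus that in \<open>{g = -1}\<close>; being nonnegative, it leaves no room for the second set.\<close>

lemma first_chaos_image_is_count:
  assumes sf: "sigma_finite_measure M" and B: "B \<in> fmeasurable M" and S: "preserves P S"
    and approx: "\<And>e. e > 0 \<Longrightarrow> \<exists>h. step_function M h \<and> (LINT N|P. (centred (indicator B) (S N) - centred h N)\<^sup>2) < e"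
  shows "\<exists>B'\<in>fmeasurable M. measure M B' = measure M B \<and> (AE N in P. measure (S N) B = measure N B')"
proof -
  interpret generating_algebra P exp_algebra by (rule generating_algebra_exp[OF sf])
  have B_sets [measurable]: "B \<in> sets M" using B by auto
  have iB: "step_function M (indicator B :: 'a \<Rightarrow> real)" by (rule step_function_indicator_real[OF B])
  note [measurable] = preserves_measurable[OF S]
  define b where "b = measure M B"
  define G where "G N = centred (indicator B) (S N)" for N
  have Gm: "G \<in> borel_measurable P" unfolding G_def using centred_measurable[OF iB] by measurable
  have iBsq: "(LINT x|M. (indicator B x :: real)\<^sup>2) = b"
  proof -
    have "(\<lambda>x. (indicator B x :: real)\<^sup>2) = indicator B" by (auto simp: indicator_def)
    then show ?thesis by (simp add: b_def sets.Int_space_eq2)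
  qed
  have G2: "integrable P (\<lambda>N. (G N)\<^sup>2)" "(LINT N|P. (G N)\<^sup>2) = b"
    using preserves_integrable[OF S centred_square(1)[OF iB]] preserves_integral[OF S, of "\<lambda>N. (centred (indicator B) N)\<^sup>2"]
      centred_square(2)[OF iB] centred_measurable[OF iB] iBsq by (simp_all add: G_def)
  have G_char: "cmod (LINT N|P. cis (s * G N)) = exp (- (b * (1 - cos s)))" for s :: real
  proof -
    have "(LINT N|P. cis (s * G N)) = (LINT N|P. cis (s * centred (indicator B) N))"
      unfolding G_def using centred_measurable[OF iB]
      by (intro preserves_integral[OF S, of "\<lambda>N. cis (s * centred (indicator B) N)"]) (simp add: cis_conv_exp)
    then have "cmod (LINT N|P. cis (s * G N)) = exp (- (LINT x|M. 1 - cos (s * indicator B x)))"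
      using cmod_characteristic_function[OF iB] by simp
    also have "(LINT x|M. 1 - cos (s * indicator B x)) = (LINT x|M. (1 - cos s) * indicator B x)"
      by (intro Bochner_Integration.integral_cong) (auto simp: indicator_def)
    also have "\<dots> = b * (1 - cos s)" by (simp add: b_def sets.Int_space_eq2)
    finally show ?thesis .
  qed
  \<comment> \<open>The rate is the one for which \<open>L2_fast_Cauchy_limit\<close> applies after the triangle inequality.\<close>
  have "\<exists>h. step_function M h \<and> (LINT N|P. (G N - centred h N)\<^sup>2) < (1 / 16) ^ n / 4" for n
    unfolding G_def by (rule approx) simp
  then obtain h where h: "\<And>n. step_function M (h n)" "\<And>n. (LINT N|P. (G N - centred (h n) N)\<^sup>2) < (1 / 16) ^ n / 4" by metis
  have hm: "h n \<in> borel_measurable M" for n using step_function_support(1)[OF h(1)] by (rule borel_measurable_simple_function)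
  have hsq: "integrable M (\<lambda>x. (h n x)\<^sup>2)" for n
    using step_function_integral(1)[OF step_function_mult[OF h(1) h(1)], of n n] by (simp add: power2_eq_square)
  note cm = centred_measurable[OF h(1)] and csq = centred_square[OF h(1)]
  have isometry: "(LINT N|P. (centred f N - centred f' N)\<^sup>2) = (LINT x|M. (f x - f' x)\<^sup>2)"
    if f: "step_function M f" "step_function M f'" for f f'
  proof -
    have d: "step_function M (\<lambda>x. f x - f' x)" using simple_bochner_integrable_compose2[of "(-)" M f f'] f by simp
    have "(LINT N|P. (centred f N - centred f' N)\<^sup>2) = (LINT N|P. (centred (\<lambda>x. f x - f' x) N)\<^sup>2)"
    proof (rule integral_cong_AE)
      show "AE N in P. (centred f N - centred f' N)\<^sup>2 = (centred (\<lambda>x. f x - f' x) N)\<^sup>2"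
        using AE_centred_diff[OF f] by eventually_elim simp
    qed (use centred_measurable[OF f(1)] centred_measurable[OF f(2)] centred_measurable[OF d] in measurable)
    then show ?thesis using centred_square(2)[OF d] by simp
  qed
  have cauchy: "(LINT x|M. (h n x - h k x)\<^sup>2) \<le> (1 / 16) ^ n" if "n \<le> k" for n k
  proof -
    have "(LINT N|P. (centred (h n) N - centred (h k) N)\<^sup>2) \<le> 2 * (LINT N|P. (centred (h n) N - G N)\<^sup>2) + 2 * (LINT N|P. (G N - centred (h k) N)\<^sup>2)"
      using cm csq Gm G2 by (intro square_distance_triangle) auto
    also have "(LINT N|P. (centred (h n) N - G N)\<^sup>2) = (LINT N|P. (G N - centred (h n) N)\<^sup>2)" by (simp add: power2_commute)
    also have "2 * \<dots> + 2 * (LINT N|P. (G N - centred (h k) N)\<^sup>2) \<le> 2 * ((1 / 16) ^ n / 4) + 2 * ((1 / 16) ^ n / 4)"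
    proof (intro add_mono mult_left_mono)
      have "(1 / 16 :: real) ^ k \<le> (1 / 16) ^ n" using that by (intro power_decreasing) auto
      then show "(LINT N|P. (G N - centred (h k) N)\<^sup>2) \<le> (1 / 16) ^ n / 4" using h(2)[of k] by linarith
    qed (use h(2)[of n] in auto)
    finally show ?thesis using isometry[OF h(1) h(1)] by simp
  qed
  obtain g where gm: "g \<in> borel_measurable M" and gsq: "integrable M (\<lambda>x. (g x)\<^sup>2)"
      and hgsq: "\<And>n. integrable M (\<lambda>x. (h n x - g x)\<^sup>2)" and hg: "(\<lambda>n. LINT x|M. (h n x - g x)\<^sup>2) \<longlonglongrightarrow> 0"
    using L2_fast_Cauchy_limit[OF hm hsq cauchy] by blast
  note lims = L2_norm_tendsto[OF hm gm hsq gsq hgsq hg]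
  have Gh: "(\<lambda>n. LINT N|P. (G N - centred (h n) N)\<^sup>2) \<longlonglongrightarrow> 0"
  proof (rule tendsto_sandwich[OF _ _ tendsto_const])
    have "(\<lambda>n. (1 / 16 :: real) ^ n / 4) \<longlonglongrightarrow> 0 / 4" by (intro tendsto_divide LIMSEQ_power_zero tendsto_const) auto
    then show "(\<lambda>n. (1 / 16 :: real) ^ n / 4) \<longlonglongrightarrow> 0" by simp
  qed (use h(2) in \<open>auto intro!: always_eventually less_imp_le\<close>)
  have Ghsq: "integrable P (\<lambda>N. (G N - centred (h n) N)\<^sup>2)" for n
    using cm csq Gm G2 by (intro integrable_square_diff) auto
  have cos_int: "integrable M (\<lambda>x. 1 - cos (s * f x))" if "f \<in> borel_measurable M" "integrable M (\<lambda>x. (f x)\<^sup>2)" for f :: "'a \<Rightarrow> real" and s :: real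
  proof (rule Bochner_Integration.integrable_bound)
    show "integrable M (\<lambda>x. (s\<^sup>2 / 2) * (f x)\<^sup>2)" using that by simp
    show "AE x in M. norm (1 - cos (s * f x)) \<le> norm ((s\<^sup>2 / 2) * (f x)\<^sup>2)"
    proof (rule AE_I2)
      fix x
      show "norm (1 - cos (s * f x)) \<le> norm ((s\<^sup>2 / 2) * (f x)\<^sup>2)"
        using one_minus_cos_le[of "s * f x"] cos_le_one[of "s * f x"] by (simp add: power_mult_distrib)
    qed
  qed (use that in measurable)
  have g_cos: "(LINT x|M. 1 - cos (s * g x)) = b * (1 - cos s)" for s :: real
  proof -
    have "(\<lambda>n. cmod (LINT N|P. cis (s * centred (h n) N))) \<longlonglongrightarrow> cmod (LINT N|P. cis (s * G N))"
      by (intro tendsto_norm characteristic_function_limit[OF Gm cm Ghsq Gh])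
    then have "(\<lambda>n. exp (- (LINT x|M. 1 - cos (s * h n x)))) \<longlonglongrightarrow> exp (- (b * (1 - cos s)))"
      unfolding cmod_characteristic_function[OF h(1)] G_char .
    then have "(\<lambda>n. ln (exp (- (LINT x|M. 1 - cos (s * h n x))))) \<longlonglongrightarrow> ln (exp (- (b * (1 - cos s))))"
      by (intro tendsto_ln) auto
    then have "(\<lambda>n. - (- (LINT x|M. 1 - cos (s * h n x)))) \<longlonglongrightarrow> - (- (b * (1 - cos s)))"
      unfolding ln_exp by (rule tendsto_minus)
    then have 1: "(\<lambda>n. LINT x|M. 1 - cos (s * h n x)) \<longlonglongrightarrow> b * (1 - cos s)" by simp
    have "(\<lambda>n. (LINT x|M. 1 - cos (s * h n x)) - (LINT x|M. 1 - cos (s * g x))) \<longlonglongrightarrow> 0"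
    proof (rule Lim_null_comparison[OF always_eventually])
      have "(\<lambda>n. (s\<^sup>2 / 2) * (LINT x|M. \<bar>h n x + g x\<bar> * \<bar>h n x - g x\<bar>)) \<longlonglongrightarrow> (s\<^sup>2 / 2) * 0"
        by (intro tendsto_mult tendsto_const lims(1))
      then show "(\<lambda>n. (s\<^sup>2 / 2) * (LINT x|M. \<bar>h n x + g x\<bar> * \<bar>h n x - g x\<bar>)) \<longlonglongrightarrow> 0" by simp
      show "\<forall>n. norm ((LINT x|M. 1 - cos (s * h n x)) - (LINT x|M. 1 - cos (s * g x))) \<le> (s\<^sup>2 / 2) * (LINT x|M. \<bar>h n x + g x\<bar> * \<bar>h n x - g x\<bar>)"
      proof
        fix n
        note i = cos_int[OF hm[of n] hsq[of n], of s] cos_int[OF gm gsq, of s]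
        have "(LINT x|M. 1 - cos (s * h n x)) - (LINT x|M. 1 - cos (s * g x)) = (LINT x|M. (1 - cos (s * h n x)) - (1 - cos (s * g x)))"
          using i by (rule Bochner_Integration.integral_diff[symmetric])
        also have "norm \<dots> \<le> (LINT x|M. norm ((1 - cos (s * h n x)) - (1 - cos (s * g x))))" by (rule integral_norm_bound)
        also have "\<dots> \<le> (LINT x|M. (s\<^sup>2 / 2) * (\<bar>h n x + g x\<bar> * \<bar>h n x - g x\<bar>))"
        proof (rule integral_mono)
          show "integrable M (\<lambda>x. norm ((1 - cos (s * h n x)) - (1 - cos (s * g x))))"
            by (intro integrable_norm Bochner_Integration.integrable_diff i)
          show "integrable M (\<lambda>x. (s\<^sup>2 / 2) * (\<bar>h n x + g x\<bar> * \<bar>h n x - g x\<bar>))"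
            by (intro integrable_mult_right lims(3))
          fix x
          have "norm ((1 - cos (s * h n x)) - (1 - cos (s * g x))) = \<bar>cos (s * h n x) - cos (s * g x)\<bar>" by simp
          also have "\<dots> \<le> \<bar>s * h n x + s * g x\<bar> * \<bar>s * h n x - s * g x\<bar> / 2" by (rule abs_cos_diff_le)
          also have "\<dots> = (s\<^sup>2 / 2) * (\<bar>h n x + g x\<bar> * \<bar>h n x - g x\<bar>)"
            by (simp add: distrib_left[symmetric] right_diff_distrib[symmetric] abs_mult power2_eq_square)
          finally show "norm ((1 - cos (s * h n x)) - (1 - cos (s * g x))) \<le> (s\<^sup>2 / 2) * (\<bar>h n x + g x\<bar> * \<bar>h n x - g x\<bar>)" .
        qed
        finally show "norm ((LINT x|M. 1 - cos (s * h n x)) - (LINT x|M. 1 - cos (s * g x))) \<le> (s\<^sup>2 / 2) * (LINT x|M. \<bar>h n x + g x\<bar> * \<bar>h n x - g x\<bar>)"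
          by simp
      qed
    qed
    then have "(\<lambda>n. LINT x|M. 1 - cos (s * h n x)) \<longlonglongrightarrow> (LINT x|M. 1 - cos (s * g x))" by (rule LIM_zero_cancel)
    with 1 show ?thesis using LIMSEQ_unique by blast
  qed
  have g_norm: "(LINT x|M. (g x)\<^sup>2) = b"
  proof -
    have "(\<lambda>n. LINT N|P. (centred (h n) N)\<^sup>2) \<longlonglongrightarrow> (LINT N|P. (G N)\<^sup>2)"
    proof (rule L2_norm_tendsto(2)[OF cm Gm csq(1) G2(1)])
      show "integrable P (\<lambda>N. (centred (h n) N - G N)\<^sup>2)" for n using Ghsq[of n] by (simp add: power2_commute)
      show "(\<lambda>n. LINT N|P. (centred (h n) N - G N)\<^sup>2) \<longlonglongrightarrow> 0" using Gh by (simp add: power2_commute)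
    qed
    then have "(\<lambda>n. LINT x|M. (h n x)\<^sup>2) \<longlonglongrightarrow> b" using csq(2) G2(2) by simp
    then show ?thesis using lims(2) LIMSEQ_unique by blast
  qed
  \<comment> \<open>\<open>s = 2\<pi>\<close>: \<open>g\<close> is integer-valued\<close>
  have "AE x in M. 1 - cos (2 * pi * g x) = 0"
    using g_cos[of "2 * pi"] integral_nonneg_eq_0_iff_AE[OF cos_int[OF gm gsq, of "2 * pi"]] by simp
  then have g_int: "AE x in M. \<exists>k::int. g x = k"
  proof eventually_elim
    case (elim x)
    then have "cos (2 * pi * g x) = 1" by simp
    then obtain k :: int where "2 * pi * g x = of_int k * 2 * pi" unfolding cos_one_2pi_int by blast
    then show ?case by (intro exI[of _ k]) simp
  qed
  \<comment> \<open>\<open>s = \<pi>\<close>: comparison with the norm confines \<open>g\<close> to \<open>{-1, 0, 1}\<close>\<close>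
  have sq1: "1 \<le> (real_of_int k)\<^sup>2" if "k \<noteq> 0" for k
  proof -
    have "1 \<le> \<bar>k\<bar>" using that by simp
    then have "1 \<le> \<bar>real_of_int k\<bar>" by (metis of_int_1_le_iff of_int_abs)
    then have "1\<^sup>2 \<le> \<bar>real_of_int k\<bar>\<^sup>2" by (intro power_mono) auto
    then show ?thesis by simp
  qed
  have pos: "AE x in M. 0 \<le> 2 * (g x)\<^sup>2 - (1 - cos (pi * g x))"
    using g_int
  proof eventually_elim
    case (elim x)
    then obtain k :: int where k: "g x = k" by blast
    show ?case
    proof (cases "k = 0")
      case False
      then show ?thesis using sq1[OF False] cos_ge_minus_one[of "pi * g x"] unfolding k by linarith
    qed (simp add: k)
  qed
  have "(LINT x|M. 2 * (g x)\<^sup>2 - (1 - cos (pi * g x))) = 0"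
    using gsq cos_int[OF gm gsq, of pi] g_norm g_cos[of pi] by simp
  then have "AE x in M. 2 * (g x)\<^sup>2 - (1 - cos (pi * g x)) = 0"
    using integral_nonneg_eq_0_iff_AE[OF _ pos] gsq cos_int[OF gm gsq, of pi] by simp
  then have g_vals: "AE x in M. g x = 0 \<or> g x = 1 \<or> g x = -1"
    using g_int
  proof eventually_elim
    case (elim x)
    then obtain k :: int where k: "g x = k" by blast
    have "(g x)\<^sup>2 \<le> 1" using elim(1) cos_ge_minus_one[of "pi * g x"] by linarith
    then have "\<bar>g x\<bar> \<le> 1" by (simp add: abs_square_le_1)
    then have "\<bar>k\<bar> \<le> 1" unfolding k by (metis of_int_abs of_int_le_1_iff)
    then have "k = 0 \<or> k = 1 \<or> k = -1" by linarith
    then show ?case unfolding k by auto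
  qed
  define C where "C = {x \<in> space M. g x = 1}"
  define D where "D = {x \<in> space M. g x = -1}"
  have CD_sets [measurable]: "C \<in> sets M" "D \<in> sets M" unfolding C_def D_def using gm by measurable
  have fin: "A \<in> fmeasurable M" if A: "A \<in> sets M" "\<And>x. x \<in> A \<Longrightarrow> (g x)\<^sup>2 = 1" for A
  proof -
    have "integrable M (indicator A :: 'a \<Rightarrow> real)"
      by (rule Bochner_Integration.integrable_bound[OF gsq]) (use A in \<open>auto simp: indicator_def intro!: AE_I2\<close>)
    then show ?thesis using A(1) by (simp add: integrable_indicator_iff sets.Int_space_eq2 fmeasurable_def)
  qed
  have C: "C \<in> fmeasurable M" and D: "D \<in> fmeasurable M"
    using fin[OF CD_sets(1)] fin[OF CD_sets(2)] by (auto simp: C_def D_def)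
  have CD: "C \<inter> D = {}" by (auto simp: C_def D_def)
  \<comment> \<open>\<open>g\<close> as a step function, so that it has a centred statistic\<close>
  define g' where "g' x = (indicator C x - indicator D x :: real)" for x
  note iC = step_function_indicator_real[OF C] and iD = step_function_indicator_real[OF D]
  have g': "step_function M g'" unfolding g'_def[abs_def]
    using simple_bochner_integrable_compose2[of "(-)" M "indicator C :: 'a \<Rightarrow> real" "indicator D"] iC iD by simp
  have gg': "AE x in M. g x = g' x"
    using g_vals AE_space by eventually_elim (auto simp: g'_def indicator_def C_def D_def)
  have g'm: "g' \<in> borel_measurable M" using step_function_support(1)[OF g'] by (rule borel_measurable_simple_function)
  have bCD: "b = measure M C + measure M D"
  proof -
    have "b = (LINT x|M. (g' x)\<^sup>2)" unfolding g_norm[symmetric]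
      using gg' gm g'm by (intro integral_cong_AE) auto
    also have "\<dots> = (LINT x|M. indicator C x + indicator D x)"
      using CD by (intro Bochner_Integration.integral_cong) (auto simp: g'_def indicator_def)
    also have "\<dots> = measure M C + measure M D"
      using C D by (subst Bochner_Integration.integral_add) (auto simp: fmeasurable_def sets.Int_space_eq2)
    finally show ?thesis .
  qed
  have "(LINT N|P. (G N - centred g' N)\<^sup>2) = 0"
  proof -
    have "(LINT N|P. (G N - centred g' N)\<^sup>2) \<le> 2 * (LINT N|P. (G N - centred (h n) N)\<^sup>2) + 2 * (LINT x|M. (h n x - g x)\<^sup>2)" for n
    proof -
      have "(LINT N|P. (G N - centred g' N)\<^sup>2) \<le> 2 * (LINT N|P. (G N - centred (h n) N)\<^sup>2) + 2 * (LINT N|P. (centred (h n) N - centred g' N)\<^sup>2)"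
        using cm csq Gm G2 centred_measurable[OF g'] centred_square[OF g'] by (intro square_distance_triangle) auto
      also have "(LINT N|P. (centred (h n) N - centred g' N)\<^sup>2) = (LINT x|M. (h n x - g' x)\<^sup>2)" by (rule isometry[OF h(1) g'])
      also have "\<dots> = (LINT x|M. (h n x - g x)\<^sup>2)"
        using gg' hm gm g'm by (intro integral_cong_AE) auto
      finally show ?thesis .
    qed
    moreover have "(\<lambda>n. 2 * (LINT N|P. (G N - centred (h n) N)\<^sup>2) + 2 * (LINT x|M. (h n x - g x)\<^sup>2)) \<longlonglongrightarrow> 2 * 0 + 2 * 0"
      by (intro tendsto_intros Gh hg)
    ultimately have "(LINT N|P. (G N - centred g' N)\<^sup>2) \<le> 2 * 0 + 2 * 0"
      by (intro LIMSEQ_le_const) auto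
    then show ?thesis by (intro antisym Bochner_Integration.integral_nonneg) simp_all
  qed
  moreover have "integrable P (\<lambda>N. (G N - centred g' N)\<^sup>2)"
    using Gm G2 centred_measurable[OF g'] centred_square[OF g'] by (intro integrable_square_diff) auto
  ultimately have "AE N in P. (G N - centred g' N)\<^sup>2 = 0"
    by (subst (asm) integral_nonneg_eq_0_iff_AE) auto
  moreover have "AE N in P. centred g' N = centred (indicator C) N - centred (indicator D) N"
    unfolding g'_def[abs_def] by (rule AE_centred_diff[OF iC iD])
  moreover have "AE N in P. N \<in> space P \<and> S N \<in> space P"
    using measurable_space[OF preserves_measurable[OF S]] by (intro AE_I2) auto
  ultimately have eq: "AE N in P. measure (S N) B = measure N C - measure N D + 2 * measure M D"
    by eventually_elim
      (simp add: G_def centred_def stat_indicator b_def[symmetric] bCD sets.Int_space_eq2)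
  have "measure M D = 0"
  proof (rule dominated_counts_null[OF C D CD])
    show "AE N in P. measure N D \<le> measure N C + 2 * measure M D"
      using eq by eventually_elim (metis diff_add_eq diff_ge_0_iff_ge measure_nonneg)
  qed
  moreover from this have "D \<in> null_sets M" using D by (auto simp: null_sets_def emeasure_eq_measure2)
  from AE_null[OF this] have "AE N in P. measure N D = 0" by eventually_elim (simp add: measure_def)
  ultimately have "AE N in P. measure (S N) B = measure N C" "measure M C = measure M B"
    using eq bCD by (auto elim: eventually_elim2 simp: b_def)
  then show ?thesis using C by blast
qed

end

section \<open>Roots of the Poisson suspension\<close>

lemma preserves_cong_AE:
  assumes "preserves M R" "AE x in M. R x = T x" "T \<in> M \<rightarrow>\<^sub>M M"
  shows "preserves M T"
  using assms distr_cong_AE[of M M M M R T] by (auto simp: preserves_def)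

lemma commute_root_AE:
  assumes S: "preserves P S" and root: "AE x in P. (S ^^ n) x = \<Phi> x"
  shows "AE x in P. S (\<Phi> x) = \<Phi> (S x)"
  using root preserves_AE[OF S root] by eventually_elim (metis funpow_swap1)

lemma commute_pow_AE:
  assumes \<Phi>: "preserves P \<Phi>" and comm: "AE x in P. S (\<Phi> x) = \<Phi> (S x)"
  shows "AE x in P. S ((\<Phi> ^^ k) x) = (\<Phi> ^^ k) (S x)"
proof (induction k)
  case (Suc k)
  show ?case using preserves_AE[OF preserves_funpow[OF \<Phi>] comm, of k] Suc
    by eventually_elim simp
qed simp

context poisson_process
begin

lemma measure_suspension:
  assumes "T \<in> M \<rightarrow>\<^sub>M M" "N \<in> space P" "A \<in> sets M"
  shows "measure (poisson_suspension M T N) A = measure N (T -` A \<inter> space M)"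
  unfolding poisson_suspension_def
  using assms configuration_sets[OF assms(2)] by (subst measure_distr) (auto cong: measurable_cong_sets)

text \<open>The centred count of \<open>B\<close>, composed with \<open>S\<close>, keeps its covariances under the suspension because \<open>S\<close>
  commutes with it. So it stays in the first chaos.\<close>

lemma commutant_acts_on_sets:
  assumes sf: "sigma_finite_measure M" and T: "preserves M T" and perp: "property_perp M T"
    and \<Phi>: "preserves P (poisson_suspension M T)" and S: "preserves P S"
    and comm: "AE N in P. S (poisson_suspension M T N) = poisson_suspension M T (S N)"
    and B: "B \<in> fmeasurable M"
  shows "\<exists>B'\<in>fmeasurable M. measure M B' = measure M B \<and> (AE N in P. measure (S N) B = measure N B')"
proof (rule first_chaos_image_is_count[OF sf B S])
  fix e :: real assume e: "e > 0"
  let ?\<Phi> = "poisson_suspension M T"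
  define f where "f = (indicator B :: 'a \<Rightarrow> real)"
  have f: "step_function M f" unfolding f_def by (rule step_function_indicator_real[OF B])
  define G where "G N = centred f (S N)" for N
  have Sm: "S \<in> P \<rightarrow>\<^sub>M P" by (rule preserves_measurable[OF S])
  have G: "G \<in> borel_measurable P" unfolding G_def using measurable_comp[OF Sm centred_measurable[OF f]] by (simp add: centred_def[abs_def] Fun.comp_def)
  have G2: "integrable P (\<lambda>N. (G N)\<^sup>2)" unfolding G_def by (rule preserves_integrable[OF S centred_square(1)[OF f]])
  have G0: "(LINT N|P. G N) = 0"
    unfolding G_def using preserves_integral[OF S centred_measurable[OF f]] centred_moments(2)[OF f f] by simp
  have cov: "(LINT N|P. G ((?\<Phi> ^^ k) N) * G N) = (LINT x|M. f ((T ^^ k) x) * f x)" for k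
  proof -
    have fk: "step_function M (\<lambda>x. f ((T ^^ k) x))" by (rule step_function_preserves[OF preserves_funpow[OF T] f])
    have "(LINT N|P. G ((?\<Phi> ^^ k) N) * G N) = (LINT N|P. centred (\<lambda>x. f ((T ^^ k) x)) (S N) * centred f (S N))"
    proof (rule integral_cong_AE)
      show "AE N in P. G ((?\<Phi> ^^ k) N) * G N = centred (\<lambda>x. f ((T ^^ k) x)) (S N) * centred f (S N)"
        using commute_pow_AE[OF \<Phi> comm, of k] AE_space
        by eventually_elim (simp add: G_def centred_suspension_pow[OF T f measurable_space[OF Sm]])
      have "(\<lambda>N. G ((?\<Phi> ^^ k) N)) \<in> borel_measurable P"
        using measurable_compose[OF preserves_measurable[OF preserves_funpow[OF \<Phi>]] G] .
      then show "(\<lambda>N. G ((?\<Phi> ^^ k) N) * G N) \<in> borel_measurable P" using G by simp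
      show "(\<lambda>N. centred (\<lambda>x. f ((T ^^ k) x)) (S N) * centred f (S N)) \<in> borel_measurable P"
        using measurable_compose[OF Sm centred_measurable[OF fk]] measurable_compose[OF Sm centred_measurable[OF f]] by simp
    qed
    also have "\<dots> = (LINT N|P. centred (\<lambda>x. f ((T ^^ k) x)) N * centred f N)"
      using centred_measurable[OF fk] centred_measurable[OF f]
      by (intro preserves_integral[OF S, of "\<lambda>N. centred (\<lambda>x. f ((T ^^ k) x)) N * centred f N"]) simp
    also have "\<dots> = (LINT x|M. f ((T ^^ k) x) * f x)" by (rule centred_moments(4)[OF fk f])
    finally show ?thesis .
  qed
  show "\<exists>h. step_function M h \<and> (LINT N|P. (centred (indicator B) (S N) - centred h N)\<^sup>2) < e"
    using first_chaos[OF sf G G2 G0 perp_orthogonal_to_higher_chaos[OF T perp \<Phi> G G2 f cov] e]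
    unfolding G_def f_def .
qed

text \<open>A root \<open>S\<close> acts on the sets of finite measure by \<open>\<phi>\<close>, where \<open>\<phi> B\<close> is the set whose count is the count of
  \<open>B\<close> composed with \<open>S\<close>. The relation between \<open>S\<close> and the suspension turns into \<open>\<phi>\<^sup>n B = T\<^sup>-\<^sup>1 B\<close>.\<close>

lemma has_no_roots_suspension:
  assumes sf: "sigma_finite_measure M" and aut: "automorphism M T" and erg: "ergodic M T"
    and perp: "property_perp M T" and comps: "\<And>n::nat. n > 0 \<Longrightarrow> has_exactly_ergodic_sets M (T ^^ n) n"
  shows "has_no_roots P (poisson_suspension M T)"
  unfolding has_no_roots_def
proof safe
  fix n :: nat and S assume n: "n \<ge> 2" and S_aut: "automorphism P S"
    and root: "AE N in P. (S ^^ n) N = poisson_suspension M T N"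
  let ?\<Phi> = "poisson_suspension M T"
  have T: "preserves M T" and S: "preserves P S" using aut S_aut by (auto simp: automorphism_iff)
  have Tm: "T \<in> M \<rightarrow>\<^sub>M M" and Sm: "S \<in> P \<rightarrow>\<^sub>M P" using T S by (auto intro: preserves_measurable)
  have \<Phi>: "preserves P ?\<Phi>"
    by (rule preserves_cong_AE[OF preserves_funpow[OF S] root measurable_suspension[OF Tm]])
  have comm: "AE N in P. S (?\<Phi> N) = ?\<Phi> (S N)" by (rule commute_root_AE[OF S root])
  have "\<forall>B. \<exists>B'. B \<in> fmeasurable M \<longrightarrow> B' \<in> fmeasurable M \<and> measure M B' = measure M B \<and> (AE N in P. measure (S N) B = measure N B')"
    using commutant_acts_on_sets[OF sf T perp \<Phi> S comm] by blast
  then obtain \<phi> where \<phi>: "\<And>B. B \<in> fmeasurable M \<Longrightarrow> \<phi> B \<in> fmeasurable M"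
      "\<And>B. B \<in> fmeasurable M \<Longrightarrow> measure M (\<phi> B) = measure M B"
      "\<And>B. B \<in> fmeasurable M \<Longrightarrow> AE N in P. measure (S N) B = measure N (\<phi> B)"
    by metis
  have TB: "T -` B \<inter> space M \<in> fmeasurable M" if "B \<in> fmeasurable M" for B
    by (rule preserves_fmeasurable[OF T that])
  show False
  proof (rule no_root_of_set_map[OF sf aut erg comps[of n] n, of \<phi>])
    show "\<phi> B \<in> fmeasurable M" if "B \<in> fmeasurable M" for B by (rule \<phi>(1)[OF that])
    show "measure M (\<phi> B \<inter> \<phi> B') = measure M (B \<inter> B')" if B: "B \<in> fmeasurable M" "B' \<in> fmeasurable M" for B B'
    proof -
      note [measurable] = fmeasurableD[OF B(1)] fmeasurableD[OF B(2)] fmeasurableD[OF \<phi>(1)[OF B(1)]] fmeasurableD[OF \<phi>(1)[OF B(2)]]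
      have m: "(\<lambda>N. measure N B * measure N B') \<in> borel_measurable P" by measurable
      have "(LINT N|P. measure N (\<phi> B) * measure N (\<phi> B')) = (LINT N|P. measure (S N) B * measure (S N) B')"
      proof (rule integral_cong_AE)
        show "AE N in P. measure N (\<phi> B) * measure N (\<phi> B') = measure (S N) B * measure (S N) B'"
          using \<phi>(3)[OF B(1)] \<phi>(3)[OF B(2)] by eventually_elim simp
        show "(\<lambda>N. measure (S N) B * measure (S N) B') \<in> borel_measurable P" by (rule measurable_compose[OF Sm m])
      qed measurable
      also have "\<dots> = (LINT N|P. measure N B * measure N B')" by (rule preserves_integral[OF S m])
      finally show ?thesis
        using count_product_moment(2)[OF B] count_product_moment(2)[OF \<phi>(1)[OF B(1)] \<phi>(1)[OF B(2)]] \<phi>(2)[OF B(1)] \<phi>(2)[OF B(2)] by simp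
    qed
    show "AE x in M. x \<in> \<phi> (T -` B \<inter> space M) \<longleftrightarrow> T x \<in> \<phi> B" if B: "B \<in> fmeasurable M" for B
    proof -
      have "AE N in P. measure N (\<phi> (T -` B \<inter> space M)) = measure N (T -` \<phi> B \<inter> space M)"
        using \<phi>(3)[OF TB[OF B]] comm preserves_AE[OF \<Phi> \<phi>(3)[OF B]] AE_space
      proof eventually_elim
        case (elim N)
        have "measure N (\<phi> (T -` B \<inter> space M)) = measure (?\<Phi> (S N)) B"
          using elim measurable_space[OF Sm elim(4)] B by (simp add: measure_suspension[OF Tm] fmeasurableD)
        also have "\<dots> = measure (?\<Phi> N) (\<phi> B)" using elim by simp
        also have "\<dots> = measure N (T -` \<phi> B \<inter> space M)"
          using measure_suspension[OF Tm elim(4)] \<phi>(1)[OF B] by (simp add: fmeasurableD)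
        finally show ?case .
      qed
      then have "AE x in M. x \<in> \<phi> (T -` B \<inter> space M) \<longleftrightarrow> x \<in> T -` \<phi> B \<inter> space M"
        by (intro indicator_statistics_eq_AE \<phi>(1) TB B)
      then show ?thesis using AE_space by eventually_elim auto
    qed
    show "AE x in M. x \<in> (\<phi> ^^ n) B \<longleftrightarrow> T x \<in> B" if B: "B \<in> fmeasurable M" for B
    proof -
      have pow: "(\<phi> ^^ k) B \<in> fmeasurable M \<and> (AE N in P. measure ((S ^^ k) N) B = measure N ((\<phi> ^^ k) B))" for k
      proof (induction k)
        case (Suc k)
        have "AE N in P. measure ((S ^^ k) (S N)) B = measure (S N) ((\<phi> ^^ k) B)"
          using preserves_AE[OF S conjunct2[OF Suc]] .
        then show ?case using \<phi>(3)[OF conjunct1[OF Suc]] \<phi>(1)[OF conjunct1[OF Suc]]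
          by (auto elim: eventually_elim2 simp: funpow_swap1)
      qed (simp add: B)
      have "AE N in P. measure N ((\<phi> ^^ n) B) = measure N (T -` B \<inter> space M)"
        using conjunct2[OF pow[of n]] root AE_space
        by eventually_elim (use B measure_suspension[OF Tm] in \<open>simp add: fmeasurableD\<close>)
      then have "AE x in M. x \<in> (\<phi> ^^ n) B \<longleftrightarrow> x \<in> T -` B \<inter> space M"
        by (intro indicator_statistics_eq_AE conjunct1[OF pow] TB B)
      then show ?thesis using AE_space by eventually_elim auto
    qed
  qed (use n in auto)
qed

end

theorem theorem1:
  fixes M :: "'a measure" and T :: "'a \<Rightarrow> 'a"
  assumes "standard_measure_space M"
    and "automorphism M T"
    and "ergodic M T"
    and "property_perp M T"
    and "\<And>n::nat. n > 0 \<Longrightarrow> has_exactly_ergodic_sets M (T ^^ n) n"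
  shows "has_no_roots M T \<and>
    (\<forall>P. poisson_measure M P \<longrightarrow> has_no_roots P (poisson_suspension M T))"
proof (intro conjI allI impI)
  have sf: "sigma_finite_measure M" using assms(1) by (simp add: standard_measure_space_def)
  show "has_no_roots M T" by (rule has_no_roots_base[OF sf assms(2,3,5)])
  fix P assume "poisson_measure M P"
  then interpret poisson_process M P by unfold_locales
  show "has_no_roots P (poisson_suspension M T)" by (rule has_no_roots_suspension[OF sf assms(2-5)])
qed

end
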